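(* Let $\alpha_0=(1+\sqrt5)/2$. For every real $q$ with $0<q<1$ the following identities hold: \begin{enumerate} \item $\displaystyle\int_0^q \frac{E(t)^5}{E(t^5)}\, r(t)^5\,\frac{dt}{t} = r(q)^5$, and $r(q)^5=\sqrt{\alpha_0^{10}+1}-\alpha_0^5$ when $q=e^{-2\pi/\sqrt5}$; \item $\displaystyle\int_0^q \frac{E(t^2)^8E(t^3)^6}{E(t)^{10}}\,dt = q\frac{E(q^2)E(q^6)^5}{E(q)^5E(q^3)}$, and this equals $\frac{\sqrt2}{12}$, $\frac{\sqrt3-1}{24}$, $\frac{\sqrt6-2}{36}$ when $q=e^{-2\pi/\sqrt6}$, $e^{-2\pi/\sqrt3}$, $e^{-2\pi/\sqrt2}$ respectively; \item $\displaystyle\int_0^q \frac{E(t)^8E(t^6)^6}{E(t^2)^{10}}\,dt = q\frac{E(q)^4E(q^6)^8}{E(q^2)^8E(q^3)^4}$, and this equals $\frac{(\sqrt2-1)^2}{3}$, $\frac{(2-\sqrt3)^2}{3}$, $\frac{(\sqrt6-2)^2}{18}$ when $q=e^{-2\pi/\sqrt6}$, $e^{-2\pi/\sqrt3}$, $e^{-2\pi/\sqrt2}$ respectively; \item $\displaystyle\int_0^q \frac{E(t)^6E(t^6)^8}{E(t^3)^{10}}\,dt = q\frac{E(q)^3E(q^6)^9}{E(q^2)^3E(q^3)^9}$, and this equals $\frac{3\sqrt2-4}{4}$, $\frac{(\sqrt3-1)^3}{16}$, $\frac{(\sqrt6-2)^3}{8}$ when $q=e^{-2\pi/\sqrt6}$,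 $e^{-2\pi/\sqrt3}$, $e^{-2\pi/\sqrt2}$ respectively; \item $\displaystyle\int_0^q \frac{E(t^2)^8E(t^4)^4}{E(t)^{8}}\,dt = q\frac{E(q^2)^2E(q^8)^4}{E(q)^4E(q^4)^2}$, and this equals $\frac{1}{\sqrt{32}}$ when $q=e^{-\pi/\sqrt2}$; \item $\displaystyle\int_0^q \frac{E(t^3)^{10}}{E(t)^{6}}\,dt = q\frac{E(q^9)^3}{E(q)^3}$, and this equals $\frac{1}{3\sqrt3}$ when $q=e^{-2\pi/3}$. \end{enumerate}
   Context: For $|q|<1$, $E(q)=\prod_{j=1}^\infty(1-q^j)$ (Euler's product). The Rogers–Ramanujan continued fraction in product form is $r(q)=q^{1/5}\prod_{j=1}^\infty\frac{(1-q^{5j-4})(1-q^{5j-1})}{(1-q^{5j-3})(1-q^{5j-2})}$ (real positive fifth root for $0<q<1$), so $r(q)^5=q\prod_{j\ge1}\frac{(1-q^{5j-4})^5(1-q^{5j-1})^5}{(1-q^{5j-3})^5(1-q^{5j-2})^5}$. *)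

theory Defs
  imports "HOL-Analysis.Analysis"
begin

definition euler_E :: "real \<Rightarrow> real" where
  "euler_E q = (\<Prod>j. 1 - q ^ (j + 1))"

text \<open>Rogers--Ramanujan continued fraction in product form (real positive fifth root of q).\<close>
definition rr_frac :: "real \<Rightarrow> real" where
  "rr_frac q = q powr (1/5) *
     (\<Prod>j. ((1 - q ^ (5*j + 1)) * (1 - q ^ (5*j + 4))) /
           ((1 - q ^ (5*j + 2)) * (1 - q ^ (5*j + 3))))"

definition alpha0 :: real where
  "alpha0 = (1 + sqrt 5) / 2"

end

theory Submission
  imports Defs
begin

text \<open>
  Put \<open>\<wp>(x; q) = \<Sum> x q^n / (1 - x q^n)^2\<close>, the sum running over all integers \<open>n\<close>. By the Jacobi triple product
  \<open>\<theta>(x y) \<theta>(x / y)\<close> is a bilinear form of rank two, which gives the three-term relation of theta functions and, in the limit,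
  the classical product formula for \<open>\<wp>(x; q) - \<wp>(y; q)\<close>. If \<open>x\<close> and \<open>y\<close> are roots of unity, or one is a root of unity and
  the other a power of the nome, the left-hand side is a Lambert series, namely the logarithmic derivative of the claimed
  antiderivative, and the right-hand side is an eta quotient. This proves (1), (4), (5) and (6). The antiderivatives in (2), (3)
  and (4) are Moebius transforms of each other, because of the relation between three values of \<open>\<wp>\<close> at points of order
  six and its image under the Fricke involution.

  The special values are evaluated with \<open>\<eta>(i / x) = x^(1/2) \<eta>(i x)\<close>, which is obtained by interchanging the two
  summations in the conditionally convergent Eisenstein series of weight two; the points belonging to square roots of two and
  three are roots of a cubic and a quartic equation of level six. In (1) one also needs
  \<open>1 / r^5 - 11 - r^5 = E(q)^6 / (q E(q^5)^6)\<close>, the product over the five fifth roots of \<open>q\<close> of a five-dissection.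
\<close>

section \<open>Infinite products and the Jacobi triple product\<close>

text \<open>The statement concerns real \<open>q\<close>, but theta functions must be evaluated at
  roots of unity, so theta functions and Weierstrass sums live over \<open>complex\<close>; only the
  finished identities are cast back to \<open>real\<close>. Fifth, third and sixth roots of unity
  are introduced by their cyclotomic equations, which turns all computations with them into
  polynomial algebra and lets a result be reused for a conjugate root.

  Two obstacles shape level six. The relation between the three Weierstrass values does not contain
  the antiderivative of (4); only its Fricke image does. Hence the eta transformation is required
  already for the integrals (2) and (3), not merely for the special values. And exp(-2 pi / sqrt k)
  is fixed by x -> 1/(k x), which makes E(q^k) / E(q) explicit: for k = 6 everything cancels in
  pairs, but for k = 3 and k = 2 this determines only a rational function of higher degree in the
  antiderivative of (2), and an equation remains to be factored.\<close>

definition qpoch :: "complex \<Rightarrow> complex \<Rightarrow> complex" where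
  "qpoch a q = (\<Prod>j. 1 - a * q ^ j)"

text \<open>The modified theta function; the factor (q; q) of the triple product is left
  out.\<close>

definition theta :: "complex \<Rightarrow> complex \<Rightarrow> complex" where
  "theta x q = qpoch x q * qpoch (q / x) q"

lemma has_prod_qpoch:
  assumes "norm q < 1"
  shows "(\<lambda>j. 1 - a * q ^ j) has_prod qpoch a q"
proof -
  have "summable (\<lambda>j. norm a * norm q ^ j)"
    using assms by (intro summable_mult summable_geometric) auto
  then have "summable (\<lambda>j. norm ((1 - a * q ^ j) - 1))"
    by (simp add: norm_mult norm_power)
  then have "convergent_prod (\<lambda>j. 1 - a * q ^ j)"
    by (intro abs_convergent_prod_imp_convergent_prod summable_imp_abs_convergent_prod)
  then show ?thesis
    unfolding qpoch_def by (rule convergent_prod_has_prod)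
qed

lemma qpoch_LIMSEQ:
  assumes "norm q < 1"
  shows "(\<lambda>N. \<Prod>j<N. 1 - a * q ^ j) \<longlonglongrightarrow> qpoch a q"
  using has_prod_imp_tendsto'[OF has_prod_qpoch[OF assms]] .

lemma qpoch_eq_0_iff:
  assumes "norm q < 1"
  shows "qpoch a q = 0 \<longleftrightarrow> (\<exists>j. a * q ^ j = 1)"
  using has_prod_eq_0_iff[OF has_prod_qpoch[OF assms, of a]] by (auto simp: image_iff)

lemma qpoch_nonzero:
  assumes "norm q < 1" "norm a < 1"
  shows "qpoch a q \<noteq> 0"
proof
  assume "qpoch a q = 0"
  then obtain j where "a * q ^ j = 1"
    using qpoch_eq_0_iff[OF assms(1)] by blast
  moreover have "norm (a * q ^ j) < 1"
  proof -
    have "norm a * norm q ^ j \<le> norm a * 1"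
      using assms by (intro mult_left_mono power_le_one) auto
    then show ?thesis using assms by (simp add: norm_mult norm_power)
  qed
  ultimately show False by simp
qed

lemma qpoch_Suc:
  assumes "norm q < 1"
  shows "qpoch a q = (1 - a) * qpoch (a * q) q"
proof (rule LIMSEQ_unique)
  show "(\<lambda>N. \<Prod>j<Suc N. 1 - a * q ^ j) \<longlonglongrightarrow> qpoch a q"
    using qpoch_LIMSEQ[OF assms] by (rule LIMSEQ_Suc)
  have "(\<Prod>j<Suc N. 1 - a * q ^ j) = (1 - a) * (\<Prod>j<N. 1 - (a * q) * q ^ j)" for N
    by (subst prod.lessThan_Suc_shift) (simp add: mult.assoc)
  then show "(\<lambda>N. \<Prod>j<Suc N. 1 - a * q ^ j) \<longlonglongrightarrow> (1 - a) * qpoch (a * q) q"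
    by (simp only:) (intro tendsto_intros qpoch_LIMSEQ assms)
qed

text \<open>Sort the factors by the residue of \<open>j\<close> modulo \<open>k\<close>. Partial
  products are compared along the lengths \<open>N * k\<close>, which contain whole periods.\<close>

lemma qpoch_split:
  assumes "norm q < 1" "k > 0"
  shows "qpoch a q = (\<Prod>i<k. qpoch (a * q ^ i) (q ^ k))"
proof (rule LIMSEQ_unique)
  have k: "norm (q ^ k) < 1"
    using assms by (simp add: norm_power power_less_one_iff)
  show "(\<lambda>N. \<Prod>j<N * k. 1 - a * q ^ j) \<longlonglongrightarrow> qpoch a q"
    using filterlim_compose[OF qpoch_LIMSEQ[OF assms(1), of a], of "\<lambda>N. N * k"] assms(2)
    by (simp add: mult_nat_right_at_top)
  have "(\<Prod>j<N * k. 1 - a * q ^ j) = (\<Prod>i<k. \<Prod>j<N. 1 - a * q ^ i * (q ^ k) ^ j)" for N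
  proof (induction N)
    case (Suc N)
    have "(\<Prod>j<Suc N * k. 1 - a * q ^ j) = (\<Prod>j<N * k. 1 - a * q ^ j) * (\<Prod>i<k. 1 - a * q ^ (i + N * k))"
      unfolding prod.nat_group[symmetric]
      by (simp add: prod.atLeastLessThan_shift_0[of _ "N * k"] lessThan_atLeast0 add.commute)
    also have "\<dots> = (\<Prod>i<k. \<Prod>j<Suc N. 1 - a * q ^ i * (q ^ k) ^ j)"
      by (simp add: Suc prod.distrib power_add power_mult[symmetric] mult_ac)
    finally show ?case .
  qed auto
  then show "(\<lambda>N. \<Prod>j<N * k. 1 - a * q ^ j) \<longlonglongrightarrow> (\<Prod>i<k. qpoch (a * q ^ i) (q ^ k))"
    by (simp only:) (intro tendsto_prod qpoch_LIMSEQ k)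
qed

text \<open>Meant for \<open>c\<close> running through the k-th roots of unity. The assumption
  \<open>fac\<close> expresses this as a factorization of 1 - z^k, a polynomial identity for
  concrete roots, and is applied to each exponent \<open>j\<close> separately.\<close>

lemma qpoch_prod_family:
  fixes k :: nat
  assumes "norm q < 1" "k > 0" and fac: "\<And>z. (\<Prod>i<k. 1 - c i * z) = 1 - z ^ k"
  shows "(\<Prod>i<k. qpoch (c i * a) q) = qpoch (a ^ k) (q ^ k)"
proof (rule LIMSEQ_unique)
  have k: "norm (q ^ k) < 1"
    using assms by (simp add: norm_power power_less_one_iff)
  show "(\<lambda>N. \<Prod>j<N. 1 - a ^ k * (q ^ k) ^ j) \<longlonglongrightarrow> qpoch (a ^ k) (q ^ k)"
    by (intro qpoch_LIMSEQ k)
  have "(\<Prod>j<N. 1 - a ^ k * (q ^ k) ^ j) = (\<Prod>i<k. \<Prod>j<N. 1 - c i * a * q ^ j)" for N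
    by (subst prod.swap) (simp add: fac[symmetric] power_mult_distrib[symmetric] power_mult[symmetric]
        mult.assoc, simp add: fac power_mult_distrib power_mult[symmetric] mult.commute)
  then show "(\<lambda>N. \<Prod>j<N. 1 - a ^ k * (q ^ k) ^ j) \<longlonglongrightarrow> (\<Prod>i<k. qpoch (c i * a) q)"
    by (simp only:) (intro tendsto_prod qpoch_LIMSEQ assms)
qed

text \<open>There are no alternating signs, so \<open>theta x q\<close> corresponds to the argument
  \<open>- x\<close>. The product n (n - 1) is even, so \<open>div\<close> is exact.\<close>

definition theta_series :: "complex \<Rightarrow> complex \<Rightarrow> complex" where
  "theta_series z q = (\<Sum>\<^sub>\<infinity>n::int. q powi (n * (n - 1) div 2) * z powi n)"

lemma summable_triangular:
  fixes r s :: real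
  assumes "0 < r" "r < 1" "0 < s"
  shows "summable (\<lambda>k. r ^ (k * (k - 1) div 2) * s ^ k)"
proof -
  have "(\<lambda>k. r ^ k * s) \<longlonglongrightarrow> 0 * s"
    by (intro tendsto_intros LIMSEQ_realpow_zero) (use assms in auto)
  then have "eventually (\<lambda>k. r ^ k * s < 1/2) sequentially"
    by (intro order_tendstoD) auto
  then obtain N where N: "\<And>k. k \<ge> N \<Longrightarrow> r ^ k * s < 1/2"
    by (auto simp: eventually_sequentially)
  show ?thesis
  proof (rule summable_ratio_test[of "1/2" N])
    fix k assume "k \<ge> N"
    have e: "(k + 1) * k div 2 = k * (k - 1) div 2 + k"
    proof -
      have "(k + 1) * k = k * (k - 1) + k * 2" by (cases k) auto
      then show ?thesis by simp
    qed
    have "r ^ (Suc k * (Suc k - 1) div 2) * s ^ Suc k = (r ^ k * s) * (r ^ (k * (k - 1) div 2) * s ^ k)"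
      using e by (simp add: power_add mult_ac)
    also have "\<dots> \<le> 1/2 * (r ^ (k * (k - 1) div 2) * s ^ k)"
      using N[OF \<open>k \<ge> N\<close>] assms by (intro mult_right_mono) auto
    finally show "norm (r ^ (Suc k * (Suc k - 1) div 2) * s ^ Suc k) \<le> 1/2 * norm (r ^ (k * (k - 1) div 2) * s ^ k)"
      using assms by simp
  qed auto
qed

lemma int_UNIV_split: "(UNIV :: int set) = range int \<union> range (\<lambda>n. - int n - 1)"
proof -
  have "n \<in> range int \<union> range (\<lambda>n. - int n - 1)" for n
    by (cases "n \<ge> 0") (auto simp: image_iff intro: exI[of _ "nat n"] exI[of _ "nat (- n - 1)"])
  then show ?thesis by auto
qed

lemma abs_summable_theta_series:
  fixes q z :: complex
  assumes "q \<noteq> 0" "norm q < 1" "z \<noteq> 0"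
  shows "(\<lambda>n::int. norm (q powi (n * (n - 1) div 2) * z powi n)) summable_on UNIV"
proof (subst int_UNIV_split, rule summable_on_Un_disjoint)
  let ?f = "\<lambda>n::int. norm (q powi (n * (n - 1) div 2) * z powi n)"
  have tri: "int k * (int k - 1) div 2 = int (k * (k - 1) div 2)" for k
    by (cases k) (auto simp: zdiv_int algebra_simps)
  have "?f \<circ> int = (\<lambda>k. norm q ^ (k * (k - 1) div 2) * norm z ^ k)"
    by (rule ext) (simp add: tri norm_mult norm_power)
  moreover have "\<dots> summable_on UNIV"
    using assms by (intro summable_nonneg_imp_summable_on summable_triangular) auto
  ultimately show "?f summable_on range int"
    by (subst summable_on_reindex) (auto simp: inj_on_def)
  \<comment> \<open>The negative indices n = -k - 1 give a series of the same kind, with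
    \<open>norm q / norm z\<close> in place of \<open>norm z\<close> and the index shifted by
    one.\<close>
  have *: "(- int k - 1) * (- int k - 1 - 1) div 2 = int (Suc k * (Suc k - 1) div 2) + int (Suc k)" for k
  proof -
    have "(- int k - 1) * (- int k - 1 - 1) = int (Suc k * (Suc k - 1)) + int (Suc k) * 2"
      by (simp add: algebra_simps)
    then show ?thesis by (simp add: zdiv_int)
  qed
  have "?f \<circ> (\<lambda>n. - int n - 1) = (\<lambda>k. norm q ^ (Suc k * (Suc k - 1) div 2) * (norm q / norm z) ^ Suc k)"
  proof (rule ext)
    fix k
    have "z powi (- int k - 1) = inverse (z ^ Suc k)"
      by (metis minus_add_distrib of_nat_Suc power_int_minus power_int_of_nat uminus_add_conv_diff add.commute diff_minus_eq_add)
    then show "(?f \<circ> (\<lambda>n. - int n - 1)) k = norm q ^ (Suc k * (Suc k - 1) div 2) * (norm q / norm z) ^ Suc k"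
      unfolding o_def * using assms
      by (simp add: power_int_add norm_mult norm_power norm_inverse power_divide divide_inverse power_inverse power_mult_distrib
                flip: of_nat_Suc del: of_nat_Suc power_Suc)
  qed
  moreover have "\<dots> summable_on UNIV"
    using assms summable_triangular[of "norm q" "norm q / norm z"]
    by (intro summable_nonneg_imp_summable_on) (subst summable_Suc_iff, auto)
  ultimately show "?f summable_on range (\<lambda>n. - int n - 1)"
    by (subst summable_on_reindex) (auto simp: inj_on_def)
qed auto

lemma has_sum_theta_series:
  assumes "q \<noteq> 0" "norm q < 1" "z \<noteq> 0"
  shows "((\<lambda>n::int. q powi (n * (n - 1) div 2) * z powi n) has_sum theta_series z q) UNIV"
  unfolding theta_series_def using abs_summable_summable[OF abs_summable_theta_series[OF assms]] by simp

section \<open>From the q-binomial theorem to the triple product\<close>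

lemma qfin_nonzero:
  fixes q :: complex
  assumes "norm q < 1"
  shows "(\<Prod>j<n. 1 - q ^ Suc j) \<noteq> 0"
proof -
  have "q ^ Suc j \<noteq> 1" for j
  proof
    assume "q ^ Suc j = 1"
    then have "norm q ^ Suc j = 1" by (metis norm_one norm_power)
    moreover have "norm q ^ Suc j < 1"
      using assms by (simp add: power_less_one_iff del: power_Suc)
    ultimately show False by simp
  qed
  then show ?thesis by (simp add: prod_zero_iff)
qed

lemma tri_Suc: "Suc k * k div 2 = k * (k - 1) div 2 + k"
proof -
  have "Suc k * k = k * (k - 1) + k * 2" by (cases k) auto
  then show ?thesis by simp
qed

text \<open>The quotients of \<open>f\<close> are Gaussian binomial coefficients. In the induction
  the new factor 1 + z q^M amounts to the q-Pascal rule, proved as \<open>rec\<close>.\<close>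

lemma q_binomial_theorem:
  fixes q z :: complex
  assumes "norm q < 1"
  defines "f \<equiv> \<lambda>n. (\<Prod>j<n. 1 - q ^ Suc j)"
  shows "(\<Prod>j<M. 1 + z * q ^ j) = (\<Sum>k\<le>M. q ^ (k * (k - 1) div 2) * (f M / (f k * f (M - k))) * z ^ k)"
proof (induction M)
  case 0
  then show ?case by (simp add: f_def)
next
  case (Suc M)
  let ?c = "\<lambda>M k. q ^ (k * (k - 1) div 2) * (f M / (f k * f (M - k)))"
  have fnz: "f n \<noteq> 0" for n
    unfolding f_def by (rule qfin_nonzero[OF assms(1)])
  have fSuc: "f (Suc n) = f n * (1 - q ^ Suc n)" for n
    by (simp add: f_def)
  have rec: "?c (Suc M) (Suc k) = ?c M (Suc k) + q ^ M * ?c M k" if "k < M" for k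
  proof -
    have e: "M - k = Suc (M - Suc k)" using that by simp
    define a where "a = M - Suc k"
    have M: "M = a + Suc k" using that by (simp add: a_def)
    have nz: "1 - q ^ Suc n \<noteq> 0" for n using fnz[of "Suc n"] by (simp add: fSuc)
    have t: "q ^ (Suc k * (Suc k - 1) div 2) = q ^ (k * (k - 1) div 2) * q ^ k"
      using tri_Suc[of k] by (simp add: power_add)
    \<comment> \<open>Over a common denominator this is 1 - q^(M+1) = (1 - q^(a+1)) + q^(a+1) (1 -
      q^(k+1)), where a + 1 = M - k.\<close>
    have "f (Suc M) / (f (Suc k) * f (Suc a)) = f M / (f (Suc k) * f a) + q ^ Suc a * (f M / (f k * f (Suc a)))"
    proof -
      have "F * C / ((u * A) * (v * B)) = F / (u * A * v) + Q * (F / (u * (v * B)))"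
        if "u \<noteq> 0" "v \<noteq> 0" "A \<noteq> 0" "B \<noteq> 0" "C = B + Q * A" for F A B C Q u v :: complex
        using that by (simp add: field_simps)
      moreover have "1 - q ^ Suc M = (1 - q ^ Suc a) + q ^ Suc a * (1 - q ^ Suc k)"
        by (simp add: M power_add algebra_simps)
      ultimately show ?thesis
        unfolding fSuc using fnz[of k] fnz[of a] nz[of k] nz[of a] by blast
    qed
    then show ?thesis
      unfolding t using M by (simp add: algebra_simps power_add)
  qed
  have c0: "?c n 0 = 1" for n using fnz by (simp add: f_def)
  have cn: "?c (Suc M) (Suc M) = q ^ M * ?c M M"
    using fnz[of 0] fnz[of M] fnz[of "Suc M"] tri_Suc[of M] by (simp add: power_add f_def)
  have "(\<Prod>j<Suc M. 1 + z * q ^ j) = (\<Sum>k\<le>M. ?c M k * z ^ k) * (1 + z * q ^ M)"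
    by (simp add: Suc)
  also have "\<dots> = (\<Sum>k\<le>M. ?c M k * z ^ k) + (\<Sum>k\<le>M. q ^ M * ?c M k * z ^ Suc k)"
    by (simp only: distrib_left mult_1_right sum_distrib_right) (simp add: mult_ac)
  also have "(\<Sum>k\<le>M. ?c M k * z ^ k) = 1 + (\<Sum>k<M. ?c M (Suc k) * z ^ Suc k)"
    by (subst sum.atMost_shift) (use c0 in simp)
  also have "(\<Sum>k\<le>M. q ^ M * ?c M k * z ^ Suc k) = (\<Sum>k<M. q ^ M * ?c M k * z ^ Suc k) + q ^ M * ?c M M * z ^ Suc M"
    by (simp add: lessThan_Suc_atMost[symmetric])
  also have "1 + (\<Sum>k<M. ?c M (Suc k) * z ^ Suc k) + ((\<Sum>k<M. q ^ M * ?c M k * z ^ Suc k) + q ^ M * ?c M M * z ^ Suc M)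
      = 1 + (\<Sum>k<M. ?c (Suc M) (Suc k) * z ^ Suc k) + ?c (Suc M) (Suc M) * z ^ Suc M"
  proof -
    have "(\<Sum>k<M. ?c M (Suc k) * z ^ Suc k) + (\<Sum>k<M. q ^ M * ?c M k * z ^ Suc k) =
        (\<Sum>k<M. ?c (Suc M) (Suc k) * z ^ Suc k)"
      unfolding sum.distrib[symmetric] by (intro sum.cong refl) (simp only: rec lessThan_iff distrib_right)
    moreover have "1 + a + (b + d) = 1 + c + d" if "a + b = c" for a b c d :: complex
      by (simp add: add.assoc flip: that)
    ultimately show ?thesis unfolding cn by blast
  qed
  also have "\<dots> = (\<Sum>k\<le>Suc M. ?c (Suc M) k * z ^ k)"
    unfolding sum.atMost_shift lessThan_Suc c0 by (simp add: add_ac)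
  finally show ?case .
qed

text \<open>The q-binomial theorem with 2 N factors at z = -x q^(-N). Its upper N factors are the 1
  - x q^j; the lower ones, read backwards, are the 1 - (q / x) q^j up to monomials. The summation
  index is n = k - N.\<close>

lemma finite_jacobi_triple:
  fixes q x :: complex
  assumes "norm q < 1" "q \<noteq> 0" "x \<noteq> 0"
  defines "f \<equiv> \<lambda>n. (\<Prod>j<n. 1 - q ^ Suc j)"
  shows "(\<Prod>j<N. 1 - x * q ^ j) * (\<Prod>j<N. 1 - q / x * q ^ j) =
         (\<Sum>n\<in>{-int N..int N}. f (2 * N) / (f (nat (int N + n)) * f (nat (int N - n))) *
            (q powi (n * (n - 1) div 2) * (- x) powi n))"
proof -
  define z where "z = - x * q powi (- int N)"
  have z0: "z \<noteq> 0" using assms by (simp add: z_def)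
  have triN: "q ^ (N * (N - 1) div 2) \<noteq> 0" using assms by simp
  have low: "(\<Prod>j<N. 1 + z * q ^ j) = z ^ N * q ^ (N * (N - 1) div 2) * (\<Prod>j<N. 1 - q / x * q ^ j)"
  proof -
    have "(\<Prod>j<N. 1 + z * q ^ j) = (\<Prod>j<N. 1 + z * q ^ (N - Suc j))"
      by (rule prod.nat_diff_reindex[symmetric])
    also have "\<dots> = (\<Prod>j<N. z * q ^ (N - Suc j) * (1 - q / x * q ^ j))"
    proof (rule prod.cong)
      fix j assume j: "j \<in> {..<N}"
      have "z * q ^ (N - Suc j) = - x * (q powi (- int N) * q powi (int (N - Suc j)))"
        by (simp add: z_def)
      also have "q powi (- int N) * q powi (int (N - Suc j)) = q powi (- int (Suc j))"
        using j assms by (subst power_int_add[symmetric]) (auto simp: of_nat_diff)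
      finally have e: "z * q ^ (N - Suc j) = - x / q ^ Suc j"
        by (simp add: power_int_minus divide_inverse del: of_nat_Suc)
      show "1 + z * q ^ (N - Suc j) = z * q ^ (N - Suc j) * (1 - q / x * q ^ j)"
        unfolding e using assms by (simp add: field_simps)
    qed auto
    also have "\<dots> = z ^ N * (\<Prod>j<N. q ^ (N - Suc j)) * (\<Prod>j<N. 1 - q / x * q ^ j)"
      by (simp add: prod.distrib)
    also have "(\<Prod>j<N. q ^ (N - Suc j)) = (\<Prod>j<N. q ^ j)"
      by (rule prod.nat_diff_reindex)
    also have "\<dots> = q ^ (N * (N - 1) div 2)"
    proof -
      have "(\<Sum>j<N. j) = N * (N - 1) div 2"
        by (induction N) (use tri_Suc in simp_all)
      then show ?thesis using power_sum[of q "\<lambda>j. j" "{..<N}"] by simp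
    qed
    finally show ?thesis .
  qed
  have high: "(\<Prod>j<N. 1 + z * q ^ (j + N)) = (\<Prod>j<N. 1 - x * q ^ j)"
    using assms by (simp add: z_def power_add power_int_minus field_simps)
  have "(\<Prod>j<2*N. 1 + z * q ^ j) = (\<Prod>j<N. 1 + z * q ^ j) * (\<Prod>j<N. 1 + z * q ^ (j + N))"
  proof -
    have "{..<2*N} = {..<N} \<union> {N..<2*N}" by auto
    then have "(\<Prod>j<2*N. 1 + z * q ^ j) = (\<Prod>j<N. 1 + z * q ^ j) * (\<Prod>j\<in>{N..<2*N}. 1 + z * q ^ j)"
      by (simp add: prod.union_disjoint ivl_disj_int)
    also have "(\<Prod>j\<in>{N..<2*N}. 1 + z * q ^ j) = (\<Prod>j<N. 1 + z * q ^ (j + N))"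
      by (rule prod.reindex_bij_witness[of _ "\<lambda>j. j + N" "\<lambda>j. j - N"]) auto
    finally show ?thesis .
  qed
  then have "z ^ N * q ^ (N * (N - 1) div 2) * ((\<Prod>j<N. 1 - x * q ^ j) * (\<Prod>j<N. 1 - q / x * q ^ j)) = (\<Prod>j<2*N. 1 + z * q ^ j)"
    by (simp add: low high)
  also have "\<dots> = (\<Sum>k\<le>2*N. q ^ (k * (k - 1) div 2) * (f (2*N) / (f k * f (2*N - k))) * z ^ k)"
    unfolding f_def by (rule q_binomial_theorem[OF assms(1)])
  also have "\<dots> = (\<Sum>n\<in>{-int N..int N}. z ^ N * q ^ (N * (N - 1) div 2) *
      (f (2 * N) / (f (nat (int N + n)) * f (nat (int N - n))) * (q powi (n * (n - 1) div 2) * (- x) powi n)))"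
  proof (rule sum.reindex_bij_witness[of _ "\<lambda>n. nat (int N + n)" "\<lambda>k. int k - int N"])
    fix k assume k: "k \<in> {..2*N}"
    define n where "n = int k - int N"
    have ev: "even (m * (m - 1))" for m :: int by simp
    have kn: "nat (int N + n) = k" "nat (int N - n) = 2 * N - k"
      using k by (auto simp: n_def)
    have tri: "int (m * (m - 1) div 2) = int m * (int m - 1) div 2" for m
      by (cases m) (auto simp: zdiv_int algebra_simps)
    have "z ^ k = z powi int k" by simp
    also have "\<dots> = z ^ N * z powi n"
      using z0 by (simp add: n_def power_int_diff)
    also have "z powi n = (- x) powi n * q powi (- int N * n)"
      unfolding z_def power_int_mult by (rule power_int_mult_distrib)
    finally have zk: "z ^ k = z ^ N * ((- x) powi n * q powi (- int N * n))" .
    have "q ^ (k * (k - 1) div 2) * q powi (- int N * n) = q powi (int (k * (k - 1) div 2) - int N * n)"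
      using assms by (simp add: power_int_diff power_int_minus divide_inverse)
    also have "int (k * (k - 1) div 2) - int N * n = int (N * (N - 1) div 2) + n * (n - 1) div 2"
    proof -
      have "2 * (int k * (int k - 1) div 2) = int k * (int k - 1)"
           "2 * (int N * (int N - 1) div 2) = int N * (int N - 1)"
           "2 * (n * (n - 1) div 2) = n * (n - 1)"
        using ev by simp_all
      moreover have "int k * (int k - 1) - 2 * (int N * n) = int N * (int N - 1) + n * (n - 1)"
        by (simp add: n_def algebra_simps)
      ultimately show ?thesis unfolding tri by linarith
    qed
    also have "q powi \<dots> = q ^ (N * (N - 1) div 2) * q powi (n * (n - 1) div 2)"
      using assms by (simp add: power_int_add)
    finally have qk: "q ^ (k * (k - 1) div 2) * q powi (- int N * n) = q ^ (N * (N - 1) div 2) * q powi (n * (n - 1) div 2)" .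
    have "q ^ (k * (k - 1) div 2) * (f (2*N) / (f k * f (2*N - k))) * z ^ k =
      (q ^ (k * (k - 1) div 2) * q powi (- int N * n)) * (f (2*N) / (f k * f (2*N - k))) * (z ^ N * (- x) powi n)"
      by (simp add: zk)
    also have "\<dots> = z ^ N * q ^ (N * (N - 1) div 2) *
      (f (2 * N) / (f (nat (int N + n)) * f (nat (int N - n))) * (q powi (n * (n - 1) div 2) * (- x) powi n))"
      unfolding qk kn by simp
    finally show "z ^ N * q ^ (N * (N - 1) div 2) *
      (f (2 * N) / (f (nat (int N + (int k - int N))) * f (nat (int N - (int k - int N)))) *
       (q powi ((int k - int N) * ((int k - int N) - 1) div 2) * (- x) powi (int k - int N))) =
       q ^ (k * (k - 1) div 2) * (f (2*N) / (f k * f (2*N - k))) * z ^ k"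
      unfolding n_def by simp
  qed auto
  finally show ?thesis
    unfolding sum_distrib_left[symmetric] using z0 triN assms(2) by simp
qed

text \<open>Let N tend to infinity in the finite form. Its coefficients tend to 1 / (q; q) and are
  bounded uniformly in \<open>N\<close> and \<open>n\<close>, so a multiple of the theta series is a
  majorant and Tannery's theorem applies.\<close>

theorem jacobi_triple_product:
  assumes "norm q < 1" "q \<noteq> 0" "x \<noteq> 0"
  shows "theta_series (- x) q = theta x q * qpoch q q"
proof -
  define f where "f = (\<lambda>n. \<Prod>j<n. 1 - q ^ Suc j)"
  define E where "E = qpoch q q"
  define c where "c = (\<lambda>n::int. q powi (n * (n - 1) div 2) * (- x) powi n)"
  \<comment> \<open>Extending the coefficients by 0 makes every finite sum a series over all
    integers.\<close>
  define b where "b = (\<lambda>N n. if n \<in> {-int N..int N} then f (2 * N) / (f (nat (int N + n)) * f (nat (int N - n))) else 0)"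
  have E0: "E \<noteq> 0" unfolding E_def using assms by (intro qpoch_nonzero)
  have flim: "f \<longlonglongrightarrow> E"
    unfolding f_def E_def using qpoch_LIMSEQ[OF assms(1), of q] by simp
  have fnz: "f n \<noteq> 0" for n unfolding f_def by (rule qfin_nonzero[OF assms(1)])
  obtain B where B: "\<And>n. norm (f n) \<le> B"
    using flim convergent_imp_Bseq[of f] by (auto simp: convergent_def Bseq_def)
  have "(\<lambda>n. inverse (f n)) \<longlonglongrightarrow> inverse E"
    by (intro tendsto_inverse flim E0)
  then obtain B' where B': "\<And>n. norm (inverse (f n)) \<le> B'"
    using convergent_imp_Bseq[of "\<lambda>n. inverse (f n)"] by (auto simp: convergent_def Bseq_def)
  have B0: "B \<ge> 0" "B' \<ge> 0" using B[of 0] B'[of 0] norm_ge_zero order_trans by blast+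
  have bb: "norm (b N n) \<le> B * (B' * B')" for N n
  proof -
    have "norm (f i / (f j * f k)) \<le> B * (B' * B')" for i j k
      unfolding divide_inverse inverse_mult_distrib norm_mult
      by (intro mult_mono B B' mult_nonneg_nonneg norm_ge_zero B0)
    then show ?thesis using B0 by (auto simp: b_def)
  qed
  have blim: "(\<lambda>N. b N n) \<longlonglongrightarrow> 1 / E" for n
  proof -
    have l: "(\<lambda>N. f (nat (int N + m))) \<longlonglongrightarrow> E" for m
    proof (rule filterlim_compose[OF flim])
      show "filterlim (\<lambda>N. nat (int N + m)) at_top at_top"
        unfolding filterlim_at_top eventually_sequentially
      proof
        fix Z :: nat
        show "\<exists>N. \<forall>n\<ge>N. Z \<le> nat (int n + m)"
          by (rule exI[of _ "Z + nat (- m)"]) auto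
      qed
    qed
    have "(\<lambda>N. f (2 * N) / (f (nat (int N + n)) * f (nat (int N + - n)))) \<longlonglongrightarrow> E / (E * E)"
      by (intro tendsto_intros l filterlim_compose[OF flim]) (use E0 in \<open>auto simp: mult_nat_left_at_top\<close>)
    then have L: "(\<lambda>N. f (2 * N) / (f (nat (int N + n)) * f (nat (int N - n)))) \<longlonglongrightarrow> 1 / E"
      using E0 by simp
    have "eventually (\<lambda>N. f (2 * N) / (f (nat (int N + n)) * f (nat (int N - n))) = b N n) sequentially"
      using eventually_ge_at_top[of "nat \<bar>n\<bar>"] by eventually_elim (auto simp: b_def)
    from Lim_transform_eventually[OF L this] show ?thesis .
  qed
  have csum: "(\<lambda>n. norm (c n)) summable_on UNIV"
    unfolding c_def using assms by (intro abs_summable_theta_series) auto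
  have cs: "(c has_sum theta_series (- x) q) UNIV"
    unfolding c_def using assms by (intro has_sum_theta_series) auto
  \<comment> \<open>Tannery's theorem speaks of series over the natural numbers, so the integers are
    enumerated by \<open>int_decode\<close>; by absolute convergence the order is
    immaterial.\<close>
  have "summable (\<lambda>k. norm (c (int_decode k)))"
    using csum summable_on_reindex_bij_betw[OF bij_int_decode, of "\<lambda>n. norm (c n)"]
    by (intro summable_on_imp_summable) auto
  then have sm: "summable (\<lambda>k. B * (B' * B') * norm (c (int_decode k)))"
    by (rule summable_mult)
  have "((\<lambda>N. suminf (\<lambda>k. b N (int_decode k) * c (int_decode k))) \<longlongrightarrow> suminf (\<lambda>k. 1 / E * c (int_decode k))) sequentially"
  proof (rule tannerys_theorem[where M = "\<lambda>k. B * (B' * B') * norm (c (int_decode k))", THEN conjunct2, THEN conjunct2])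
    show "(\<lambda>n. b n (int_decode k) * c (int_decode k)) \<longlonglongrightarrow> 1 / E * c (int_decode k)" for k
      by (intro tendsto_mult blim tendsto_const)
    show "\<forall>\<^sub>F (k, n) in sequentially \<times>\<^sub>F sequentially. norm (b n (int_decode k) * c (int_decode k)) \<le> B * (B' * B') * norm (c (int_decode k))"
      by (intro always_eventually) (auto simp: norm_mult intro!: mult_right_mono bb)
  qed (use sm in auto)
  moreover have "suminf (\<lambda>k. b N (int_decode k) * c (int_decode k)) = (\<Prod>j<N. 1 - x * q ^ j) * (\<Prod>j<N. 1 - q / x * q ^ j)" for N
  proof -
    have "((\<lambda>n. b N n * c n) has_sum (\<Sum>n\<in>{-int N..int N}. b N n * c n)) UNIV"
      by (rule has_sum_finite_neutralI[of "{-int N..int N}"]) (auto simp: b_def)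
    then have "((\<lambda>k. b N (int_decode k) * c (int_decode k)) has_sum (\<Sum>n\<in>{-int N..int N}. b N n * c n)) UNIV"
      using has_sum_reindex_bij_betw[OF bij_int_decode, of "\<lambda>n. b N n * c n"] by simp
    then have "suminf (\<lambda>k. b N (int_decode k) * c (int_decode k)) = (\<Sum>n\<in>{-int N..int N}. b N n * c n)"
      by (auto dest!: has_sum_imp_sums simp: sums_iff)
    also have "\<dots> = (\<Prod>j<N. 1 - x * q ^ j) * (\<Prod>j<N. 1 - q / x * q ^ j)"
      unfolding finite_jacobi_triple[OF assms] by (intro sum.cong) (auto simp: b_def f_def c_def)
    finally show ?thesis .
  qed
  moreover have "suminf (\<lambda>k. 1 / E * c (int_decode k)) = 1 / E * theta_series (- x) q"
  proof -
    have "((\<lambda>k. c (int_decode k)) has_sum theta_series (- x) q) UNIV"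
      using cs has_sum_reindex_bij_betw[OF bij_int_decode, of c] by simp
    then have "(\<lambda>k. c (int_decode k)) sums theta_series (- x) q"
      by (rule has_sum_imp_sums)
    then show ?thesis by (intro sums_unique[symmetric] sums_mult)
  qed
  ultimately have "(\<lambda>N. (\<Prod>j<N. 1 - x * q ^ j) * (\<Prod>j<N. 1 - q / x * q ^ j)) \<longlonglongrightarrow> 1 / E * theta_series (- x) q"
    by simp
  moreover have "(\<lambda>N. (\<Prod>j<N. 1 - x * q ^ j) * (\<Prod>j<N. 1 - q / x * q ^ j)) \<longlonglongrightarrow> theta x q"
    unfolding theta_def by (intro tendsto_mult qpoch_LIMSEQ assms)
  ultimately have "theta x q = 1 / E * theta_series (- x) q"
    using LIMSEQ_unique by blast
  then show ?thesis using E0 by (simp add: E_def)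
qed

section \<open>The product of two theta series as a bilinear form\<close>

lemma has_sum_product:
  fixes f :: "'a \<Rightarrow> complex" and g :: "'b \<Rightarrow> complex"
  assumes "(f has_sum a) A" "(g has_sum b) B"
    "(\<lambda>x. norm (f x)) summable_on A" "(\<lambda>x. norm (g x)) summable_on B"
  shows "((\<lambda>(x, y). f x * g y) has_sum a * b) (A \<times> B)"
proof -
  have "(\<lambda>p. norm (f (fst p) * g (snd p))) summable_on A \<times> B"
  proof (rule Infinite_Sum.abs_summable_on_Sigma_iff[THEN iffD2], intro conjI ballI)
    fix x
    show "(\<lambda>y. norm (f (fst (x, y)) * g (snd (x, y)))) summable_on B"
      using assms(4) by (simp add: norm_mult summable_on_cmult_right)
  next
    have "(\<lambda>x. norm (f x) * (\<Sum>\<^sub>\<infinity>y\<in>B. norm (g y))) summable_on A"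
      using assms(3) by (intro summable_on_cmult_left)
    then show "(\<lambda>x. norm (\<Sum>\<^sub>\<infinity>y\<in>B. norm (f (fst (x, y)) * g (snd (x, y))))) summable_on A"
      by (simp add: norm_mult infsum_cmult_right' infsum_nonneg abs_mult)
  qed
  then have "(\<lambda>(x, y). f x * g y) summable_on A \<times> B"
    unfolding case_prod_unfold by (rule Infinite_Sum.abs_summable_summable)
  then obtain S where S: "((\<lambda>(x, y). f x * g y) has_sum S) (A \<times> B)"
    by (auto simp: summable_on_def)
  have "((\<lambda>x. f x * b) has_sum S) A"
    by (rule has_sum_Sigma'[OF S]) (use assms(2) in \<open>simp add: has_sum_cmult_right\<close>)
  moreover have "((\<lambda>x. f x * b) has_sum a * b) A"
    using assms(1) by (rule has_sum_cmult_left)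
  ultimately show ?thesis using S has_sum_unique by blast
qed

text \<open>In the double series over (m, n) put m = a + b, n = a - b when m + n is even and m = a +
  b + 1, n = a - b when it is odd; the exponents then separate in a and b. Each of the two resulting
  terms is a function of \<open>x\<close> times a function of \<open>y\<close>.\<close>

lemma theta_series_mult:
  assumes "q \<noteq> 0" "norm q < 1" "x \<noteq> 0" "y \<noteq> 0"
  shows "theta_series (- (x * y)) q * theta_series (- (x / y)) q =
    theta_series (x ^ 2) (q ^ 2) * theta_series (q * y ^ 2) (q ^ 2) - x * y * theta_series (q * x ^ 2) (q ^ 2) * theta_series (q ^ 2 * y ^ 2) (q ^ 2)"
proof -
  define t where "t = (\<lambda>n::int. n * (n - 1) div 2)"
  define c where "c = (\<lambda>z q (n::int). (q::complex) powi (t n) * z powi n)"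
  have q2': "q ^ 2 \<noteq> 0" "norm (q ^ 2) < 1"
    using assms by (auto simp: norm_power power_less_one_iff)
  have prod: "((\<lambda>(m, n). c z p m * c w p n) has_sum theta_series z p * theta_series w p) (UNIV \<times> UNIV)"
    if "z \<noteq> 0" "w \<noteq> 0" "p \<noteq> 0" "norm p < 1" for z w p
    unfolding c_def t_def using that
    by (intro has_sum_product has_sum_theta_series abs_summable_theta_series) auto
  define F where "F = (\<lambda>(m, n). c (- (x * y)) q m * c (- (x / y)) q n)"
  have t2: "2 * t n = n * (n - 1)" for n by (simp add: t_def)
  define u v where "u = - (x * y)" and "v = - (x / y)"
  have uv: "u \<noteq> 0" "v \<noteq> 0" "u * v = x ^ 2" "u / v = y ^ 2"
    using assms by (auto simp: u_def v_def power2_eq_square)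
  have pw: "u powi (a + b) * v powi (a - b) = (x ^ 2) powi a * (y ^ 2) powi b" for a b
    unfolding uv(3,4)[symmetric] using uv(1,2)
    by (simp add: power_int_add power_int_diff power_int_mult_distrib power_int_divide_distrib)
  have q2: "(q ^ 2) powi k = q powi (2 * k)" for k
    by (simp add: power_int_mult)
  have F0: "F (a + b, a - b) = c (x ^ 2) (q ^ 2) a * c (q * y ^ 2) (q ^ 2) b" for a b
  proof -
    have "F (a + b, a - b) = q powi (t (a + b) + t (a - b)) * (u powi (a + b) * v powi (a - b))"
      using assms unfolding F_def c_def u_def v_def by (simp add: power_int_add mult_ac)
    also have "t (a + b) + t (a - b) = 2 * t a + (2 * t b + b)"
    proof -
      have "2 * (t (a + b) + t (a - b)) = 2 * (2 * t a + (2 * t b + b))"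
        unfolding distrib_left t2 by (simp add: algebra_simps)
      then show ?thesis by simp
    qed
    finally show ?thesis
      unfolding pw c_def q2 using assms by (simp add: power_int_add power_int_mult_distrib mult_ac)
  qed
  have F1: "F (a + b + 1, a - b) = - (x * y) * (c (q * x ^ 2) (q ^ 2) a * c (q ^ 2 * y ^ 2) (q ^ 2) b)" for a b
  proof -
    have "F (a + b + 1, a - b) = q powi (t (a + b + 1) + t (a - b)) * (u powi (a + b + 1) * v powi (a - b))"
      using assms unfolding F_def c_def u_def v_def by (simp add: power_int_add mult_ac)
    also have "u powi (a + b + 1) * v powi (a - b) = u * (u powi (a + b) * v powi (a - b))"
      using uv by (simp add: power_int_add_1)
    also have "t (a + b + 1) + t (a - b) = 2 * t a + a + (2 * t b + 2 * b)"
    proof -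
      have "2 * (t (a + b + 1) + t (a - b)) = 2 * (2 * t a + a + (2 * t b + 2 * b))"
        unfolding distrib_left t2 by (simp add: algebra_simps)
      then show ?thesis by simp
    qed
    finally show ?thesis
      unfolding pw c_def q2 power_int_mult_distrib using assms by (simp add: power_int_add mult_ac u_def)
  qed
  define \<phi> \<psi> where "\<phi> = (\<lambda>(a::int, b::int). (a + b, a - b))" and "\<psi> = (\<lambda>(a::int, b::int). (a + b + 1, a - b))"
  have inj: "inj \<phi>" "inj \<psi>" by (auto simp: inj_on_def \<phi>_def \<psi>_def)
  have "(F has_sum theta_series (x ^ 2) (q ^ 2) * theta_series (q * y ^ 2) (q ^ 2)) (range \<phi>)"
    unfolding has_sum_reindex[OF inj(1)]
    using prod[of "x ^ 2" "q * y ^ 2" "q ^ 2"] assms q2' by (simp add: o_def \<phi>_def case_prod_unfold F0)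
  moreover have "(F has_sum - (x * y) * (theta_series (q * x ^ 2) (q ^ 2) * theta_series (q ^ 2 * y ^ 2) (q ^ 2))) (range \<psi>)"
    unfolding has_sum_reindex[OF inj(2)]
    using has_sum_cmult_right[OF prod[of "q * x ^ 2" "q ^ 2 * y ^ 2" "q ^ 2"], of "- (x * y)"] assms q2'
    by (simp add: o_def \<psi>_def case_prod_unfold F1)
  moreover have "range \<phi> \<inter> range \<psi> = {}"
  proof -
    have "\<phi> p \<noteq> \<psi> r" for p r
    proof
      assume "\<phi> p = \<psi> r"
      then have "2 * fst p = 2 * fst r + 1" by (auto simp: \<phi>_def \<psi>_def case_prod_unfold)
      then show False by presburger
    qed
    then show ?thesis by (auto simp del: split_paired_All) metis
  qed
  ultimately have "(F has_sum theta_series (x ^ 2) (q ^ 2) * theta_series (q * y ^ 2) (q ^ 2) +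
     - (x * y) * (theta_series (q * x ^ 2) (q ^ 2) * theta_series (q ^ 2 * y ^ 2) (q ^ 2))) (range \<phi> \<union> range \<psi>)"
    by (rule has_sum_Un_disjoint)
  moreover have "range \<phi> \<union> range \<psi> = UNIV"
  proof -
    have "(m, n) \<in> range \<phi> \<union> range \<psi>" for m n
    proof (cases "even (m + n)")
      case True
      then have "(m, n) = \<phi> ((m + n) div 2, (m - n) div 2)"
        unfolding \<phi>_def by auto presburger+
      then show ?thesis by blast
    next
      case False
      then have "(m, n) = \<psi> ((m + n - 1) div 2, (m - n - 1) div 2)"
        unfolding \<psi>_def by auto presburger+
      then show ?thesis by blast
    qed
    then show ?thesis by auto
  qed
  moreover have "(F has_sum theta_series (- (x * y)) q * theta_series (- (x / y)) q) UNIV"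
    using prod[of "- (x * y)" "- (x / y)" q] assms unfolding F_def by simp
  ultimately show ?thesis
    by (auto dest: has_sum_unique simp: algebra_simps)
qed

section \<open>Differences of Weierstrass functions as theta quotients\<close>

lemma theta_1 [simp]: "norm q < 1 \<Longrightarrow> theta 1 q = 0"
  using qpoch_Suc[of q 1] by (simp add: theta_def)

lemma theta_eq:
  assumes "norm q < 1" "x \<noteq> 0"
  shows "theta x q = (1 - x) * qpoch (q * x) q * qpoch (q / x) q"
  using qpoch_Suc[of q x] assms by (simp add: theta_def mult_ac)

lemma theta_inverse:
  assumes "norm q < 1" "x \<noteq> 0"
  shows "theta (1 / x) q = - theta x q / x"
  using assms by (simp add: theta_eq field_simps)

text \<open>Up to a constant, \<open>theta (x * y) q * theta (x / y) q\<close> has the form g(x)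
  h(y) - g'(x) h'(y), so all 3 by 3 determinants of its values vanish. This is the determinant with
  rows x, y, 1 and columns 1, y, v.\<close>

lemma theta_three_term:
  assumes "q \<noteq> 0" "norm q < 1" "x \<noteq> 0" "y \<noteq> 0" "v \<noteq> 0"
  shows "theta y q * theta (1 / y) q *
      (theta y q ^ 2 * (theta (x * v) q * theta (x / v) q) - theta x q ^ 2 * (theta (y * v) q * theta (y / v) q)) =
      theta (x * y) q * theta (x / y) q * theta y q ^ 2 * (theta v q * theta (1 / v) q)"
proof -
  define E where "E = qpoch q q"
  define g h g' h' where "g = (\<lambda>x. theta_series (x ^ 2) (q ^ 2))" "h = (\<lambda>y. theta_series (q * y ^ 2) (q ^ 2))"
    "g' = (\<lambda>x. x * theta_series (q * x ^ 2) (q ^ 2))" "h' = (\<lambda>y. y * theta_series (q ^ 2 * y ^ 2) (q ^ 2))"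
  define B where "B = (\<lambda>x y. theta (x * y) q * theta (x / y) q)"
  have E0: "E \<noteq> 0" unfolding E_def using assms by (intro qpoch_nonzero)
  have B: "E ^ 2 * B a b = g a * h b - g' a * h' b" if "a \<noteq> 0" "b \<noteq> 0" for a b
  proof -
    have "E ^ 2 * B a b = theta_series (- (a * b)) q * theta_series (- (a / b)) q"
      using that assms by (simp add: jacobi_triple_product B_def E_def power2_eq_square)
    also have "\<dots> = g a * h b - g' a * h' b"
      using that assms by (simp add: theta_series_mult g_h_g'_h'_def)
    finally show ?thesis .
  qed
  have "B x 1 * (B y y * B 1 v - B y v * B 1 y) - B x y * (B y 1 * B 1 v - B y v * B 1 1)
      + B x v * (B y 1 * B 1 y - B y y * B 1 1) = 0"
  proof -
    have "(E ^ 2 * B x 1) * ((E ^ 2 * B y y) * (E ^ 2 * B 1 v) - (E ^ 2 * B y v) * (E ^ 2 * B 1 y))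
      - (E ^ 2 * B x y) * ((E ^ 2 * B y 1) * (E ^ 2 * B 1 v) - (E ^ 2 * B y v) * (E ^ 2 * B 1 1))
      + (E ^ 2 * B x v) * ((E ^ 2 * B y 1) * (E ^ 2 * B 1 y) - (E ^ 2 * B y y) * (E ^ 2 * B 1 1)) = 0"
      using assms by (simp add: B) algebra
    then have "(E ^ 2 * E ^ 2 * E ^ 2) * (B x 1 * (B y y * B 1 v - B y v * B 1 y) - B x y * (B y 1 * B 1 v - B y v * B 1 1)
      + B x v * (B y 1 * B 1 y - B y y * B 1 1)) = 0"
      by algebra
    then show ?thesis using E0 by simp
  qed
  \<comment> \<open>Both zeros come from \<open>theta 1 q = 0\<close>; they leave three of the six
    products of the determinant.\<close>
  moreover have "B y y = 0" "B 1 1 = 0" "B x 1 = theta x q ^ 2" "B y 1 = theta y q ^ 2"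
    "B 1 y = theta y q * theta (1 / y) q" "B 1 v = theta v q * theta (1 / v) q"
    using assms by (auto simp: B_def power2_eq_square)
  ultimately have "theta y q * theta (1 / y) q * (theta y q ^ 2 * B x v - theta x q ^ 2 * B y v) =
      B x y * theta y q ^ 2 * (theta v q * theta (1 / v) q)"
    by simp algebra
  then show ?thesis unfolding B_def .
qed

section \<open>The limit of the three-term relation\<close>

lemma norm_prod_minus_linear_le:
  fixes u :: "nat \<Rightarrow> complex"
  shows "norm ((\<Prod>j<N. 1 + u j) - 1 - (\<Sum>j<N. u j)) \<le> (\<Prod>j<N. 1 + norm (u j)) - 1 - (\<Sum>j<N. norm (u j))"
proof (induction N)
  case (Suc N)
  let ?P = "\<Prod>j<N. 1 + u j" and ?Q = "\<Prod>j<N. 1 + norm (u j)"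
  have "(\<Prod>j<Suc N. 1 + u j) - 1 - (\<Sum>j<Suc N. u j) = (?P - 1 - (\<Sum>j<N. u j)) + (?P - 1) * u N"
    by (simp add: algebra_simps)
  also have "norm \<dots> \<le> norm (?P - 1 - (\<Sum>j<N. u j)) + norm (?P - 1) * norm (u N)"
    by (metis norm_mult norm_triangle_ineq)
  also have "\<dots> \<le> (?Q - 1 - (\<Sum>j<N. norm (u j))) + (?Q - 1) * norm (u N)"
    using norm_prod_minus1_le_prod_minus1[of u "{..<N}"]
    by (intro add_mono Suc mult_right_mono) auto
  also have "\<dots> = (\<Prod>j<Suc N. 1 + norm (u j)) - 1 - (\<Sum>j<Suc N. norm (u j))"
    by (simp add: algebra_simps)
  finally show ?case .
qed auto

text \<open>The terms of order two and higher are dominated by those of the product of the 1 + |u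
  j|, hence by exp A - 1 - A, which is at most A^2 for A <= 1. The quadratic error permits division
  by a small common factor of the \<open>u j\<close>.\<close>

lemma has_prod_linearization:
  fixes u :: "nat \<Rightarrow> complex"
  assumes sm: "summable (\<lambda>j. norm (u j))" and A: "(\<Sum>j. norm (u j)) \<le> 1"
    and P: "(\<lambda>N. \<Prod>j<N. 1 + u j) \<longlonglongrightarrow> P"
  shows "norm (P - 1 - (\<Sum>j. u j)) \<le> (\<Sum>j. norm (u j)) ^ 2"
proof -
  let ?A = "\<Sum>j. norm (u j)"
  have "norm (P - 1 - (\<Sum>j. u j)) \<le> exp ?A - 1 - ?A"
  proof (rule LIMSEQ_le)
    show "(\<lambda>N. norm ((\<Prod>j<N. 1 + u j) - 1 - (\<Sum>j<N. u j))) \<longlonglongrightarrow> norm (P - 1 - (\<Sum>j. u j))"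
      by (intro tendsto_intros P summable_LIMSEQ summable_norm_cancel[OF sm])
    show "(\<lambda>N. exp ?A - 1 - (\<Sum>j<N. norm (u j))) \<longlonglongrightarrow> exp ?A - 1 - ?A"
      by (intro tendsto_intros summable_LIMSEQ sm)
    show "\<exists>N. \<forall>n\<ge>N. norm ((\<Prod>j<n. 1 + u j) - 1 - (\<Sum>j<n. u j)) \<le> exp ?A - 1 - (\<Sum>j<n. norm (u j))"
    proof (intro exI allI impI)
      fix n
      have "(\<Prod>j<n. 1 + norm (u j)) \<le> exp (\<Sum>j<n. norm (u j))"
        by (rule prod_le_exp_sum) auto
      also have "\<dots> \<le> exp ?A"
        by (simp add: sum_le_suminf sm)
      finally show "norm ((\<Prod>j<n. 1 + u j) - 1 - (\<Sum>j<n. u j)) \<le> exp ?A - 1 - (\<Sum>j<n. norm (u j))"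
        using norm_prod_minus_linear_le[of u n] by linarith
    qed
  qed
  moreover have "exp ?A \<le> 1 + ?A + ?A ^ 2"
    by (intro exp_bound A suminf_nonneg sm) auto
  ultimately show ?thesis by linarith
qed

text \<open>The half n >= 0 of the bilateral sum. Since y / (1 - y)^2 is invariant under y -> 1 / y,
  the half n < 0 at x is \<open>double_pole_sum (q / x) q\<close>.\<close>

definition double_pole_sum :: "complex \<Rightarrow> complex \<Rightarrow> complex" where
  "double_pole_sum a q = (\<Sum>j. a * q ^ j / (1 - a * q ^ j) ^ 2)"

lemma abs_summable_double_pole_sum:
  fixes a q :: complex
  assumes "norm q < 1"
  shows "summable (\<lambda>j. norm (a * q ^ j / (1 - a * q ^ j) ^ 2))"
proof (rule summable_comparison_test_ev)
  have "(\<lambda>j. norm (a * q ^ j)) \<longlonglongrightarrow> norm (a * 0)"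
    by (intro tendsto_intros LIMSEQ_power_zero assms)
  then have "eventually (\<lambda>j. norm (a * q ^ j) < 1/2) sequentially"
    by (intro order_tendstoD) auto
  then show "eventually (\<lambda>j. norm (norm (a * q ^ j / (1 - a * q ^ j) ^ 2)) \<le> 4 * norm a * norm q ^ j) sequentially"
  proof eventually_elim
    case (elim j)
    have "1/2 \<le> norm (1 - a * q ^ j)"
      using elim norm_triangle_ineq2[of 1 "a * q ^ j"] by simp
    then have "(1/2) ^ 2 \<le> norm (1 - a * q ^ j) ^ 2"
      by (intro power_mono) auto
    then have "norm (a * q ^ j) / norm (1 - a * q ^ j) ^ 2 \<le> norm (a * q ^ j) / (1/2) ^ 2"
      by (intro divide_left_mono mult_pos_pos) auto
    also have "\<dots> = 4 * norm a * norm q ^ j"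
      by (simp add: norm_mult norm_power field_simps power2_eq_square)
    finally show ?case
      by (metis abs_norm_cancel norm_divide norm_power real_norm_def)
  qed
  show "summable (\<lambda>j. 4 * norm a * norm q ^ j)"
    using assms by (intro summable_mult summable_geometric) auto
qed

lemma eventually_at_1:
  "eventually (\<lambda>v::complex. v \<noteq> 0 \<and> v \<noteq> 1) (at 1)"
proof (rule eventually_conj)
  show "eventually (\<lambda>v::complex. v \<noteq> 0) (at 1)"
    by (rule tendsto_imp_eventually_ne[OF tendsto_ident_at]) simp
qed (simp add: eventually_at_filter)

text \<open>Because (1 - b v) (1 - b / v) = (1 - b)^2 - (v + 1/v - 2) b, the ratio is the product of
  the 1 - w t_j, where w = v + 1/v - 2 and t_j are the terms of \<open>double_pole_sum a q\<close>;
  its linear part survives the division by w. As w = (v - 1)^2 / v, this is in effect a second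
  logarithmic derivative.\<close>

lemma qpoch_ratio_tendsto:
  assumes "norm q < 1" and nz: "qpoch a q \<noteq> 0"
  shows "((\<lambda>v. (qpoch (a * v) q * qpoch (a / v) q / qpoch a q ^ 2 - 1) / (v + 1 / v - 2)) \<longlongrightarrow> - double_pole_sum a q) (at 1)"
proof -
  define t where "t = (\<lambda>j. a * q ^ j / (1 - a * q ^ j) ^ 2)"
  define w where "w = (\<lambda>v::complex. v + 1 / v - 2)"
  define R where "R = (\<lambda>v. qpoch (a * v) q * qpoch (a / v) q / qpoch a q ^ 2)"
  define A where "A = (\<Sum>j. norm (t j))"
  have sm: "summable (\<lambda>j. norm (t j))"
    unfolding t_def by (rule abs_summable_double_pole_sum[OF assms(1)])
  have fnz: "1 - a * q ^ j \<noteq> 0" for j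
    using nz qpoch_eq_0_iff[OF assms(1), of a] by auto
  have lim: "(\<lambda>N. \<Prod>j<N. 1 + - w v * t j) \<longlonglongrightarrow> R v" if "v \<noteq> 0" for v
  proof -
    have "(\<lambda>N. (\<Prod>j<N. 1 - a * v * q ^ j) * (\<Prod>j<N. 1 - a / v * q ^ j) / (\<Prod>j<N. 1 - a * q ^ j) ^ 2) \<longlonglongrightarrow> R v"
      unfolding R_def by (intro tendsto_intros qpoch_LIMSEQ assms) (use nz in auto)
    moreover have "(\<Prod>j<N. 1 - a * v * q ^ j) * (\<Prod>j<N. 1 - a / v * q ^ j) / (\<Prod>j<N. 1 - a * q ^ j) ^ 2 = (\<Prod>j<N. 1 + - w v * t j)" for N
      unfolding prod_power_distrib prod.distrib[symmetric] prod_dividef[symmetric]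
    proof (intro prod.cong refl)
      fix j
      have "(1 - b * v) * (1 - b / v) = (1 - b) ^ 2 - (v + 1 / v - 2) * b" for b
        using that by (simp add: field_simps power2_eq_square)
      from this[of "a * q ^ j"] have "(1 - a * v * q ^ j) * (1 - a / v * q ^ j) = (1 - a * q ^ j) ^ 2 - w v * (a * q ^ j)"
        by (simp add: w_def mult_ac)
      then show "(1 - a * v * q ^ j) * (1 - a / v * q ^ j) / (1 - a * q ^ j) ^ 2 = 1 + - w v * t j"
        using fnz[of j] by (simp add: t_def diff_divide_distrib)
    qed
    ultimately show ?thesis by simp
  qed
  have A0: "A \<ge> 0" unfolding A_def by (intro suminf_nonneg sm) auto
  have bound: "norm ((R v - 1) / w v - - double_pole_sum a q) \<le> norm (w v) * A ^ 2" if "v \<noteq> 0" "w v \<noteq> 0" "norm (w v) * A \<le> 1" for v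
  proof -
    have "norm (R v - 1 - (\<Sum>j. - w v * t j)) \<le> (\<Sum>j. norm (- w v * t j)) ^ 2"
    proof (rule has_prod_linearization[OF _ _ lim[OF that(1)]])
      show "summable (\<lambda>j. norm (- w v * t j))"
        using sm by (simp add: norm_mult)
      show "(\<Sum>j. norm (- w v * t j)) \<le> 1"
        using that sm by (simp add: norm_mult suminf_mult A_def)
    qed
    also have "(\<Sum>j. norm (- w v * t j)) = norm (w v) * A"
      using sm by (simp add: norm_mult suminf_mult A_def)
    also have "(\<Sum>j. - w v * t j) = - w v * double_pole_sum a q"
      unfolding double_pole_sum_def t_def[symmetric] by (intro suminf_mult summable_norm_cancel[OF sm])
    finally have *: "norm (R v - 1 + w v * double_pole_sum a q) \<le> (norm (w v) * A) ^ 2" by simp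
    have "(R v - 1) / w v - - double_pole_sum a q = (R v - 1 + w v * double_pole_sum a q) / w v"
      using that by (simp add: field_simps)
    then have "norm ((R v - 1) / w v - - double_pole_sum a q) = norm (R v - 1 + w v * double_pole_sum a q) / norm (w v)"
      by (simp add: norm_divide)
    also have "\<dots> \<le> (norm (w v) * A) ^ 2 / norm (w v)"
      by (intro divide_right_mono *) auto
    also have "\<dots> = norm (w v) * A ^ 2"
      using that by (simp add: power2_eq_square)
    finally show ?thesis .
  qed
  have w0: "(w \<longlongrightarrow> 0) (at 1)"
    unfolding w_def by (rule tendsto_eq_intros refl | simp)+
  have ev1: "eventually (\<lambda>v. v \<noteq> 0 \<and> w v \<noteq> 0) (at 1)"
    using eventually_at_1
  proof eventually_elim
    case (elim v)
    have "w v = (v - 1) ^ 2 / v" using elim by (simp add: w_def field_simps power2_eq_square)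
    then show ?case using elim by simp
  qed
  have ev2: "eventually (\<lambda>v. norm (w v) * A \<le> 1) (at 1)"
  proof -
    have "((\<lambda>v. norm (w v) * A) \<longlongrightarrow> norm (0::complex) * A) (at 1)"
      by (intro tendsto_intros w0)
    then have "eventually (\<lambda>v. norm (w v) * A < 1) (at 1)"
      by (intro order_tendstoD) auto
    then show ?thesis by (rule eventually_mono) auto
  qed
  have "((\<lambda>v. (R v - 1) / w v - - double_pole_sum a q) \<longlongrightarrow> 0) (at 1)"
  proof (rule Lim_null_comparison)
    show "eventually (\<lambda>v. norm ((R v - 1) / w v - - double_pole_sum a q) \<le> norm (w v) * A ^ 2) (at 1)"
      using ev1 ev2 by eventually_elim (use bound in auto)
    show "((\<lambda>v. norm (w v) * A ^ 2) \<longlongrightarrow> 0) (at 1)"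
      by (rule tendsto_eq_intros w0 refl | simp)+
  qed
  then show ?thesis unfolding R_def w_def by (rule Lim_null[THEN iffD2])
qed

text \<open>The limit \<open>v \<longrightarrow> 1\<close> of the three-term relation: up to constants, \<open>double_pole_sum x q + double_pole_sum (q / x) q\<close> is the Weierstrass function of \<open>x\<close>, and
  this is the formula for a difference of two of its values.\<close>

theorem double_pole_sum_difference:
  assumes "q \<noteq> 0" "norm q < 1" "x \<noteq> 0" "y \<noteq> 0" "theta x q \<noteq> 0" "theta y q \<noteq> 0"
  shows "theta y q * theta (1 / y) q * theta x q ^ 2 * ((double_pole_sum x q + double_pole_sum (q / x) q) - (double_pole_sum y q + double_pole_sum (q / y) q)) =
         qpoch q q ^ 4 * theta (x * y) q * theta (x / y) q"
proof -
  define w where "w = (\<lambda>v::complex. v + 1 / v - 2)"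
  define R where "R = (\<lambda>a v. qpoch (a * v) q * qpoch (a / v) q / qpoch a q ^ 2)"
  define L where "L = (\<lambda>x. double_pole_sum x q + double_pole_sum (q / x) q)"
  have w0: "(w \<longlongrightarrow> 0) (at 1)"
    unfolding w_def by (rule tendsto_eq_intros refl | simp)+
  have wne: "w v \<noteq> 0" if "v \<noteq> 0" "v \<noteq> 1" for v
  proof -
    have "w v = (v - 1) ^ 2 / v" using that by (simp add: w_def field_simps power2_eq_square)
    then show ?thesis using that by simp
  qed
  have Rlim: "((\<lambda>v. (R a v - 1) / w v) \<longlongrightarrow> - double_pole_sum a q) (at 1)" if "qpoch a q \<noteq> 0" for a
    unfolding R_def w_def by (rule qpoch_ratio_tendsto[OF assms(2) that])
  have R1: "(R a \<longlongrightarrow> 1) (at 1)" if "qpoch a q \<noteq> 0" for a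
  proof -
    have "((\<lambda>v. (R a v - 1) / w v * w v + 1) \<longlongrightarrow> - double_pole_sum a q * 0 + 1) (at 1)"
      by (intro tendsto_intros Rlim that w0)
    moreover have "eventually (\<lambda>v. (R a v - 1) / w v * w v + 1 = R a v) (at 1)"
      using eventually_at_1 by eventually_elim (simp add: wne)
    ultimately have "(R a \<longlongrightarrow> - double_pole_sum a q * 0 + 1) (at 1)"
      by (rule Lim_transform_eventually)
    then show ?thesis by simp
  qed
  have Blim: "((\<lambda>v. (theta (x * v) q * theta (x / v) q - theta x q ^ 2) / w v) \<longlongrightarrow> theta x q ^ 2 * - L x) (at 1)"
    if "theta x q \<noteq> 0" "x \<noteq> 0" for x
  proof -
    have nz: "qpoch x q \<noteq> 0" "qpoch (q / x) q \<noteq> 0"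
      using that by (auto simp: theta_def)
    have "((\<lambda>v. theta x q ^ 2 * ((R x v - 1) / w v * R (q / x) v + (R (q / x) v - 1) / w v)) \<longlongrightarrow>
        theta x q ^ 2 * (- double_pole_sum x q * 1 + - double_pole_sum (q / x) q)) (at 1)"
      by (intro tendsto_intros Rlim R1 nz)
    moreover have "eventually (\<lambda>v. theta x q ^ 2 * ((R x v - 1) / w v * R (q / x) v + (R (q / x) v - 1) / w v) =
       (theta (x * v) q * theta (x / v) q - theta x q ^ 2) / w v) (at 1)"
      using eventually_at_1
    proof eventually_elim
      case (elim v)
      have "theta x q ^ 2 * (R x v * R (q / x) v) = theta (x * v) q * theta (x / v) q"
        using nz elim that by (simp add: R_def theta_def field_simps)
      then show ?case using wne elim by (simp add: field_simps)
    qed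
    ultimately have "((\<lambda>v. (theta (x * v) q * theta (x / v) q - theta x q ^ 2) / w v) \<longlongrightarrow>
        theta x q ^ 2 * (- double_pole_sum x q * 1 + - double_pole_sum (q / x) q)) (at 1)"
      by (rule Lim_transform_eventually)
    then show ?thesis by (simp add: L_def)
  qed
  \<comment> \<open>\<open>theta v q\<close> and \<open>theta (1 / v) q\<close> both vanish at v = 1
    and together contribute (1 - v) (1 - 1/v) = - w, exactly the order of the difference
    quotients.\<close>
  have Vlim: "((\<lambda>v. theta v q * theta (1 / v) q / w v) \<longlongrightarrow> - (qpoch q q ^ 4)) (at 1)"
  proof -
    have nz: "qpoch q q \<noteq> 0" using assms by (intro qpoch_nonzero)
    have "((\<lambda>v. - ((qpoch q q ^ 2 * R q v) ^ 2)) \<longlongrightarrow> - ((qpoch q q ^ 2 * 1) ^ 2)) (at 1)"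
      by (intro tendsto_intros R1 nz)
    moreover have "eventually (\<lambda>v. - ((qpoch q q ^ 2 * R q v) ^ 2) = theta v q * theta (1 / v) q / w v) (at 1)"
      using eventually_at_1
    proof eventually_elim
      case (elim v)
      have e: "theta v q * theta (1 / v) q = - w v * (qpoch (q * v) q * qpoch (q / v) q) ^ 2"
        using elim assms(2) by (simp add: theta_eq w_def field_simps power2_eq_square)
      have "qpoch q q ^ 2 * R q v = qpoch (q * v) q * qpoch (q / v) q"
        using nz by (simp add: R_def)
      then show ?case using wne[of v] elim by (simp add: e)
    qed
    ultimately have "((\<lambda>v. theta v q * theta (1 / v) q / w v) \<longlongrightarrow> - ((qpoch q q ^ 2 * 1) ^ 2)) (at 1)"
      by (rule Lim_transform_eventually)
    then show ?thesis by (simp flip: power_mult)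
  qed
  \<comment> \<open>The three-term relation divided by w, with the product of the two squares
    subtracted and added so that both terms become difference quotients.\<close>
  have l1: "((\<lambda>v. theta y q * theta (1 / y) q * (theta y q ^ 2 * ((theta (x * v) q * theta (x / v) q - theta x q ^ 2) / w v)
      - theta x q ^ 2 * ((theta (y * v) q * theta (y / v) q - theta y q ^ 2) / w v))) \<longlongrightarrow>
      theta y q * theta (1 / y) q * (theta y q ^ 2 * (theta x q ^ 2 * - L x) - theta x q ^ 2 * (theta y q ^ 2 * - L y))) (at 1)"
    by (intro tendsto_intros Blim assms)
  have l2: "((\<lambda>v. theta (x * y) q * theta (x / y) q * theta y q ^ 2 * (theta v q * theta (1 / v) q / w v)) \<longlongrightarrow>
      theta (x * y) q * theta (x / y) q * theta y q ^ 2 * - (qpoch q q ^ 4)) (at 1)"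
    by (intro tendsto_intros Vlim)
  have ev: "eventually (\<lambda>v. theta y q * theta (1 / y) q * (theta y q ^ 2 * ((theta (x * v) q * theta (x / v) q - theta x q ^ 2) / w v)
      - theta x q ^ 2 * ((theta (y * v) q * theta (y / v) q - theta y q ^ 2) / w v)) =
      theta (x * y) q * theta (x / y) q * theta y q ^ 2 * (theta v q * theta (1 / v) q / w v)) (at 1)"
    using eventually_at_1
  proof eventually_elim
    case (elim v)
    have gen: "P * (Y * ((a - X) / d) - X * ((b - Y) / d)) = e * (f / d)"
      if "P * (Y * a - X * b) = e * f" "d \<noteq> 0" for P Y X a b d e f :: complex
      using that by (simp add: field_simps)
    show ?case
      by (rule gen[OF theta_three_term]) (use assms elim wne in auto)
  qed
  have "theta y q * theta (1 / y) q * (theta y q ^ 2 * (theta x q ^ 2 * - L x) - theta x q ^ 2 * (theta y q ^ 2 * - L y)) =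
    theta (x * y) q * theta (x / y) q * theta y q ^ 2 * - (qpoch q q ^ 4)"
    by (rule tendsto_unique[OF _ Lim_transform_eventually[OF l1 ev] l2]) simp
  then have "theta y q ^ 2 * (theta y q * theta (1 / y) q * theta x q ^ 2 * (L x - L y)) =
     theta y q ^ 2 * (qpoch q q ^ 4 * theta (x * y) q * theta (x / y) q)"
    by algebra
  then show ?thesis using assms by (simp add: L_def)
qed

section \<open>Lambert series\<close>

lemma double_pole_sum_Suc:
  assumes "norm q < 1"
  shows "double_pole_sum a q = a / (1 - a) ^ 2 + double_pole_sum (a * q) q"
proof -
  have "summable (\<lambda>j. a * q ^ j / (1 - a * q ^ j) ^ 2)"
    using abs_summable_double_pole_sum[OF assms] by (rule summable_norm_cancel)
  from suminf_split_head[OF this] show ?thesis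
    by (simp add: double_pole_sum_def mult_ac)
qed

text \<open>Expand y / (1 - y)^2 = y + 2 y^2 + 3 y^3 + ... at y = a q^j and sum the geometric series
  over j first.\<close>

lemma double_pole_sum_Lambert:
  assumes "norm q < 1" "norm a < 1"
  shows "(\<lambda>m. of_nat (Suc m) * a ^ Suc m / (1 - q ^ Suc m)) sums double_pole_sum a q"
    and "summable (\<lambda>m. norm (of_nat (Suc m) * a ^ Suc m / (1 - q ^ Suc m)))"
proof -
  define f where "f = (\<lambda>(j, m). of_nat (Suc m) * (a * q ^ j) ^ Suc m)"
  have small: "norm (a * q ^ j) < 1" for j
  proof -
    have "norm a * norm q ^ j \<le> norm a * 1"
      using assms by (intro mult_left_mono power_le_one) auto
    then show ?thesis using assms by (simp add: norm_mult norm_power)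
  qed
  have geo: "(\<lambda>m. of_nat (Suc m) * z ^ Suc m) sums (z / (1 - z) ^ 2)" if "norm z < 1" for z :: "'b::{real_normed_field,banach}"
    using sums_mult[OF geometric_deriv_sums[OF that], of z] by (simp add: mult_ac)
  have geon: "((\<lambda>m. norm (f (j, m))) has_sum (norm (a * q ^ j) / (1 - norm (a * q ^ j)) ^ 2)) UNIV" for j
  proof -
    have "(\<lambda>m. norm (f (j, m))) sums (norm (a * q ^ j) / (1 - norm (a * q ^ j)) ^ 2)"
      using geo[of "norm (a * q ^ j)"] small[of j] by (simp add: f_def norm_mult norm_power power_mult_distrib del: of_nat_Suc)
    then show ?thesis by (intro sums_nonneg_imp_has_sum) auto
  qed
  have "(\<lambda>p. norm (f p)) summable_on UNIV \<times> UNIV"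
  proof (rule Infinite_Sum.abs_summable_on_Sigma_iff[THEN iffD2], intro conjI ballI)
    show "(\<lambda>y. norm (f (x, y))) summable_on UNIV" for x
      using geon has_sum_imp_summable by blast
    \<comment> \<open>Absolute convergence of the double series is the convergence of
      \<open>double_pole_sum\<close> at the norms of \<open>a\<close> and \<open>q\<close>.\<close>
    have "summable (\<lambda>j. norm (of_real (norm a) * of_real (norm q) ^ j / (1 - of_real (norm a) * of_real (norm q) ^ j) ^ 2 :: complex))"
      using assms by (intro abs_summable_double_pole_sum) auto
    also have "(\<lambda>j. norm (of_real (norm a) * of_real (norm q) ^ j / (1 - of_real (norm a) * of_real (norm q) ^ j) ^ 2 :: complex)) =
       (\<lambda>j. norm (norm (a * q ^ j) / (1 - norm (a * q ^ j)) ^ 2))"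
    proof
      fix j
      have "of_real (norm a) * of_real (norm q) ^ j / (1 - of_real (norm a) * of_real (norm q) ^ j) ^ 2 =
        (of_real (norm (a * q ^ j) / (1 - norm (a * q ^ j)) ^ 2) :: complex)"
        by (simp add: norm_mult norm_power)
      then show "norm (of_real (norm a) * of_real (norm q) ^ j / (1 - of_real (norm a) * of_real (norm q) ^ j) ^ 2 :: complex) =
         norm (norm (a * q ^ j) / (1 - norm (a * q ^ j)) ^ 2)"
        by (simp only: norm_of_real real_norm_def)
    qed
    finally have "(\<lambda>j. norm (norm (a * q ^ j) / (1 - norm (a * q ^ j)) ^ 2)) summable_on UNIV"
      by (intro summable_nonneg_imp_summable_on) auto
    then show "(\<lambda>x. norm (\<Sum>\<^sub>\<infinity>y. norm (f (x, y)))) summable_on UNIV"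
      by (simp only: infsumI[OF geon])
  qed
  then have sf: "(\<lambda>p. norm (f p)) summable_on UNIV" by simp
  then obtain S where S: "(f has_sum S) (UNIV \<times> UNIV)"
    using abs_summable_summable[OF sf] by (auto simp: summable_on_def)
  have row: "((\<lambda>m. f (j, m)) has_sum (a * q ^ j / (1 - a * q ^ j) ^ 2)) UNIV" for j
  proof (rule norm_summable_imp_has_sum)
    show "summable (\<lambda>m. norm (f (j, m)))"
      using has_sum_imp_sums[OF geon[of j]] by (rule sums_summable)
    show "(\<lambda>m. f (j, m)) sums (a * q ^ j / (1 - a * q ^ j) ^ 2)"
      using geo[OF small[of j]] by (simp add: f_def)
  qed
  have "((\<lambda>j. a * q ^ j / (1 - a * q ^ j) ^ 2) has_sum S) UNIV"
    by (rule has_sum_Sigma'[OF S]) (use row in simp)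
  then have SL: "S = double_pole_sum a q"
    unfolding double_pole_sum_def by (metis has_sum_imp_sums sums_unique)
  have qm: "norm (q ^ Suc m) < 1" for m
    using assms(1) by (simp add: norm_power power_less_one_iff del: power_Suc)
  have colf: "f (j, m) = of_nat (Suc m) * a ^ Suc m * (q ^ Suc m) ^ j" for j m
    by (simp only: f_def prod.case power_mult_distrib power_mult[symmetric] mult.commute[of j] mult.assoc)
  have coln: "((\<lambda>j. norm (f (j, m))) has_sum (norm (of_nat (Suc m) * a ^ Suc m) * (1 / (1 - norm (q ^ Suc m))))) UNIV" for m
    unfolding colf norm_mult[of _ "(q ^ Suc m) ^ _"] norm_power[of "q ^ Suc m"]
    by (intro has_sum_cmult_right sums_nonneg_imp_has_sum geometric_sums) (use qm in auto)
  have col: "((\<lambda>j. f (j, m)) has_sum (of_nat (Suc m) * a ^ Suc m / (1 - q ^ Suc m))) UNIV" for m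
  proof -
    have "(\<lambda>j. f (j, m)) sums (of_nat (Suc m) * a ^ Suc m * (1 / (1 - q ^ Suc m)))"
      unfolding colf by (intro sums_mult geometric_sums qm)
    then show ?thesis
      using norm_summable_imp_has_sum[OF sums_summable[OF has_sum_imp_sums[OF coln[of m]]]] by simp
  qed
  have Ssw: "((\<lambda>(m, j). f (j, m)) has_sum S) (UNIV \<times> UNIV)"
    using has_sum_swap[of f UNIV UNIV S] S by (simp add: case_prod_unfold)
  have hs: "((\<lambda>m. of_nat (Suc m) * a ^ Suc m / (1 - q ^ Suc m)) has_sum S) UNIV"
    by (rule has_sum_Sigma'[OF Ssw]) (use col in simp)
  then show "(\<lambda>m. of_nat (Suc m) * a ^ Suc m / (1 - q ^ Suc m)) sums double_pole_sum a q"
    unfolding SL by (rule has_sum_imp_sums)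
  have "(\<lambda>m. of_nat (Suc m) * a ^ Suc m / (1 - q ^ Suc m)) summable_on UNIV"
    using hs has_sum_imp_summable by blast
  then show "summable (\<lambda>m. norm (of_nat (Suc m) * a ^ Suc m / (1 - q ^ Suc m)))"
    unfolding summable_on_iff_abs_summable_on_complex by (rule summable_on_imp_summable)
qed

section \<open>Theta functions at roots of unity\<close>

text \<open>The complex counterpart of \<open>euler_E\<close>; \<open>of_real_euler_E\<close>
  identifies the two.\<close>

definition eulerc :: "complex \<Rightarrow> complex" where
  "eulerc q = qpoch q q"

lemma cube_root_facts:
  fixes w :: complex
  assumes w: "w ^ 2 + w + 1 = 0"
  shows "w \<noteq> 0" "inverse w = w ^ 2" "w ^ 3 = 1" "w \<noteq> 1" "w \<noteq> - 1"
proof -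
  show "w \<noteq> 0" "w \<noteq> 1" "w \<noteq> - 1" using w by auto
  show "w ^ 3 = 1" using w by algebra
  then show "inverse w = w ^ 2" by (intro inverse_unique) (simp add: power3_eq_cube power2_eq_square mult_ac)
qed

context
  fixes q :: complex
  assumes q: "q \<noteq> 0" "norm q < 1"
begin

lemma norm_pow_lt_1: "k > 0 \<Longrightarrow> norm (q ^ k) < 1"
  using q by (simp add: norm_power power_less_one_iff)

lemma eulerc_pow_nonzero: "k > 0 \<Longrightarrow> eulerc (q ^ k) \<noteq> 0"
  unfolding eulerc_def using norm_pow_lt_1 by (intro qpoch_nonzero)

lemma eulerc_nonzero: "eulerc q \<noteq> 0"
  unfolding eulerc_def using q by (intro qpoch_nonzero)

lemma qpoch_minus: "qpoch (- a) q * qpoch a q = qpoch (a ^ 2) (q ^ 2)"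
  using qpoch_prod_family[of q 2 "\<lambda>i. if i = 0 then - 1 else 1" a] q
  by (simp add: numeral_2_eq_2 lessThan_Suc algebra_simps)

lemma qpoch_cube:
  assumes w: "w ^ 2 + w + 1 = 0"
  shows "qpoch a q * qpoch (w * a) q * qpoch (w ^ 2 * a) q = qpoch (a ^ 3) (q ^ 3)"
proof -
  have "(\<Prod>i<3. qpoch (w ^ i * a) q) = qpoch (a ^ 3) (q ^ 3)"
  proof (rule qpoch_prod_family)
    fix z
    have "(1 - z) * (1 - w * z) * (1 - w ^ 2 * z) = 1 - z ^ 3"
      using w by algebra
    then show "(\<Prod>i<3. 1 - w ^ i * z) = 1 - z ^ 3"
      by (simp add: numeral_3_eq_3 lessThan_Suc mult_ac power2_eq_square)
  qed (use q in auto)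
  then show ?thesis
    by (simp add: numeral_3_eq_3 lessThan_Suc mult_ac power2_eq_square)
qed

lemma qpoch_split2: "qpoch a q = qpoch a (q ^ 2) * qpoch (a * q) (q ^ 2)"
  using qpoch_split[of q 2 a] q by (simp add: numeral_2_eq_2 lessThan_Suc mult_ac)

lemma qpoch_split3: "qpoch a q = qpoch a (q ^ 3) * qpoch (a * q) (q ^ 3) * qpoch (a * q ^ 2) (q ^ 3)"
  using qpoch_split[of q 3 a] q by (simp add: numeral_3_eq_3 lessThan_Suc mult_ac power2_eq_square)

lemma theta_minus_1: "theta (- 1) q = 2 * eulerc (q ^ 2) ^ 2 / eulerc q ^ 2"
proof -
  have "qpoch (- q) q * eulerc q = eulerc (q ^ 2)"
    using qpoch_minus[of q] by (simp add: eulerc_def)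
  then have "qpoch (- q) q = eulerc (q ^ 2) / eulerc q"
    using eulerc_nonzero by (simp add: field_simps)
  then show ?thesis
    using q by (simp add: theta_eq power2_eq_square)
qed

lemma theta_i: "theta \<i> q = (1 - \<i>) * eulerc (q ^ 4) / eulerc (q ^ 2)"
proof -
  have "qpoch (- (\<i> * q)) q * qpoch (\<i> * q) q = qpoch (- (q ^ 2)) (q ^ 2)"
    using qpoch_minus[of "\<i> * q"] by (simp add: power_mult_distrib)
  moreover have "qpoch (- (q ^ 2)) (q ^ 2) * qpoch (q ^ 2) (q ^ 2) = qpoch ((q ^ 2) ^ 2) ((q ^ 2) ^ 2)"
    using Submission.qpoch_minus[of "q ^ 2" "q ^ 2"] q norm_pow_lt_1[of 2] by simp
  ultimately have "qpoch (- (\<i> * q)) q * qpoch (\<i> * q) q = eulerc (q ^ 4) / eulerc (q ^ 2)"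
    using eulerc_pow_nonzero[of 2] by (simp add: eulerc_def field_simps flip: power_mult)
  then show ?thesis
    using q by (simp add: theta_eq mult_ac)
qed

lemma theta_odd: "theta q (q ^ 2) = (eulerc q / eulerc (q ^ 2)) ^ 2"
proof -
  have "qpoch q (q ^ 2) = eulerc q / eulerc (q ^ 2)"
    using qpoch_split2[of q] eulerc_pow_nonzero[of 2] by (simp add: eulerc_def power2_eq_square)
  then show ?thesis
    using q by (simp add: theta_def power2_eq_square)
qed

text \<open>The factors at i q and -i q combine to (-q^2; q^4) = (q^4; q^8) / (q^2; q^4). As i / q =
  1 / (-i q), the second value follows by inversion.\<close>

lemma theta_i_odd:
  "theta (\<i> * q) (q ^ 2) = eulerc (q ^ 4) ^ 2 / (eulerc (q ^ 2) * eulerc (q ^ 8))"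
  "theta (\<i> / q) (q ^ 2) = - \<i> * eulerc (q ^ 4) ^ 2 / (q * eulerc (q ^ 2) * eulerc (q ^ 8))"
proof -
  have odd: "qpoch (q ^ k) (q ^ (2 * k)) = eulerc (q ^ k) / eulerc (q ^ (2 * k))" if "k > 0" for k
    using Submission.qpoch_split2[of "q ^ k" "q ^ k"] q norm_pow_lt_1[OF that] eulerc_pow_nonzero[of "2 * k"] that
    by (simp add: eulerc_def field_simps power2_eq_square flip: power_mult power_add mult_2)
  have gen: "P = b ^ 2 / (a * c)" if "P * (a / b) = b / c" "a \<noteq> 0" "b \<noteq> 0" "c \<noteq> 0" for P a b c :: complex
    using that by (simp add: field_simps power2_eq_square)
  have "qpoch (- (\<i> * q)) (q ^ 2) * qpoch (\<i> * q) (q ^ 2) = qpoch (- (q ^ 2)) (q ^ 4)"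
    using Submission.qpoch_minus[of "q ^ 2" "\<i> * q"] q norm_pow_lt_1[of 2]
    by (simp add: power_mult_distrib flip: power_mult)
  moreover have "qpoch (- (q ^ 2)) (q ^ 4) * qpoch (q ^ 2) (q ^ 4) = qpoch (q ^ 4) (q ^ 8)"
    using Submission.qpoch_minus[of "q ^ 4" "q ^ 2"] q norm_pow_lt_1[of 4]
    by (simp add: power_mult_distrib flip: power_mult)
  ultimately have *: "qpoch (- (\<i> * q)) (q ^ 2) * qpoch (\<i> * q) (q ^ 2) = eulerc (q ^ 4) ^ 2 / (eulerc (q ^ 2) * eulerc (q ^ 8))"
    using gen[where a = "eulerc (q ^ 2)" and b = "eulerc (q ^ 4)" and c = "eulerc (q ^ 8)"] odd[of 2] odd[of 4]
      eulerc_pow_nonzero[of 2] eulerc_pow_nonzero[of 4] eulerc_pow_nonzero[of 8] by simp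
  have iq: "q ^ 2 / (\<i> * q) = - (\<i> * q)" "q ^ 2 / (- \<i> * q) = \<i> * q"
    using q by (simp_all add: field_simps power2_eq_square)
  show "theta (\<i> * q) (q ^ 2) = eulerc (q ^ 4) ^ 2 / (eulerc (q ^ 2) * eulerc (q ^ 8))"
    unfolding theta_def iq(1) using * by (simp add: mult.commute)
  have "theta (\<i> / q) (q ^ 2) = theta (1 / (- \<i> * q)) (q ^ 2)"
    by (simp add: divide_inverse)
  also have "\<dots> = - theta (- \<i> * q) (q ^ 2) / (- \<i> * q)"
    using q norm_pow_lt_1[of 2] by (intro theta_inverse) auto
  also have "theta (- \<i> * q) (q ^ 2) = eulerc (q ^ 4) ^ 2 / (eulerc (q ^ 2) * eulerc (q ^ 8))"
    unfolding theta_def iq(2) using * by simp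
  also have "- (eulerc (q ^ 4) ^ 2 / (eulerc (q ^ 2) * eulerc (q ^ 8))) / (- \<i> * q) = - \<i> * eulerc (q ^ 4) ^ 2 / (q * eulerc (q ^ 2) * eulerc (q ^ 8))"
    using q eulerc_pow_nonzero[of 2] eulerc_pow_nonzero[of 8] by (simp add: field_simps)
  finally show "theta (\<i> / q) (q ^ 2) = - \<i> * eulerc (q ^ 4) ^ 2 / (q * eulerc (q ^ 2) * eulerc (q ^ 8))" .
qed

lemma theta_q_q3: "theta q (q ^ 3) = eulerc q / eulerc (q ^ 3)"
proof -
  have "q ^ 3 / q = q ^ 2" "q * q = q ^ 2" "q * q ^ 2 = q ^ 3"
    using q by (simp_all add: field_simps power3_eq_cube power2_eq_square)
  then show ?thesis
    using qpoch_split3[of q] eulerc_pow_nonzero[of 3] by (simp add: eulerc_def theta_def field_simps)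
qed

context
  fixes w :: complex
  assumes w: "w ^ 2 + w + 1 = 0"
begin

lemmas wf = cube_root_facts[OF w]

lemma theta_w: "theta w q = (1 - w) * eulerc (q ^ 3) / eulerc q"
proof -
  have "eulerc q * (qpoch (q * w) q * qpoch (q / w) q) = eulerc (q ^ 3)"
    using qpoch_cube[OF w, of q] wf by (simp add: eulerc_def divide_inverse mult_ac)
  then have "qpoch (q * w) q * qpoch (q / w) q = eulerc (q ^ 3) / eulerc q"
    using eulerc_nonzero by (simp add: field_simps)
  then show ?thesis using q wf by (simp add: theta_eq mult.assoc)
qed

text \<open>Multiplying the factors at -w and -w^2 by those at w and w^2 gives factors at w^2 and
  w^4 = w in the nome q^2. Both auxiliary products are eta quotients by the cube formula.\<close>

lemma theta_minus_w: "theta (- w) q = (1 + w) * eulerc (q ^ 6) * eulerc q / (eulerc (q ^ 2) * eulerc (q ^ 3))"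
proof -
  have w4: "w ^ 4 = w" using wf(3) by (simp add: eval_nat_numeral)
  have a: "qpoch (- (w * q)) q * qpoch (w * q) q = qpoch (w ^ 2 * q ^ 2) (q ^ 2)"
    using qpoch_minus[of "w * q"] by (simp add: power_mult_distrib)
  have b: "qpoch (- (w ^ 2 * q)) q * qpoch (w ^ 2 * q) q = qpoch (w * q ^ 2) (q ^ 2)"
    using qpoch_minus[of "w ^ 2 * q"] by (simp add: power_mult_distrib w4 flip: power_mult)
  have c: "qpoch (w * q) q * qpoch (w ^ 2 * q) q = eulerc (q ^ 3) / eulerc q"
    using qpoch_cube[OF w, of q] eulerc_nonzero by (simp add: eulerc_def field_simps)
  have d: "qpoch (w * q ^ 2) (q ^ 2) * qpoch (w ^ 2 * q ^ 2) (q ^ 2) = eulerc (q ^ 6) / eulerc (q ^ 2)"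
    using Submission.qpoch_cube[OF _ _ w, of "q ^ 2" "q ^ 2"] q norm_pow_lt_1[of 2] eulerc_pow_nonzero[of 2]
    by (simp add: eulerc_def field_simps flip: power_mult)
  have "qpoch (- (w * q)) q * qpoch (- (w ^ 2 * q)) q * (eulerc (q ^ 3) / eulerc q) = eulerc (q ^ 6) / eulerc (q ^ 2)"
    unfolding c[symmetric] d[symmetric] a[symmetric] b[symmetric] by (simp add: mult_ac)
  then have e: "qpoch (- (w * q)) q * qpoch (- (w ^ 2 * q)) q = eulerc (q ^ 6) * eulerc q / (eulerc (q ^ 2) * eulerc (q ^ 3))"
    using eulerc_nonzero eulerc_pow_nonzero[of 2] eulerc_pow_nonzero[of 3] by (simp add: field_simps)
  have "q / (- w) = - (w ^ 2 * q)" using wf(2) by (simp add: divide_inverse)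
  then have "theta (- w) q = (1 + w) * (qpoch (- (w * q)) q * qpoch (- (w ^ 2 * q)) q)"
    using theta_eq[of q "- w"] q wf by (simp add: mult_ac)
  then show ?thesis unfolding e by simp
qed

text \<open>Since w / q is the inverse of w^2 q, this is, up to a monomial, the product of the theta
  values at w q and w^2 q. Together with \<open>theta q (q ^ 3)\<close> it collapses to (q^3; q^9)
  (q^6; q^9) = E(q^3) / E(q^9).\<close>

lemma theta_w_q_q3:
  "theta (w * q) (q ^ 3) * theta (w / q) (q ^ 3) = - w / q * (eulerc (q ^ 3) ^ 2 / (eulerc q * eulerc (q ^ 9)))"
proof -
  have q3: "q ^ 3 \<noteq> 0" "norm (q ^ 3) < 1" using q norm_pow_lt_1[of 3] by auto
  have "q ^ 3 / (w * q) = inverse w * q ^ 2"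
    using q by (simp add: field_simps power3_eq_cube power2_eq_square)
  then have 1: "theta (w * q) (q ^ 3) = qpoch (w * q) (q ^ 3) * qpoch (w ^ 2 * q ^ 2) (q ^ 3)"
    unfolding wf by (simp only: theta_def)
  have q3q: "q ^ 3 / q = q ^ 2"
    using q by (simp add: field_simps power3_eq_cube power2_eq_square)
  have iw2: "inverse (w ^ 2) = w" using wf(3) by (intro inverse_unique) (simp add: power3_eq_cube power2_eq_square mult_ac)
  have "q ^ 3 / (w ^ 2 * q) = inverse (w ^ 2) * q ^ 2"
    using q by (simp add: field_simps power3_eq_cube power2_eq_square)
  then have 2: "theta (w ^ 2 * q) (q ^ 3) = qpoch (w ^ 2 * q) (q ^ 3) * qpoch (w * q ^ 2) (q ^ 3)"
    unfolding iw2 by (simp only: theta_def)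
  have "theta (w / q) (q ^ 3) = theta (1 / (w ^ 2 * q)) (q ^ 3)"
    using iw2 by (simp add: divide_inverse mult_ac del: power_inverse)
  also have "\<dots> = - theta (w ^ 2 * q) (q ^ 3) / (w ^ 2 * q)"
    using q q3 wf by (intro theta_inverse) auto
  also have "\<dots> = - w / q * theta (w ^ 2 * q) (q ^ 3)"
    using iw2 by (simp add: divide_inverse mult_ac del: power_inverse)
  finally have 3: "theta (w / q) (q ^ 3) = - w / q * theta (w ^ 2 * q) (q ^ 3)" .
  have "theta q (q ^ 3) * theta (w * q) (q ^ 3) * theta (w ^ 2 * q) (q ^ 3) =
    (qpoch q (q ^ 3) * qpoch (w * q) (q ^ 3) * qpoch (w ^ 2 * q) (q ^ 3)) *
    (qpoch (q ^ 2) (q ^ 3) * qpoch (w * q ^ 2) (q ^ 3) * qpoch (w ^ 2 * q ^ 2) (q ^ 3))"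
    unfolding 1 2 theta_def[of q] q3q by (simp add: mult_ac)
  also have "\<dots> = qpoch (q ^ 3) (q ^ 9) * qpoch (q ^ 6) (q ^ 9)"
    using Submission.qpoch_cube[OF q3 w, of q] Submission.qpoch_cube[OF q3 w, of "q ^ 2"] by (simp flip: power_mult)
  also have "\<dots> = eulerc (q ^ 3) / eulerc (q ^ 9)"
    using Submission.qpoch_split3[OF q3, of "q ^ 3"] eulerc_pow_nonzero[of 9]
    by (simp add: eulerc_def field_simps flip: power_mult power_add)
  finally have "theta (w * q) (q ^ 3) * theta (w ^ 2 * q) (q ^ 3) = eulerc (q ^ 3) ^ 2 / (eulerc q * eulerc (q ^ 9))"
    using eulerc_nonzero eulerc_pow_nonzero[of 3] eulerc_pow_nonzero[of 9]
    by (simp add: theta_q_q3 field_simps power2_eq_square)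
  then show ?thesis unfolding 3 by (simp add: mult_ac)
qed

end

end

text \<open>The sum of y / (1 - y)^2 over all y = x q^n with n an integer; up to normalization the
  Weierstrass function.\<close>

definition wp :: "complex \<Rightarrow> complex \<Rightarrow> complex" where
  "wp x q = double_pole_sum x q + double_pole_sum (q / x) q"

lemma eq_divide_of_mult:
  fixes k X Y :: "'a::field"
  shows "k * X = Y \<Longrightarrow> k \<noteq> 0 \<Longrightarrow> X = Y / k"
  by (auto simp: field_simps)

lemma mult_left_cancelD:
  fixes k X Y :: "'a::field"
  shows "k * X = k * Y \<Longrightarrow> k \<noteq> 0 \<Longrightarrow> X = Y"
  by simp

section \<open>Differences of Weierstrass values at torsion points\<close>

context
  fixes q :: complex
  assumes q: "q \<noteq> 0" "norm q < 1"
begin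

lemma eulerc_nz: "eulerc q \<noteq> 0" "eulerc (q ^ 2) \<noteq> 0" "eulerc (q ^ 3) \<noteq> 0" "eulerc (q ^ 4) \<noteq> 0" "eulerc (q ^ 5) \<noteq> 0"
    "eulerc (q ^ 6) \<noteq> 0" "eulerc (q ^ 8) \<noteq> 0" "eulerc (q ^ 9) \<noteq> 0"
  by (simp_all add: eulerc_nonzero[OF q] eulerc_pow_nonzero[OF q])

context
  fixes w :: complex
  assumes w: "w ^ 2 + w + 1 = 0"
begin

lemma theta_w_nz: "theta w q \<noteq> 0" "theta (- w) q \<noteq> 0" "theta (- 1) q \<noteq> 0"
  using cube_root_facts[OF w] eulerc_nz by (auto simp: theta_w[OF q w] theta_minus_w[OF q w] theta_minus_1[OF q] add_eq_0_iff2 minus_equation_iff[of w])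

text \<open>The points have orders 3, 6 and 2. Products and quotients of two of them are, up to
  inversion, again among the three, so every theta value in the difference formula is one of three
  known eta quotients.\<close>

lemma wp_level6:
  "wp w q - wp (- w) q = 2 / 3 * (eulerc q ^ 3 * eulerc (q ^ 2) ^ 3 / (eulerc (q ^ 3) * eulerc (q ^ 6)))" (is ?A)
  "wp (- 1) q - wp (- w) q = 3 / 4 * (eulerc q ^ 4 * eulerc (q ^ 3) ^ 4 / (eulerc (q ^ 2) ^ 2 * eulerc (q ^ 6) ^ 2))" (is ?B)
  "wp (- 1) q - wp w q = 1 / 12 * (eulerc q ^ 12 * eulerc (q ^ 6) ^ 2 / (eulerc (q ^ 2) ^ 6 * eulerc (q ^ 3) ^ 4))" (is ?C)
proof -
  note nz = theta_w_nz and wf = cube_root_facts[OF w]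
  define a b c d where abcd: "a = eulerc q" "b = eulerc (q ^ 2)" "c = eulerc (q ^ 3)" "d = eulerc (q ^ 6)"
  have enz: "a \<noteq> 0" "b \<noteq> 0" "c \<noteq> 0" "d \<noteq> 0" using eulerc_nz by (auto simp: abcd)
  have tw: "theta w q = (1 - w) * c / a" and tmw: "theta (- w) q = (1 + w) * d * a / (b * c)"
    and tm: "theta (- 1) q = 2 * b ^ 2 / a ^ 2"
    unfolding abcd by (simp_all add: theta_w[OF q w] theta_minus_w[OF q w] theta_minus_1[OF q])
  have inv1: "theta (1 / w) q = - theta w q / w" "theta (1 / - w) q = theta (- w) q / w"
    using theta_inverse[of q w] theta_inverse[of q "- w"] q wf by auto
  have w2: "1 / w = w ^ 2" using wf by (simp add: divide_inverse)
  have m2: "(1 - w) ^ 2 = - 3 * w" "(1 + w) ^ 2 = w" "(1 + w) * (1 - w) ^ 2 = 3" using w by algebra+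
  have tmw2: "theta (- w) q ^ 2 = w * (d * a / (b * c)) ^ 2"
    unfolding tmw using m2(2) by (simp add: power_mult_distrib power_divide)
  have tw2: "theta w q ^ 2 = - 3 * w * (c / a) ^ 2"
    unfolding tw using m2(1) by (simp add: power_mult_distrib power_divide)
  have "theta (- w) q * theta (1 / - w) q * theta w q ^ 2 * (wp w q - wp (- w) q) =
      a ^ 4 * theta (w * - w) q * theta (w / - w) q"
    unfolding wp_def abcd eulerc_def using q wf nz by (intro double_pole_sum_difference) auto
  moreover have "theta (w * - w) q = theta (1 / - w) q"
    using w2 by (simp add: power2_eq_square)
  moreover have "theta (w / - w) q = theta (- 1) q" using wf by simp
  moreover have "theta (1 / - w) q \<noteq> 0" using inv1 nz wf by simp
  moreover have "P * Q * D = A * B" if "P * t * Q * D = A * t * B" "t \<noteq> 0" for P Q D A B t :: complex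
  proof -
    have "t * (P * Q * D) = t * (A * B)" using that(1) by (simp add: mult_ac)
    then show ?thesis using that(2) by simp
  qed
  ultimately have "theta (- w) q * theta w q ^ 2 * (wp w q - wp (- w) q) = a ^ 4 * theta (- 1) q"
    by metis
  moreover have "theta (- w) q * theta w q ^ 2 = 3 * d * c / (a * b)"
  proof -
    have "theta (- w) q * theta w q ^ 2 = ((1 + w) * (1 - w) ^ 2) * (d * c / (a * b))"
      unfolding tw tmw using enz by (simp add: field_simps power2_eq_square)
    then show ?thesis unfolding m2(3) by simp
  qed
  ultimately have "3 * d * c / (a * b) * (wp w q - wp (- w) q) = a ^ 4 * (2 * b ^ 2 / a ^ 2)"
    unfolding tm by simp
  moreover have "3 * d * c / (a * b) \<noteq> 0" using enz by simp
  ultimately have "wp w q - wp (- w) q = a ^ 4 * (2 * b ^ 2 / a ^ 2) / (3 * d * c / (a * b))"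
    by (rule eq_divide_of_mult)
  also have "\<dots> = 2 / 3 * (a ^ 3 * b ^ 3 / (c * d))"
    using enz by (simp add: field_simps eval_nat_numeral)
  finally show ?A unfolding abcd .
  have "theta (- w) q * theta (1 / - w) q * theta (- 1) q ^ 2 * (wp (- 1) q - wp (- w) q) =
      a ^ 4 * theta (- 1 * - w) q * theta (- 1 / - w) q"
    unfolding wp_def abcd eulerc_def using q wf nz by (intro double_pole_sum_difference) auto
  then have "theta (- w) q * (theta (- w) q / w) * theta (- 1) q ^ 2 * (wp (- 1) q - wp (- w) q) =
      a ^ 4 * theta w q * (- theta w q / w)"
    unfolding inv1 by (simp add: inv1)
  then have "inverse w * (theta (- w) q ^ 2 * theta (- 1) q ^ 2 * (wp (- 1) q - wp (- w) q)) = inverse w * - (a ^ 4 * theta w q ^ 2)"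
    by (simp add: power2_eq_square divide_inverse mult_ac)
  then have "theta (- w) q ^ 2 * theta (- 1) q ^ 2 * (wp (- 1) q - wp (- w) q) = - (a ^ 4 * theta w q ^ 2)"
    by (rule mult_left_cancelD) (use wf(1) in simp)
  then have "w * ((d * a / (b * c)) ^ 2 * (2 * b ^ 2 / a ^ 2) ^ 2 * (wp (- 1) q - wp (- w) q)) = w * (3 * a ^ 4 * (c / a) ^ 2)"
    unfolding tw2 tmw2 tm by (simp add: mult_ac)
  then have "(d * a / (b * c)) ^ 2 * (2 * b ^ 2 / a ^ 2) ^ 2 * (wp (- 1) q - wp (- w) q) = 3 * a ^ 4 * (c / a) ^ 2"
    using wf(1) by (rule mult_left_cancelD)
  moreover have "(d * a / (b * c)) ^ 2 * (2 * b ^ 2 / a ^ 2) ^ 2 \<noteq> 0" using enz by simp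
  ultimately have "wp (- 1) q - wp (- w) q = 3 * a ^ 4 * (c / a) ^ 2 / ((d * a / (b * c)) ^ 2 * (2 * b ^ 2 / a ^ 2) ^ 2)"
    by (rule eq_divide_of_mult)
  also have "\<dots> = 3 / 4 * (a ^ 4 * c ^ 4 / (b ^ 2 * d ^ 2))"
    using enz by (simp add: field_simps eval_nat_numeral)
  finally show ?B unfolding abcd .
  have "theta w q * theta (1 / w) q * theta (- 1) q ^ 2 * (wp (- 1) q - wp w q) =
      a ^ 4 * theta (- 1 * w) q * theta (- 1 / w) q"
    unfolding wp_def abcd eulerc_def using q wf nz by (intro double_pole_sum_difference) auto
  then have "theta w q ^ 2 * theta (- 1) q ^ 2 * (wp (- 1) q - wp w q) = - (a ^ 4 * theta (- w) q ^ 2)"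
    using wf inv1 by (simp add: field_simps power2_eq_square)
  then have "w * (3 * (c / a) ^ 2 * (2 * b ^ 2 / a ^ 2) ^ 2 * (wp (- 1) q - wp w q)) = w * (a ^ 4 * (d * a / (b * c)) ^ 2)"
    unfolding tw2 tmw2 tm by (simp add: mult_ac)
  then have "3 * (c / a) ^ 2 * (2 * b ^ 2 / a ^ 2) ^ 2 * (wp (- 1) q - wp w q) = a ^ 4 * (d * a / (b * c)) ^ 2"
    using wf(1) by (rule mult_left_cancelD)
  moreover have "3 * (c / a) ^ 2 * (2 * b ^ 2 / a ^ 2) ^ 2 \<noteq> 0" using enz by simp
  ultimately have "wp (- 1) q - wp w q = a ^ 4 * (d * a / (b * c)) ^ 2 / (3 * (c / a) ^ 2 * (2 * b ^ 2 / a ^ 2) ^ 2)"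
    by (rule eq_divide_of_mult)
  also have "\<dots> = 1 / 12 * (a ^ 12 * d ^ 2 / (b ^ 6 * c ^ 4))"
    using enz by (simp add: field_simps eval_nat_numeral)
  finally show ?C unfolding abcd .
qed

text \<open>In the nome q^3 both \<open>w\<close> and \<open>q\<close> are points of order
  three.\<close>

lemma wp_level9:
  "wp w (q ^ 3) - wp q (q ^ 3) = - 1 / 3 * (eulerc (q ^ 3) ^ 10 / (eulerc q ^ 3 * eulerc (q ^ 9) ^ 3))"
proof -
  note wf = cube_root_facts[OF w]
  have q3: "q ^ 3 \<noteq> 0" "norm (q ^ 3) < 1" using q norm_pow_lt_1[OF q, of 3] by auto
  define a c d where acd: "a = eulerc q" "c = eulerc (q ^ 3)" "d = eulerc (q ^ 9)"
  have enz: "a \<noteq> 0" "c \<noteq> 0" "d \<noteq> 0" using eulerc_nz by (auto simp: acd)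
  have tw: "theta w (q ^ 3) = (1 - w) * d / c"
    using theta_w[OF q3 w] by (simp add: acd flip: power_mult)
  have tq: "theta q (q ^ 3) = a / c" unfolding acd by (rule theta_q_q3[OF q])
  have nz: "theta w (q ^ 3) \<noteq> 0" "theta q (q ^ 3) \<noteq> 0"
    using enz wf by (auto simp: tw tq)
  have tqi: "theta (1 / q) (q ^ 3) = - theta q (q ^ 3) / q"
    using q q3 by (intro theta_inverse)
  have "(1 - w) ^ 2 = - 3 * w" using w by algebra
  then have tw2: "theta w (q ^ 3) ^ 2 = - 3 * w * (d / c) ^ 2"
    by (simp add: tw power_mult_distrib power_divide)
  have "theta q (q ^ 3) * theta (1 / q) (q ^ 3) * theta w (q ^ 3) ^ 2 * (wp w (q ^ 3) - wp q (q ^ 3)) =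
      c ^ 4 * theta (w * q) (q ^ 3) * theta (w / q) (q ^ 3)"
    unfolding wp_def eulerc_def acd using q q3 wf nz by (intro double_pole_sum_difference) auto
  also have "\<dots> = c ^ 4 * (- w / q * (c ^ 2 / (a * d)))"
    using theta_w_q_q3[OF q w] by (simp only: mult.assoc acd)
  finally have "(w / q) * (3 * (a / c) ^ 2 * (d / c) ^ 2 * (wp w (q ^ 3) - wp q (q ^ 3))) = (w / q) * (- (c ^ 4 * (c ^ 2 / (a * d))))"
    unfolding tw2 tqi tq by (simp add: mult_ac power2_eq_square)
  moreover have "w / q \<noteq> 0" using wf q by simp
  ultimately have "3 * (a / c) ^ 2 * (d / c) ^ 2 * (wp w (q ^ 3) - wp q (q ^ 3)) = - (c ^ 4 * (c ^ 2 / (a * d)))"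
    by (rule mult_left_cancelD)
  moreover have "3 * (a / c) ^ 2 * (d / c) ^ 2 \<noteq> 0" using enz by simp
  ultimately have "wp w (q ^ 3) - wp q (q ^ 3) = - (c ^ 4 * (c ^ 2 / (a * d))) / (3 * (a / c) ^ 2 * (d / c) ^ 2)"
    by (rule eq_divide_of_mult)
  also have "\<dots> = - 1 / 3 * (c ^ 10 / (a ^ 3 * d ^ 3))"
    using enz by (simp add: field_simps eval_nat_numeral)
  finally show ?thesis unfolding acd .
qed

end

text \<open>In the nome q^2 the point \<open>\<i>\<close> has order four and \<open>q\<close> has
  order two.\<close>

lemma wp_level8:
  "wp \<i> (q ^ 2) - wp q (q ^ 2) = - 1 / 2 * (eulerc (q ^ 2) ^ 6 * eulerc (q ^ 4) ^ 6 / (eulerc q ^ 4 * eulerc (q ^ 8) ^ 4))"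
proof -
  have q2: "q ^ 2 \<noteq> 0" "norm (q ^ 2) < 1" using q norm_pow_lt_1[OF q, of 2] by auto
  define a b c d where abcd: "a = eulerc q" "b = eulerc (q ^ 2)" "c = eulerc (q ^ 4)" "d = eulerc (q ^ 8)"
  have enz: "a \<noteq> 0" "b \<noteq> 0" "c \<noteq> 0" "d \<noteq> 0" using eulerc_nz by (auto simp: abcd)
  have ti: "theta \<i> (q ^ 2) = (1 - \<i>) * d / c"
    using theta_i[OF q2] by (simp add: abcd flip: power_mult)
  have tq: "theta q (q ^ 2) = (a / b) ^ 2" unfolding abcd by (rule theta_odd[OF q])
  have i1: "\<i> \<noteq> 1" by (simp add: complex_eq_iff)
  have nz: "theta \<i> (q ^ 2) \<noteq> 0" "theta q (q ^ 2) \<noteq> 0"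
    using enz i1 by (auto simp: ti tq)
  have tqi: "theta (1 / q) (q ^ 2) = - theta q (q ^ 2) / q"
    using q q2 by (intro theta_inverse)
  have "(1 - \<i>) ^ 2 = - 2 * \<i>" by (simp add: power2_eq_square algebra_simps)
  then have ti2: "theta \<i> (q ^ 2) ^ 2 = - 2 * \<i> * (d / c) ^ 2"
    by (simp add: ti power_mult_distrib power_divide)
  have "theta q (q ^ 2) * theta (1 / q) (q ^ 2) * theta \<i> (q ^ 2) ^ 2 * (wp \<i> (q ^ 2) - wp q (q ^ 2)) =
      b ^ 4 * theta (\<i> * q) (q ^ 2) * theta (\<i> / q) (q ^ 2)"
    unfolding wp_def eulerc_def abcd using q q2 nz by (intro double_pole_sum_difference) auto
  also have "\<dots> = b ^ 4 * (- \<i> / q * (c ^ 2 / (b * d)) ^ 2)"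
    unfolding theta_i_odd[OF q] abcd[symmetric] by (simp add: power2_eq_square mult_ac)
  finally have "(\<i> / q) * (2 * (a / b) ^ 4 * (d / c) ^ 2 * (wp \<i> (q ^ 2) - wp q (q ^ 2))) = (\<i> / q) * (- (b ^ 4 * (c ^ 2 / (b * d)) ^ 2))"
    unfolding ti2 tqi tq by (simp add: mult_ac power2_eq_square power4_eq_xxxx)
  moreover have "\<i> / q \<noteq> 0" using q by simp
  ultimately have "2 * (a / b) ^ 4 * (d / c) ^ 2 * (wp \<i> (q ^ 2) - wp q (q ^ 2)) = - (b ^ 4 * (c ^ 2 / (b * d)) ^ 2)"
    by (rule mult_left_cancelD)
  moreover have "2 * (a / b) ^ 4 * (d / c) ^ 2 \<noteq> 0" using enz by simp
  ultimately have "wp \<i> (q ^ 2) - wp q (q ^ 2) = - (b ^ 4 * (c ^ 2 / (b * d)) ^ 2) / (2 * (a / b) ^ 4 * (d / c) ^ 2)"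
    by (rule eq_divide_of_mult)
  also have "\<dots> = - 1 / 2 * (b ^ 6 * c ^ 6 / (a ^ 4 * d ^ 4))"
    using enz by (simp add: field_simps eval_nat_numeral)
  finally show ?thesis unfolding abcd .
qed

text \<open>The differences \<open>wp (- 1) q - wp w q\<close> and
  \<open>wp w q - wp (- w) q\<close> add up to the third one of \<open>wp_level6\<close>; the
  equation is normalized so that the second of them becomes the constant 8.\<close>

lemma level6_relation:
  "eulerc q ^ 9 * eulerc (q ^ 6) ^ 3 / (eulerc (q ^ 2) ^ 9 * eulerc (q ^ 3) ^ 3) + 8 = 9 * (eulerc q * eulerc (q ^ 3) ^ 5 / (eulerc (q ^ 2) ^ 5 * eulerc (q ^ 6)))"
proof -
  define w where "w = Complex (-1/2) (sqrt 3 / 2)"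
  have w: "w ^ 2 + w + 1 = 0"
    by (simp add: w_def complex_eq_iff power2_eq_square)
  define a b c d where abcd: "a = eulerc q" "b = eulerc (q ^ 2)" "c = eulerc (q ^ 3)" "d = eulerc (q ^ 6)"
  have enz: "a \<noteq> 0" "b \<noteq> 0" "c \<noteq> 0" "d \<noteq> 0" using eulerc_nz by (auto simp: abcd)
  have *: "1 / 12 * (a ^ 12 * d ^ 2 / (b ^ 6 * c ^ 4)) + 2 / 3 * (a ^ 3 * b ^ 3 / (c * d)) = 3 / 4 * (a ^ 4 * c ^ 4 / (b ^ 2 * d ^ 2))"
    unfolding abcd wp_level6[OF w, symmetric] by simp
  have "a ^ 9 * d ^ 3 / (b ^ 9 * c ^ 3) + 8 =
      (12 * (c * d) / (a ^ 3 * b ^ 3)) * (1 / 12 * (a ^ 12 * d ^ 2 / (b ^ 6 * c ^ 4)) + 2 / 3 * (a ^ 3 * b ^ 3 / (c * d)))"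
    using enz by (simp add: field_simps eval_nat_numeral)
  also have "\<dots> = 9 * (a * c ^ 5 / (b ^ 5 * d))"
    unfolding * using enz by (simp add: field_simps eval_nat_numeral)
  finally show ?thesis unfolding abcd .
qed

end

section \<open>Level five and the Rogers--Ramanujan continued fraction\<close>

text \<open>The cyclotomic equation is the only assumption, and z^2 satisfies it too, so later
  results can be applied to the conjugate root.\<close>

lemma fifth_root_facts:
  fixes z :: complex
  assumes z: "z ^ 4 + z ^ 3 + z ^ 2 + z + 1 = 0"
  shows "z \<noteq> 0" "z ^ 5 = 1" "z \<noteq> 1" "z ^ 2 \<noteq> 1" "inverse z = z ^ 4" "inverse (z ^ 2) = z ^ 3"
    "(z ^ 2) ^ 4 + (z ^ 2) ^ 3 + (z ^ 2) ^ 2 + z ^ 2 + 1 = 0"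
    "z * (1 - z) * (1 - z ^ 2) \<noteq> 0"
proof -
  show z5: "z ^ 5 = 1" using z by algebra
  show z0: "z \<noteq> 0" and z1: "z \<noteq> 1" using z by auto
  show sq: "(z ^ 2) ^ 4 + (z ^ 2) ^ 3 + (z ^ 2) ^ 2 + z ^ 2 + 1 = 0" using z by algebra
  show z2: "z ^ 2 \<noteq> 1"
  proof
    assume "z ^ 2 = 1"
    from sq[unfolded this] show False by simp
  qed
  show "inverse z = z ^ 4" by (rule inverse_unique) (use z5 in \<open>simp flip: power_Suc\<close>)
  show "inverse (z ^ 2) = z ^ 3" by (rule inverse_unique) (use z5 in \<open>simp flip: power_add\<close>)
  show "z * (1 - z) * (1 - z ^ 2) \<noteq> 0" using z0 z1 z2 by simp
qed

lemma prod_five: "(\<Prod>i<5. f i) = f 0 * f 1 * f 2 * f 3 * (f (4::nat) :: 'a::comm_monoid_mult)"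
  by (simp add: eval_nat_numeral lessThan_Suc mult_ac)

text \<open>Comparing the two products leaves the factors 1 - 1/x and 1 - x, whose quotient is -1/x.
  For x = 1, where nothing can be divided out, both sides vanish.\<close>

lemma theta_mult_q:
  assumes "q \<noteq> 0" "norm q < 1" "x \<noteq> 0"
  shows "theta (x * q) q = - theta x q / x"
proof -
  have "theta (x * q) q * (1 - x) = (1 - 1 / x) * theta x q"
  proof -
    have "theta (x * q) q = qpoch (x * q) q * qpoch (1 / x) q"
      using assms by (simp add: theta_def)
    also have "qpoch (1 / x) q = (1 - 1 / x) * qpoch (q / x) q"
      using qpoch_Suc[OF assms(2), of "1 / x"] by simp
    finally show ?thesis
      using qpoch_Suc[OF assms(2), of x] by (simp add: theta_def mult_ac)
  qed
  moreover have "(1 - 1 / x) = - (1 - x) / x" using assms by (simp add: field_simps)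
  ultimately show ?thesis
  proof (cases "x = 1")
    case True
    have "qpoch q q * qpoch 1 q = 0" using qpoch_Suc[OF assms(2), of 1] by simp
    then show ?thesis using True assms by (auto simp: theta_def)
  next
    case False
    have "(1 - x) * theta (x * q) q = (1 - x) * (- theta x q / x)"
      using \<open>theta (x * q) q * (1 - x) = (1 - 1 / x) * theta x q\<close> assms by (simp add: field_simps)
    then show ?thesis by (rule mult_left_cancelD) (use False in simp)
  qed
qed

lemma theta_reflect:
  assumes "q \<noteq> 0" "x \<noteq> 0" "x * y = q"
  shows "theta y q = theta x q"
proof -
  have "q / x = y" "q / y = x" using assms by auto
  then show ?thesis by (simp add: theta_def mult.commute)
qed

lemma sum_five: "(\<Sum>i<5. f i) = f 0 + f 1 + f 2 + f 3 + (f (4::nat) :: 'a::comm_monoid_add)"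
  by (simp add: eval_nat_numeral lessThan_Suc add_ac)

lemma exists_fifth_root: "\<exists>z::complex. z ^ 4 + z ^ 3 + z ^ 2 + z + 1 = 0"
proof -
  define z where "z = cis (2 * pi / 5)"
  have "z ^ 5 = cis (2 * pi)" unfolding z_def Complex.DeMoivre by (rule arg_cong[of _ _ cis]) simp
  then have "z ^ 5 = 1" by (simp only: cis_2pi)
  then have "(z - 1) * (z ^ 4 + z ^ 3 + z ^ 2 + z + 1) = 0" by algebra
  moreover have "z \<noteq> 1"
  proof
    assume "z = 1"
    then have "sin (2 * pi / 5) = 0" by (simp add: z_def complex_eq_iff)
    moreover have "sin (2 * pi / 5) > 0" by (rule sin_gt_zero) auto
    ultimately show False by simp
  qed
  ultimately show ?thesis by auto
qed

context
  fixes z :: complex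
  assumes z: "z ^ 4 + z ^ 3 + z ^ 2 + z + 1 = 0"
begin

lemmas zf = fifth_root_facts[OF z]

lemma fifth_root_factorization: "(1 - y) * (1 - z * y) * (1 - z ^ 2 * y) * (1 - z ^ 3 * y) * (1 - z ^ 4 * y) = 1 - y ^ 5"
  using z by algebra

lemma qpoch_five:
  assumes "norm q < 1"
  shows "qpoch a q * qpoch (z * a) q * qpoch (z ^ 2 * a) q * qpoch (z ^ 3 * a) q * qpoch (z ^ 4 * a) q = qpoch (a ^ 5) (q ^ 5)"
  using qpoch_prod_family[of q 5 "\<lambda>i. z ^ i" a] assms fifth_root_factorization by (simp add: prod_five)

lemma theta_five:
  assumes q: "q \<noteq> 0" "norm q < 1"
  shows "theta z q * theta (z ^ 2) q = (1 - z) * (1 - z ^ 2) * (eulerc (q ^ 5) / eulerc q)"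
proof -
  have th1: "theta z q = (1 - z) * qpoch (z * q) q * qpoch (z ^ 4 * q) q"
    using theta_eq[of q z] q zf by (simp add: divide_inverse mult_ac)
  have th2: "theta (z ^ 2) q = (1 - z ^ 2) * qpoch (z ^ 2 * q) q * qpoch (z ^ 3 * q) q"
    using theta_eq[of q "z ^ 2"] q zf by (simp add: divide_inverse mult_ac)
  have "eulerc q * (qpoch (z * q) q * qpoch (z ^ 2 * q) q * qpoch (z ^ 3 * q) q * qpoch (z ^ 4 * q) q) = eulerc (q ^ 5)"
    using qpoch_five[OF q(2), of q] by (simp add: eulerc_def mult_ac)
  then have "qpoch (z * q) q * qpoch (z ^ 2 * q) q * qpoch (z ^ 3 * q) q * qpoch (z ^ 4 * q) q = eulerc (q ^ 5) / eulerc q"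
    using eulerc_nonzero[OF q] by (intro eq_divide_of_mult)
  then show ?thesis
    unfolding th1 th2 by (simp add: mult_ac)
qed

text \<open>As z^3 is the inverse of z^2, all theta values are at z, z^2 or their inverses, and
  after cancellation only the product of \<open>theta_five\<close> remains. The number z (1 - z) (1
  - z^2) is a quadratic Gauss sum, a square root of 5.\<close>

lemma wp_level5:
  assumes q: "q \<noteq> 0" "norm q < 1"
  shows "wp z q - wp (z ^ 2) q = - (eulerc q ^ 5 / (z * (1 - z) * (1 - z ^ 2) * eulerc (q ^ 5)))"
proof -
  define a b where ab: "a = eulerc q" "b = eulerc (q ^ 5)"
  have enz: "a \<noteq> 0" "b \<noteq> 0" using eulerc_nz[OF q] by (auto simp: ab)
  have prod: "theta z q * theta (z ^ 2) q = (1 - z) * (1 - z ^ 2) * (b / a)"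
    unfolding ab by (rule theta_five[OF q])
  then have nz: "theta z q \<noteq> 0" "theta (z ^ 2) q \<noteq> 0"
    using enz zf by auto
  have inv: "theta (1 / z ^ 2) q = - theta (z ^ 2) q / z ^ 2" "theta (1 / z) q = - theta z q / z"
    using theta_inverse[OF q(2), of "z ^ 2"] theta_inverse[OF q(2), of z] zf(1) by auto
  define t where "t = theta (1 / z ^ 2) q"
  have e: "z * z ^ 2 = 1 / z ^ 2" "z / z ^ 2 = 1 / z"
  proof -
    have "1 / z ^ 2 = z ^ 3" using zf(6) by (simp only: divide_inverse mult_1)
    then show "z * z ^ 2 = 1 / z ^ 2" by (simp add: power3_eq_cube power2_eq_square)
    show "z / z ^ 2 = 1 / z" using zf(1) by (simp add: power2_eq_square)
  qed
  have "theta (z ^ 2) q * theta (1 / z ^ 2) q * theta z q ^ 2 * (wp z q - wp (z ^ 2) q) =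
      a ^ 4 * theta (z * z ^ 2) q * theta (z / z ^ 2) q"
    unfolding wp_def ab eulerc_def using q zf(1) nz by (intro double_pole_sum_difference) auto
  then have *: "theta (z ^ 2) q * t * theta z q ^ 2 * (wp z q - wp (z ^ 2) q) = a ^ 4 * t * (- theta z q / z)"
    unfolding e inv(2) t_def .
  have "(t * theta z q * inverse z) * (z * (theta z q * theta (z ^ 2) q) * (wp z q - wp (z ^ 2) q)) =
      (t * theta z q * inverse z) * - (a ^ 4)" if "z * inverse z = 1"
  proof -
    have "(t * theta z q * inverse z) * (z * (theta z q * theta (z ^ 2) q) * (wp z q - wp (z ^ 2) q)) =
        (z * inverse z) * (theta (z ^ 2) q * t * theta z q ^ 2 * (wp z q - wp (z ^ 2) q))"
      by (simp only: mult_ac power2_eq_square[of "theta z q"])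
    also have "\<dots> = a ^ 4 * t * (- theta z q / z)"
      using that * by simp
    also have "\<dots> = (t * theta z q * inverse z) * - (a ^ 4)"
      by (simp add: divide_inverse mult_ac)
    finally show ?thesis .
  qed
  then have "(t * theta z q * inverse z) * (z * (theta z q * theta (z ^ 2) q) * (wp z q - wp (z ^ 2) q)) =
      (t * theta z q * inverse z) * - (a ^ 4)"
    using zf(1) by simp
  moreover have "t * theta z q * inverse z \<noteq> 0"
  proof -
    have "t \<noteq> 0" unfolding t_def inv(1) using nz zf(1) by simp
    then show ?thesis using nz zf(1) by simp
  qed
  ultimately have "z * (theta z q * theta (z ^ 2) q) * (wp z q - wp (z ^ 2) q) = - (a ^ 4)"
    by (rule mult_left_cancelD)
  moreover have "z * (theta z q * theta (z ^ 2) q) \<noteq> 0" using nz zf by simp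
  ultimately have "wp z q - wp (z ^ 2) q = - (a ^ 4) / (z * (theta z q * theta (z ^ 2) q))"
    by (rule eq_divide_of_mult)
  also have "\<dots> = - (a ^ 5 / (z * (1 - z) * (1 - z ^ 2) * b))"
    unfolding prod using enz by (simp add: field_simps eval_nat_numeral)
  finally show ?thesis unfolding ab .
qed

text \<open>Split by n = 5 k + r. Because z^5 = 1, the root of unity survives only in (-z)^r, and
  T(5 k + r) = T(r) + 25 T(k) + (10 + 5 r) k for T(n) = n (n - 1) / 2 leaves a theta series in the
  nome p^25.\<close>

lemma theta_series_mod_five:
  assumes p: "p \<noteq> 0" "norm p < 1"
  shows "theta_series (- z) p = (\<Sum>r<5. (- z) ^ r * p ^ (r * (r - 1) div 2) * theta_series (- (p ^ (10 + 5 * r))) (p ^ 25))"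
proof -
  define c where "c = (\<lambda>n::int. p powi (n * (n - 1) div 2) * (- z) powi n)"
  define g where "g = (\<lambda>(r::nat, k::int). 5 * k + int r)"
  have p25: "p ^ 25 \<noteq> 0" "norm (p ^ 25) < 1"
    using p norm_pow_lt_1[OF p, of 25] by auto
  have "bij_betw g ({..<5} \<times> UNIV) UNIV"
  proof (rule bij_betw_byWitness[where f' = "\<lambda>n. (nat (n mod 5), n div 5)"])
    show "\<forall>a\<in>{..<5} \<times> UNIV. (nat (g a mod 5), g a div 5) = a"
      by (auto simp: g_def)
    show "\<forall>a'\<in>UNIV. g (nat (a' mod 5), a' div 5) = a'"
      by (auto simp: g_def)
    show "(\<lambda>n. (nat (n mod 5), n div 5)) ` UNIV \<subseteq> {..<5} \<times> UNIV"
      by (auto simp: nat_less_iff)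
  qed auto
  moreover have "(c has_sum theta_series (- z) p) UNIV"
    unfolding c_def using p zf by (intro has_sum_theta_series) auto
  ultimately have S: "((\<lambda>x. c (g x)) has_sum theta_series (- z) p) ({..<5} \<times> UNIV)"
    using has_sum_reindex_bij_betw by blast
  have cg: "c (g (r, k)) = (- z) ^ r * p ^ (r * (r - 1) div 2) * ((p ^ 25) powi (k * (k - 1) div 2) * (- (p ^ (10 + 5 * r))) powi k)"
    for r k
  proof -
    have tri: "int (r * (r - 1) div 2) = int r * (int r - 1) div 2"
      by (cases r) (auto simp: zdiv_int algebra_simps)
    have ex: "(5 * k + int r) * (5 * k + int r - 1) div 2 = int (r * (r - 1) div 2) + 25 * (k * (k - 1) div 2) + int (10 + 5 * r) * k"
    proof -
      define t where "t = (\<lambda>n::int. n * (n - 1) div 2)"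
      have t2: "2 * t n = n * (n - 1)" for n by (simp add: t_def)
      have "2 * (t (int r) + 25 * t k + int (10 + 5 * r) * k) = 2 * t (int r) + 25 * (2 * t k) + 2 * int (10 + 5 * r) * k"
        by simp
      also have "\<dots> = 2 * t (5 * k + int r)"
        unfolding t2 by (simp add: algebra_simps)
      finally have "t (5 * k + int r) = t (int r) + 25 * t k + int (10 + 5 * r) * k" by simp
      then show ?thesis unfolding tri t_def .
    qed
    have z5: "(- z) powi (5 * k) = (- 1) powi k"
    proof -
      have "(- z) powi (5 * k) = ((- z) powi 5) powi k" by (rule power_int_mult)
      also have "(- z) powi 5 = - 1" using zf(2) by simp
      finally show ?thesis .
    qed
    have "(- z) powi (5 * k + int r) = (- 1) powi k * (- z) ^ r"
      using zf(1) by (simp add: power_int_add z5)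
    moreover have "(- (p ^ (10 + 5 * r))) powi k = (- 1) powi k * p powi (int (10 + 5 * r) * k)"
      by (subst power_int_mult, subst power_int_of_nat) (metis mult_minus1 power_int_mult_distrib)
    moreover have "(p ^ 25) powi (k * (k - 1) div 2) = p powi (25 * (k * (k - 1) div 2))"
      by (subst power_int_mult) simp
    ultimately show ?thesis
      using p(1) unfolding c_def g_def prod.case ex by (simp add: power_int_add mult_ac)
  qed
  have "((\<lambda>r. (- z) ^ r * p ^ (r * (r - 1) div 2) * theta_series (- (p ^ (10 + 5 * r))) (p ^ 25)) has_sum theta_series (- z) p) {..<5}"
  proof (rule has_sum_Sigma'[OF S])
    fix r :: nat
    show "((\<lambda>k. c (g (r, k))) has_sum (- z) ^ r * p ^ (r * (r - 1) div 2) * theta_series (- (p ^ (10 + 5 * r))) (p ^ 25)) UNIV"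
      unfolding cg using p p25 by (intro has_sum_cmult_right has_sum_theta_series) auto
  qed
  then show ?thesis
    by (rule has_sum_unique[OF _ has_sum_finite]) simp
qed

text \<open>The part r = 3 vanishes. The parts r = 0, 1 share \<open>theta (p ^ 10) (p ^ 25)\<close>
  by reflection; r = 2, 4 share \<open>theta (p ^ 5) (p ^ 25)\<close> by reflection and
  quasi-periodicity, which turns p^6 into -p.\<close>

lemma theta_five_dissection:
  assumes p: "p \<noteq> 0" "norm p < 1"
  shows "theta z p * eulerc p = ((1 - z) * theta (p ^ 10) (p ^ 25) + (z ^ 2 - z ^ 4) * p * theta (p ^ 5) (p ^ 25)) * eulerc (p ^ 25)"
proof -
  have p25: "p ^ 25 \<noteq> 0" "norm (p ^ 25) < 1"
    using p norm_pow_lt_1[OF p, of 25] by auto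
  have b: "theta_series (- (p ^ k)) (p ^ 25) = theta (p ^ k) (p ^ 25) * eulerc (p ^ 25)" for k
    unfolding eulerc_def using p p25 by (intro jacobi_triple_product) auto
  have t: "theta (p ^ 15) (p ^ 25) = theta (p ^ 10) (p ^ 25)" "theta (p ^ 20) (p ^ 25) = theta (p ^ 5) (p ^ 25)"
    using p by (auto intro!: theta_reflect simp flip: power_add)
  have t0: "theta (p ^ 25) (p ^ 25) = 0"
    using theta_mult_q[OF p25, of 1] p25 by simp
  have t30: "theta (p ^ 30) (p ^ 25) = - theta (p ^ 5) (p ^ 25) / p ^ 5"
    using theta_mult_q[OF p25, of "p ^ 5"] p by (simp flip: power_add)
  have "theta z p * eulerc p = theta_series (- z) p"
    unfolding eulerc_def using p zf(1) by (intro jacobi_triple_product[symmetric])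
  also have "\<dots> = (\<Sum>r<5. (- z) ^ r * p ^ (r * (r - 1) div 2) * theta_series (- (p ^ (10 + 5 * r))) (p ^ 25))"
    by (rule theta_series_mod_five[OF p])
  also have "\<dots> = theta_series (- (p ^ 10)) (p ^ 25) + (- z) * theta_series (- (p ^ 15)) (p ^ 25) + z ^ 2 * p * theta_series (- (p ^ 20)) (p ^ 25)
      + (- z) ^ 3 * p ^ 3 * theta_series (- (p ^ 25)) (p ^ 25) + z ^ 4 * p ^ 6 * theta_series (- (p ^ 30)) (p ^ 25)"
    by (simp add: sum_five)
  also have "\<dots> = ((1 - z) * theta (p ^ 10) (p ^ 25) + (z ^ 2 - z ^ 4) * p * theta (p ^ 5) (p ^ 25)) * eulerc (p ^ 25)"
  proof -
    have "p ^ 6 = p * p ^ 5" by (simp flip: power_Suc)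
    then have "z ^ 4 * p ^ 6 * (- theta (p ^ 5) (p ^ 25) / p ^ 5 * eulerc (p ^ 25)) = - (z ^ 4 * p * theta (p ^ 5) (p ^ 25) * eulerc (p ^ 25))"
      using p(1) by simp
    then show ?thesis
      unfolding b t t0 t30 by (simp add: algebra_simps)
  qed
  finally show ?thesis .
qed

end

text \<open>Two conjugate choices of the fifth root of unity are multiplied in order to get rid of it.\<close>

lemma rr_dissection:
  assumes p: "p \<noteq> 0" "norm p < 1"
  defines "T \<equiv> theta (p ^ 5) (p ^ 25) / theta (p ^ 10) (p ^ 25)"
  shows "T \<noteq> 0" "eulerc p / eulerc (p ^ 25) = 1 / T - p - p ^ 2 * T"
proof -
  obtain z :: complex where z: "z ^ 4 + z ^ 3 + z ^ 2 + z + 1 = 0"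
    using exists_fifth_root by blast
  note zf = fifth_root_facts[OF z]
  have p25: "p ^ 25 \<noteq> 0" "norm (p ^ 25) < 1" and p5: "p ^ 5 \<noteq> 0" "norm (p ^ 5) < 1"
    using p norm_pow_lt_1[OF p, of 25] norm_pow_lt_1[OF p, of 5] by auto
  define A B where AB: "A = theta (p ^ 10) (p ^ 25)" "B = theta (p ^ 5) (p ^ 25)"
  define a b c where abc: "a = eulerc p" "b = eulerc (p ^ 5)" "c = eulerc (p ^ 25)"
  have enz: "a \<noteq> 0" "b \<noteq> 0" "c \<noteq> 0"
    unfolding abc using eulerc_nonzero[OF p] eulerc_pow_nonzero[OF p] by auto
  have d1: "theta z p * a = ((1 - z) * A + (z ^ 2 - z ^ 4) * p * B) * c"
    unfolding AB abc by (rule theta_five_dissection[OF z p])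
  \<comment> \<open>The conjugate equation, with z^2 for z; \<open>A\<close>, \<open>B\<close>,
    \<open>a\<close> and \<open>c\<close> are the same in both.\<close>
  have d2: "theta (z ^ 2) p * a = ((1 - z ^ 2) * A + (z ^ 4 - z ^ 3) * p * B) * c"
  proof -
    have "(z ^ 2) ^ 2 - (z ^ 2) ^ 4 = z ^ 4 - z ^ 3"
      using z by algebra
    then show ?thesis
      using theta_five_dissection[OF zf(7) p] unfolding AB abc by simp
  qed
  have th: "theta z p * theta (z ^ 2) p = (1 - z) * (1 - z ^ 2) * (b / a)"
    unfolding abc by (rule theta_five[OF z p])
  have "(1 - z) * (1 - z ^ 2) * (b * a) = (1 - z) * (1 - z ^ 2) * (b / a) * (a * a)"
    using enz by simp
  also have "\<dots> = (theta z p * a) * (theta (z ^ 2) p * a)"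
    unfolding th[symmetric] by (simp only: mult_ac)
  also have "\<dots> = (1 - z) * (1 - z ^ 2) * ((A ^ 2 - A * B * p - p ^ 2 * B ^ 2) * c ^ 2)"
  proof -
    \<comment> \<open>The numbers t and -1 - t are the roots of X^2 + X - 1, so the product of the
      two linear forms in A and p B has rational coefficients.\<close>
    define t where "t = z + z ^ 4"
    have e: "z ^ 2 - z ^ 4 = (1 - z) * (- 1 - t)" "z ^ 4 - z ^ 3 = (1 - z ^ 2) * t"
      unfolding t_def using z by algebra+
    have t: "t * (- 1 - t) = - 1" unfolding t_def using z by algebra
    show ?thesis unfolding d1 d2 e using t by algebra
  qed
  finally have ba: "b * a = (A ^ 2 - A * B * p - p ^ 2 * B ^ 2) * c ^ 2"
    by (rule mult_left_cancelD) (use zf(3,4) in simp)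
  \<comment> \<open>Together \<open>A\<close> and \<open>B\<close> contain the four nonzero residue
    classes modulo 5, that is, E(p^5) without the factors of E(p^25).\<close>
  have AB': "A * B = b / c"
  proof -
    have "A * B = qpoch (p ^ 5) (p ^ 25) * qpoch (p ^ 10) (p ^ 25) * qpoch (p ^ 15) (p ^ 25) * qpoch (p ^ 20) (p ^ 25)"
    proof -
      have "p ^ 25 / p ^ 10 = p ^ 15" "p ^ 25 / p ^ 5 = p ^ 20"
        using p by (simp_all add: field_simps flip: power_add)
      then show ?thesis unfolding AB theta_def by (simp add: mult_ac)
    qed
    moreover have "b = qpoch (p ^ 5) (p ^ 25) * qpoch (p ^ 10) (p ^ 25) * qpoch (p ^ 15) (p ^ 25) * qpoch (p ^ 20) (p ^ 25) * c"
      unfolding abc eulerc_def using qpoch_split[OF p5(2), of 5 "p ^ 5"]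
      by (simp add: prod_five flip: power_mult power_add)
    ultimately show ?thesis using enz by simp
  qed
  then have nz: "A \<noteq> 0" "B \<noteq> 0" using enz by auto
  then show "T \<noteq> 0" unfolding T_def AB by simp
  have T: "T = B / A" unfolding T_def AB ..
  have "b = A * B * c" using AB' enz by (simp add: field_simps)
  then have "c * (A * B * a) = b * a" by (simp only: mult_ac)
  also have "\<dots> = c * ((A ^ 2 - A * B * p - p ^ 2 * B ^ 2) * c)"
    unfolding ba by (simp only: power2_eq_square[of c] mult_ac)
  finally have "A * B * a = (A ^ 2 - A * B * p - p ^ 2 * B ^ 2) * c"
    by (rule mult_left_cancelD) (rule enz)
  then have "a / c = (A ^ 2 - A * B * p - p ^ 2 * B ^ 2) / (A * B)"
    using enz nz by (simp add: field_simps)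
  also have "\<dots> = 1 / T - p - p ^ 2 * T"
    unfolding T using nz by (simp add: field_simps power2_eq_square)
  finally show "eulerc p / eulerc (p ^ 25) = 1 / T - p - p ^ 2 * T" unfolding abc .
qed

text \<open>Apply \<open>rr_dissection\<close> to z^k p and multiply over k: T depends on p^5 only
  and stays fixed.\<close>

lemma rr_fifth_power_identity:
  assumes p: "p \<noteq> 0" "norm p < 1"
  defines "T \<equiv> theta (p ^ 5) (p ^ 25) / theta (p ^ 10) (p ^ 25)"
  shows "eulerc (p ^ 5) ^ 6 / eulerc (p ^ 25) ^ 6 = 1 / T ^ 5 - 11 * p ^ 5 - p ^ 10 * T ^ 5"
proof -
  obtain z :: complex where z: "z ^ 4 + z ^ 3 + z ^ 2 + z + 1 = 0"
    using exists_fifth_root by blast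
  note zf = fifth_root_facts[OF z]
  have nz1: "norm z = 1"
    using zf(2) by (metis norm_one norm_power power_eq_1_iff zero_neq_numeral norm_ge_zero)
  have p5: "p ^ 5 \<noteq> 0" "norm (p ^ 5) < 1"
    using p norm_pow_lt_1[OF p, of 5] by auto
  have T0: "T \<noteq> 0" unfolding T_def by (rule rr_dissection(1)[OF p])
  define u where "u = 1 / T"
  have uT: "u * T = 1" using T0 by (simp add: u_def)
  have zk: "(z ^ k * p) ^ 5 = p ^ 5" "(z ^ k * p) ^ 10 = p ^ 10" "(z ^ k * p) ^ 25 = p ^ 25" for k
  proof -
    have *: "(z ^ k * p) ^ (5 * j) = p ^ (5 * j)" for j
      using zf(2) by (metis mult.commute mult_1 power_mult power_mult_distrib power_one)
    show "(z ^ k * p) ^ 5 = p ^ 5" "(z ^ k * p) ^ 10 = p ^ 10" "(z ^ k * p) ^ 25 = p ^ 25"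
      using *[of 1] *[of 2] *[of 5] by simp_all
  qed
  have fac: "eulerc (z ^ k * p) / eulerc (p ^ 25) = u - z ^ k * p - (z ^ k * p) ^ 2 * T" for k
  proof -
    have "z ^ k * p \<noteq> 0" "norm (z ^ k * p) < 1"
      using p zf nz1 by (auto simp: norm_mult norm_power)
    from rr_dissection(2)[OF this] show ?thesis unfolding zk T_def u_def .
  qed
  have "(\<Prod>k<5. eulerc (z ^ k * p)) = eulerc (p ^ 5) ^ 6 / eulerc (p ^ 25)"
  proof -
    have e: "eulerc (z ^ k * p) = (\<Prod>i<5. qpoch ((z ^ k * p) ^ Suc i) (p ^ 5))" for k
    proof -
      have "norm (z ^ k * p) < 1" using p nz1 by (simp add: norm_mult norm_power)
      from qpoch_split[OF this, of 5 "z ^ k * p"] show ?thesis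
        unfolding eulerc_def zk(1) by simp
    qed
    \<comment> \<open>For n prime to 5 the powers z^(k n) run through all fifth roots of unity. For
      n = 5 they are all 1, so that class contributes a fifth power instead.\<close>
    have i: "(\<Prod>k<5. qpoch ((z ^ k * p) ^ n) (p ^ 5)) = qpoch ((p ^ n) ^ 5) (p ^ 25)"
      if "(z ^ n) ^ 4 + (z ^ n) ^ 3 + (z ^ n) ^ 2 + z ^ n + 1 = 0" for n
    proof -
      have "(z ^ k * p) ^ n = (z ^ n) ^ k * p ^ n" for k
        by (simp add: power_mult_distrib mult.commute flip: power_mult)
      moreover have "(\<Prod>k<5. qpoch ((z ^ n) ^ k * p ^ n) (p ^ 5)) = qpoch ((p ^ n) ^ 5) ((p ^ 5) ^ 5)"
        using qpoch_five[OF that p5(2), of "p ^ n"] by (simp only: prod_five power_0 power_one_right mult_1)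
      moreover have "(p ^ 5) ^ 5 = p ^ 25" by (simp flip: power_mult)
      ultimately show ?thesis by (simp only:)
    qed
    have roots: "(z ^ 1) ^ 4 + (z ^ 1) ^ 3 + (z ^ 1) ^ 2 + z ^ 1 + 1 = 0"
      "(z ^ 2) ^ 4 + (z ^ 2) ^ 3 + (z ^ 2) ^ 2 + z ^ 2 + 1 = 0"
      "(z ^ 3) ^ 4 + (z ^ 3) ^ 3 + (z ^ 3) ^ 2 + z ^ 3 + 1 = 0"
      "(z ^ 4) ^ 4 + (z ^ 4) ^ 3 + (z ^ 4) ^ 2 + z ^ 4 + 1 = 0" using z by algebra+
    note i1 = i[OF roots(1)] and i2 = i[OF roots(2)] and i3 = i[OF roots(3)] and i4 = i[OF roots(4)]
    have "(\<Prod>k<5. eulerc (z ^ k * p)) = (\<Prod>i<5. \<Prod>k<5. qpoch ((z ^ k * p) ^ Suc i) (p ^ 5))"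
      unfolding e by (rule prod.swap)
    also have "\<dots> = (\<Prod>k<5. qpoch ((z ^ k * p) ^ 1) (p ^ 5)) * (\<Prod>k<5. qpoch ((z ^ k * p) ^ 2) (p ^ 5)) *
        (\<Prod>k<5. qpoch ((z ^ k * p) ^ 3) (p ^ 5)) * (\<Prod>k<5. qpoch ((z ^ k * p) ^ 4) (p ^ 5)) * (\<Prod>k<5. qpoch ((z ^ k * p) ^ 5) (p ^ 5))"
      by (subst prod_five) (simp only: Suc_numeral One_nat_def[symmetric] Suc_1 semiring_norm)
    also have "\<dots> = (qpoch ((p ^ 1) ^ 5) (p ^ 25) * qpoch ((p ^ 2) ^ 5) (p ^ 25) * qpoch ((p ^ 3) ^ 5) (p ^ 25) *
        qpoch ((p ^ 4) ^ 5) (p ^ 25)) * eulerc (p ^ 5) ^ 5"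
      unfolding i1 i2 i3 i4 zk(1) eulerc_def by simp
    also have "qpoch ((p ^ 1) ^ 5) (p ^ 25) * qpoch ((p ^ 2) ^ 5) (p ^ 25) * qpoch ((p ^ 3) ^ 5) (p ^ 25) *
        qpoch ((p ^ 4) ^ 5) (p ^ 25) = eulerc (p ^ 5) / eulerc (p ^ 25)"
    proof -
      have "eulerc (p ^ 5) = qpoch ((p ^ 1) ^ 5) (p ^ 25) * qpoch ((p ^ 2) ^ 5) (p ^ 25) * qpoch ((p ^ 3) ^ 5) (p ^ 25) *
        qpoch ((p ^ 4) ^ 5) (p ^ 25) * eulerc (p ^ 25)"
        unfolding eulerc_def using qpoch_split[OF p5(2), of 5 "p ^ 5"]
        by (simp add: prod_five flip: power_mult power_add)
      then show ?thesis using eulerc_pow_nonzero[OF p, of 25] by simp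
    qed
    finally show ?thesis by (simp add: eval_nat_numeral)
  qed
  then have "eulerc (p ^ 5) ^ 6 / eulerc (p ^ 25) ^ 6 = (\<Prod>k<5. eulerc (z ^ k * p) / eulerc (p ^ 25))"
    by (simp add: prod_dividef eval_nat_numeral)
  also have "\<dots> = u ^ 5 - 11 * p ^ 5 - p ^ 10 * T ^ 5"
  proof -
    \<comment> \<open>Conjugate factors are paired, so that only \<open>s\<close>, a root of X^2 + X
      - 1, is left; it drops out of the last product and leaves the constant 11.\<close>
    define s where "s = z + z ^ 4"
    have s: "s ^ 2 + s = 1" unfolding s_def using z by algebra
    have s': "z ^ 2 + z ^ 3 = - 1 - s" unfolding s_def using z by algebra
    have z5: "z ^ 5 = 1" by (rule zf(2))
    have m1: "(u - z * p - (z * p) ^ 2 * T) * (u - z ^ 4 * p - (z ^ 4 * p) ^ 2 * T) =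
        u ^ 2 - s * u * p + (2 + s) * p ^ 2 + s * p ^ 3 * T + p ^ 4 * T ^ 2"
      unfolding s_def using uT z by algebra
    have m2: "(u - z ^ 2 * p - (z ^ 2 * p) ^ 2 * T) * (u - z ^ 3 * p - (z ^ 3 * p) ^ 2 * T) =
        u ^ 2 + (1 + s) * u * p + (1 - s) * p ^ 2 - (1 + s) * p ^ 3 * T + p ^ 4 * T ^ 2"
      unfolding s_def using uT z by algebra
    have "(\<Prod>k<5. eulerc (z ^ k * p) / eulerc (p ^ 25)) = (u - p - p ^ 2 * T) *
       ((u - z * p - (z * p) ^ 2 * T) * (u - z ^ 4 * p - (z ^ 4 * p) ^ 2 * T)) *
       ((u - z ^ 2 * p - (z ^ 2 * p) ^ 2 * T) * (u - z ^ 3 * p - (z ^ 3 * p) ^ 2 * T))"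
      unfolding fac prod_five by (simp add: mult_ac)
    also have "\<dots> = u ^ 5 - 11 * p ^ 5 - p ^ 10 * T ^ 5"
      unfolding m1 m2 using s uT by algebra
    finally show ?thesis .
  qed
  finally show ?thesis by (simp add: u_def power_divide)
qed

section \<open>Logarithmic derivatives of Euler products\<close>

text \<open>The q-Pochhammer symbol (q^b; q^k) for real q: Euler's product for k = b = 1, the
  constituents of \<open>rr_frac\<close> for k = 5.\<close>

definition progression_prod :: "nat \<Rightarrow> nat \<Rightarrow> real \<Rightarrow> real" where
  "progression_prod k b q = (\<Prod>j. 1 - q ^ (k * j + b))"

text \<open>Minus the logarithmic derivative of \<open>progression_prod k b\<close>.\<close>

definition progression_dlog :: "nat \<Rightarrow> nat \<Rightarrow> real \<Rightarrow> real" where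
  "progression_dlog k b q = (\<Sum>j. real (k * j + b) * q ^ (k * j + b - 1) / (1 - q ^ (k * j + b)))"

lemma euler_E_progression: "euler_E q = progression_prod 1 1 q"
  by (simp add: euler_E_def progression_prod_def)

lemma summable_arith_power:
  fixes r :: real
  assumes "0 \<le> r" "r < 1" "k > 0" "b > 0"
  shows "summable (\<lambda>j. real (k * j + b) * r ^ (k * j + b - 1))"
proof -
  have "summable (\<lambda>n. of_nat (Suc n) * r ^ n)"
    using geometric_deriv_sums[of r] assms by (auto simp: sums_iff)
  then have "summable ((\<lambda>n. real (Suc n) * r ^ n) \<circ> (\<lambda>j. k * j + b - 1))"
  proof (rule summable_reindex)
    show "inj (\<lambda>j. k * j + b - 1)"
    proof (rule injI)
      fix x y assume "k * x + b - 1 = k * y + b - 1"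
      then have "k * x = k * y" using assms(4) by linarith
      then show "x = y" using assms(3) by simp
    qed
  qed (use assms in auto)
  also have "((\<lambda>n. real (Suc n) * r ^ n) \<circ> (\<lambda>j. k * j + b - 1)) = (\<lambda>j. real (k * j + b) * r ^ (k * j + b - 1))"
  proof -
    have "Suc (k * j + b - 1) = k * j + b" for j using assms by simp
    then show ?thesis by (simp only: o_def)
  qed
  finally show ?thesis .
qed

lemma power_abs_less_one:
  fixes x :: real
  assumes "\<bar>x\<bar> < 1" "n > 0"
  shows "x ^ n < 1"
proof -
  have "x ^ n \<le> \<bar>x\<bar> ^ n" by (metis abs_ge_self power_abs)
  also have "\<dots> < 1" using assms by (simp add: power_less_one_iff)
  finally show ?thesis .
qed

text \<open>The product is the exponential of a series of logarithms, differentiated term by term on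
  an interval of radius r with |q| < r < 1. A neighbourhood of 0 is covered on purpose: the
  integrals start there and continuity at 0 must be known.\<close>

lemma progression_prod_facts:
  fixes q :: real
  assumes q: "\<bar>q\<bar> < 1" and kb: "k > 0" "b > 0"
  shows "(\<lambda>j. 1 - q ^ (k * j + b)) has_prod progression_prod k b q" "progression_prod k b q > 0"
    "(progression_prod k b has_real_derivative (- progression_prod k b q * progression_dlog k b q)) (at q)"
    "(\<lambda>j. real (k * j + b) * q ^ (k * j + b - 1) / (1 - q ^ (k * j + b))) sums progression_dlog k b q"
proof -
  define r where "r = (\<bar>q\<bar> + 1) / 2"
  have r: "\<bar>q\<bar> < r" "r < 1" "0 \<le> r" using q by (auto simp: r_def)
  define S where "S = {-r<..<r}"
  define f where "f = (\<lambda>j x. ln (1 - x ^ (k * j + b) :: real))"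
  define f' where "f' = (\<lambda>j x. - (real (k * j + b) * x ^ (k * j + b - 1) / (1 - x ^ (k * j + b) :: real)))"
  have lt1: "x ^ (k * j + b) < 1" if "\<bar>x\<bar> < 1" for x :: real and j
    using that kb by (intro power_abs_less_one) auto
  have xS: "\<bar>x\<bar> < 1" if "x \<in> S" for x using that r by (auto simp: S_def)
  have der: "(f j has_field_derivative f' j x) (at x within S)" if "x \<in> S" for j x
    unfolding f_def f'_def using lt1[OF xS[OF that], of j]
    by (auto intro!: derivative_eq_intros)
  have unif: "uniformly_convergent_on S (\<lambda>n x. \<Sum>i<n. f' i x)"
  proof (rule Weierstrass_m_test')
    show "summable (\<lambda>j. real (k * j + b) * r ^ (k * j + b - 1) / (1 - r))"
      using r kb by (intro summable_divide summable_arith_power) auto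
    fix j x assume x: "x \<in> S"
    then have xr: "\<bar>x\<bar> \<le> r" by (auto simp: S_def)
    have "x ^ (k * j + b) \<le> \<bar>x\<bar> ^ (k * j + b)" by (metis abs_ge_self power_abs)
    also have "\<dots> \<le> r ^ (k * j + b)" using xr by (intro power_mono) auto
    also have "\<dots> \<le> r ^ 1" using r kb by (intro power_decreasing) auto
    finally have "1 - r \<le> 1 - x ^ (k * j + b)" by simp
    moreover have "\<bar>x ^ (k * j + b - 1)\<bar> \<le> r ^ (k * j + b - 1)"
      unfolding power_abs using xr by (intro power_mono) auto
    ultimately have "real (k * j + b) * \<bar>x ^ (k * j + b - 1)\<bar> / (1 - x ^ (k * j + b)) \<le>
        real (k * j + b) * r ^ (k * j + b - 1) / (1 - r)"
      using r by (intro frac_le mult_left_mono mult_nonneg_nonneg) auto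
    moreover have "norm (f' j x) = real (k * j + b) * \<bar>x ^ (k * j + b - 1)\<bar> / (1 - x ^ (k * j + b))"
      unfolding f'_def using lt1[OF xS[OF x], of j] by (simp add: abs_mult)
    ultimately show "norm (f' j x) \<le> real (k * j + b) * r ^ (k * j + b - 1) / (1 - r)"
      by simp
  qed
  have ev: "convex S" "(0::real) \<in> S" "open S" using r q by (auto simp: S_def)
  have s0: "summable (\<lambda>n. f n 0)" using kb by (simp add: f_def power_0_left)
  have iS: "x \<in> interior S" if "x \<in> S" for x using ev that by (simp add: interior_open)
  have D: "summable (\<lambda>n. f n x)" "((\<lambda>x. \<Sum>n. f n x) has_field_derivative (\<Sum>n. f' n x)) (at x)" if "x \<in> S" for x
    using has_field_derivative_series'[where S = S and f = f and f' = f' and ?x0.0 = 0 and x = x] ev der unif s0 iS[OF that]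
    by auto
  have hp: "(\<lambda>j. 1 - x ^ (k * j + b)) has_prod exp (\<Sum>n. f n x)" if "x \<in> S" for x
  proof -
    have "(\<lambda>n. f n x) sums (\<Sum>n. f n x)" using D(1)[OF that] by (rule summable_sums)
    then have "raw_has_prod (\<lambda>i. exp (f i x)) 0 (exp (\<Sum>n. f n x))" by (rule sums_imp_has_prod_exp)
    then have "(\<lambda>i. exp (f i x)) has_prod exp (\<Sum>n. f n x)" by (auto simp: has_prod_def)
    moreover have "exp (f i x) = 1 - x ^ (k * i + b)" for i
      using lt1[OF xS[OF that], of i] by (simp add: f_def)
    ultimately show ?thesis by simp
  qed
  have gpe: "progression_prod k b x = exp (\<Sum>n. f n x)" if "x \<in> S" for x
    unfolding progression_prod_def using hp[OF that] by (rule has_prod_unique[symmetric])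
  have qS: "q \<in> S" using r by (auto simp: S_def)
  show "(\<lambda>j. 1 - q ^ (k * j + b)) has_prod progression_prod k b q" using hp[OF qS] gpe[OF qS] by simp
  show "progression_prod k b q > 0" using gpe[OF qS] by simp
  have sf: "summable (\<lambda>n. f' n q)"
    using uniformly_convergent_imp_convergent[OF unif qS] by (simp add: summable_iff_convergent)
  have "summable (\<lambda>n. - f' n q)" using sf by (rule summable_minus)
  then show "(\<lambda>j. real (k * j + b) * q ^ (k * j + b - 1) / (1 - q ^ (k * j + b))) sums progression_dlog k b q"
    unfolding progression_dlog_def by (subst summable_sums_iff[symmetric]) (simp add: f'_def)
  have "((\<lambda>x. exp (\<Sum>n. f n x)) has_real_derivative (exp (\<Sum>n. f n q) * (\<Sum>n. f' n q))) (at q)"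
    by (rule DERIV_fun_exp[OF D(2)[OF qS]])
  moreover have "(\<Sum>n. f' n q) = - progression_dlog k b q"
  proof -
    from sf have "(\<Sum>n. - f' n q) = - (\<Sum>n. f' n q)" by (rule suminf_minus)
    then show ?thesis unfolding progression_dlog_def by (simp add: f'_def)
  qed
  ultimately have "((\<lambda>x. exp (\<Sum>n. f n x)) has_real_derivative (- progression_prod k b q * progression_dlog k b q)) (at q)"
    by (simp add: gpe[OF qS])
  then show "(progression_prod k b has_real_derivative (- progression_prod k b q * progression_dlog k b q)) (at q)"
    by (rule has_field_derivative_transform_within_open[OF _ ev(3) qS]) (simp add: gpe)
qed

lemma of_real_progression_prod:
  assumes "\<bar>q\<bar> < 1" "k > 0" "b > 0"
  shows "complex_of_real (progression_prod k b q) = qpoch (of_real q ^ b) (of_real q ^ k)"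
proof -
  have "(\<lambda>j. complex_of_real (1 - q ^ (k * j + b))) has_prod of_real (progression_prod k b q)"
    unfolding has_prod_of_real_iff by (rule progression_prod_facts(1)[OF assms])
  then have "of_real (progression_prod k b q) = (\<Prod>j. complex_of_real (1 - q ^ (k * j + b)))"
    by (rule has_prod_unique)
  also have "\<dots> = qpoch (of_real q ^ b) (of_real q ^ k)"
    unfolding qpoch_def by (simp add: power_add mult.commute flip: power_mult)
  finally show ?thesis .
qed

lemma of_real_euler_E:
  assumes "\<bar>q\<bar> < 1"
  shows "complex_of_real (euler_E q) = eulerc (of_real q)"
  unfolding euler_E_progression eulerc_def using of_real_progression_prod[OF assms, of 1 1] by simp

lemma euler_E_pos: "\<bar>q\<bar> < 1 \<Longrightarrow> euler_E q > 0"
  unfolding euler_E_progression by (rule progression_prod_facts(2)) auto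

lemma of_real_euler_E_pow:
  assumes "\<bar>q\<bar> < 1" "k > 0"
  shows "eulerc (of_real q ^ k) = complex_of_real (euler_E (q ^ k))"
  using of_real_euler_E[of "q ^ k"] assms by (simp add: power_abs power_less_one_iff)

text \<open>The generating series of the divisor sums sigma(n); 1 - 24 \<open>sigma_series q\<close>
  is the Eisenstein series of weight two.\<close>

definition sigma_series :: "real \<Rightarrow> real" where
  "sigma_series q = (\<Sum>m. real (Suc m) * q ^ Suc m / (1 - q ^ Suc m))"

lemma sigma_series_sums:
  assumes "\<bar>q\<bar> < 1"
  shows "(\<lambda>m. real (Suc m) * q ^ Suc m / (1 - q ^ Suc m)) sums sigma_series q"
    "double_pole_sum (of_real q) (of_real q) = of_real (sigma_series q)"
proof -
  have 1: "(\<lambda>m. complex_of_real (real (Suc m) * q ^ Suc m / (1 - q ^ Suc m))) sums double_pole_sum (of_real q) (of_real q)"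
    using double_pole_sum_Lambert(1)[of "of_real q" "of_real q"] assms by simp
  then have "summable (\<lambda>m. complex_of_real (real (Suc m) * q ^ Suc m / (1 - q ^ Suc m)))"
    by (rule sums_summable)
  then have "summable (\<lambda>m. real (Suc m) * q ^ Suc m / (1 - q ^ Suc m))"
    by (simp only: summable_of_real_iff)
  then show 2: "(\<lambda>m. real (Suc m) * q ^ Suc m / (1 - q ^ Suc m)) sums sigma_series q"
    unfolding sigma_series_def by (rule summable_sums)
  then have "(\<lambda>m. complex_of_real (real (Suc m) * q ^ Suc m / (1 - q ^ Suc m))) sums of_real (sigma_series q)"
    by (rule sums_of_real)
  with 1 show "double_pole_sum (of_real q) (of_real q) = of_real (sigma_series q)"
    by (rule sums_unique2)
qed

lemma euler_E_deriv:
  assumes "\<bar>q\<bar> < 1" "q \<noteq> 0"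
  shows "(euler_E has_real_derivative (- euler_E q * sigma_series q / q)) (at q)"
proof -
  have "progression_dlog 1 1 q = sigma_series q / q"
  proof -
    have "(\<lambda>m. real (Suc m) * q ^ Suc m / (1 - q ^ Suc m) / q) sums (sigma_series q / q)"
      by (intro sums_divide sigma_series_sums assms)
    then have "(\<lambda>j. real (1 * j + 1) * q ^ (1 * j + 1 - 1) / (1 - q ^ (1 * j + 1))) sums (sigma_series q / q)"
      using assms(2) by simp
    then show ?thesis unfolding progression_dlog_def by (rule sums_unique[symmetric])
  qed
  then show ?thesis
    using progression_prod_facts(3)[OF assms(1), of 1 1] unfolding euler_E_progression[abs_def] by simp
qed

lemma euler_E_pow_deriv:
  assumes "0 < q" "q < 1" "k > 0"
  shows "((\<lambda>q. euler_E (q ^ k)) has_real_derivative (- euler_E (q ^ k) * (real k * sigma_series (q ^ k) / q))) (at q)"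
proof -
  have "\<bar>q ^ k\<bar> < 1" using assms by (simp add: power_less_one_iff)
  then have "(euler_E has_real_derivative (- euler_E (q ^ k) * sigma_series (q ^ k) / q ^ k)) (at (q ^ k))"
    using assms by (intro euler_E_deriv) auto
  then have "((\<lambda>q. euler_E (q ^ k)) has_real_derivative (- euler_E (q ^ k) * sigma_series (q ^ k) / q ^ k * (real k * q ^ (k - 1)))) (at q)"
    by (rule DERIV_chain2) (auto intro!: derivative_eq_intros)
  also have "- euler_E (q ^ k) * sigma_series (q ^ k) / q ^ k * (real k * q ^ (k - 1)) = - euler_E (q ^ k) * (real k * sigma_series (q ^ k) / q)"
  proof -
    have "q ^ k = q * q ^ (k - 1)" using assms by (simp flip: power_Suc)
    then have "q ^ (k - 1) / q ^ k = 1 / q" using assms by simp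
    then show ?thesis by (metis (no_types, opaque_lifting) mult.assoc mult.commute mult.right_neutral times_divide_eq_left times_divide_eq_right)
  qed
  finally show ?thesis .
qed

lemma euler_E_pow_cont: "k > 0 \<Longrightarrow> 0 \<le> q \<Longrightarrow> q < 1 \<Longrightarrow> isCont (\<lambda>q. euler_E (q ^ k)) q"
proof -
  assume k: "k > 0" "0 \<le> q" "q < 1"
  have "\<bar>q ^ k\<bar> < 1" using k by (simp add: power_less_one_iff)
  then have "isCont (progression_prod 1 1) (q ^ k)"
    by (intro DERIV_isCont[OF progression_prod_facts(3)]) auto
  then show ?thesis unfolding euler_E_progression by (intro isCont_o2[where g = "progression_prod 1 1" and f = "\<lambda>q. q ^ k"] continuous_intros)
qed

section \<open>Weierstrass values at torsion points as Lambert series\<close>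

lemma double_pole_sum_multiples:
  assumes "norm q < 1" "k > 0"
  shows "(\<lambda>m. if k dvd Suc m then of_nat (Suc m) * q ^ Suc m / (1 - q ^ Suc m) else 0) sums (of_nat k * double_pole_sum (q ^ k) (q ^ k))"
proof -
  let ?f = "\<lambda>m. if k dvd Suc m then of_nat (Suc m) * q ^ Suc m / (1 - q ^ Suc m) else 0"
  define g where "g = (\<lambda>m. k * Suc m - 1)"
  have Sg: "Suc (g m) = k * Suc m" for m using assms by (simp add: g_def)
  have "strict_mono g"
    unfolding strict_mono_def
  proof (intro allI impI)
    fix x y :: nat assume "x < y"
    then have "Suc (g x) < Suc (g y)" unfolding Sg using assms by (intro mult_strict_left_mono) auto
    then show "g x < g y" by simp
  qed
  moreover have "?f n = 0" if "n \<notin> range g" for n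
  proof -
    have "\<not> k dvd Suc n"
    proof
      assume "k dvd Suc n"
      then obtain j where j: "Suc n = k * j" by blast
      then have "j \<noteq> 0" by (metis mult_0_right nat.distinct(1))
      then obtain i where "j = Suc i" using not0_implies_Suc by blast
      then have "n = g i" using j Sg[of i] by simp
      then show False using that by blast
    qed
    then show ?thesis by simp
  qed
  ultimately have "(\<lambda>n. ?f (g n)) sums (of_nat k * double_pole_sum (q ^ k) (q ^ k)) \<longleftrightarrow> ?f sums (of_nat k * double_pole_sum (q ^ k) (q ^ k))"
    by (intro sums_mono_reindex) auto
  moreover have "(\<lambda>n. ?f (g n)) sums (of_nat k * double_pole_sum (q ^ k) (q ^ k))"
  proof -
    have "norm (q ^ k) < 1" using assms by (simp add: norm_power power_less_one_iff)
    from sums_mult[OF double_pole_sum_Lambert(1)[OF this this], of "of_nat k"]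
    show ?thesis unfolding Sg by (simp add: power_mult mult_ac del: mult_Suc_right power_Suc of_nat_Suc)
  qed
  ultimately show ?thesis by simp
qed

text \<open>On the unit circle \<open>x\<close> is outside the range of the Lambert expansion.
  Splitting off the term y = x leaves the arguments x q and q / x, both of norm less than
  one.\<close>

lemma wp_unit_sums:
  assumes "norm q < 1" "norm x = 1"
  shows "(\<lambda>m. (x ^ Suc m + inverse x ^ Suc m) * (of_nat (Suc m) * q ^ Suc m / (1 - q ^ Suc m))) sums (wp x q - x / (1 - x) ^ 2)"
proof -
  have n: "norm (x * q) < 1" "norm (q / x) < 1" using assms by (auto simp: norm_mult norm_divide)
  have "(\<lambda>m. of_nat (Suc m) * (x * q) ^ Suc m / (1 - q ^ Suc m) + of_nat (Suc m) * (q / x) ^ Suc m / (1 - q ^ Suc m)) sums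
     (double_pole_sum (x * q) q + double_pole_sum (q / x) q)"
    by (intro sums_add double_pole_sum_Lambert(1) n assms)
  also have "double_pole_sum (x * q) q + double_pole_sum (q / x) q = wp x q - x / (1 - x) ^ 2"
    unfolding wp_def using double_pole_sum_Suc[OF assms(1), of x] by simp
  also have "(\<lambda>m. of_nat (Suc m) * (x * q) ^ Suc m / (1 - q ^ Suc m) + of_nat (Suc m) * (q / x) ^ Suc m / (1 - q ^ Suc m)) =
     (\<lambda>m. (x ^ Suc m + inverse x ^ Suc m) * (of_nat (Suc m) * q ^ Suc m / (1 - q ^ Suc m)))"
    unfolding divide_inverse power_mult_distrib by (rule ext) (simp only: algebra_simps)
  finally show ?thesis .
qed

lemma power_periodic:
  fixes x :: complex
  assumes "x ^ k = 1"
  shows "x ^ n = x ^ (n mod k)"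
proof -
  have "x ^ n = x ^ (k * (n div k) + n mod k)" by simp
  also have "\<dots> = x ^ (n mod k)" using assms by (simp only: power_add power_mult power_one mult_1)
  finally show ?thesis .
qed

context
  fixes q w :: complex
  assumes q: "q \<noteq> 0" "norm q < 1" and w: "w ^ 2 + w + 1 = 0"
begin

lemma norm_w: "norm w = 1"
  using cube_root_facts(3)[OF w] by (metis norm_one norm_power power_eq_1_iff zero_neq_numeral norm_ge_zero)

text \<open>w^n + w^(-n) is the Ramanujan sum c_3(n) = 3 [3 | n] - 1, and restriction to multiples
  of 3 brings another factor 3. The constant is w / (1 - w)^2.\<close>

lemma wp_w: "wp w q = - 1 / 3 + 9 * double_pole_sum (q ^ 3) (q ^ 3) - double_pole_sum q q"
proof -
  let ?l = "\<lambda>m. of_nat (Suc m) * q ^ Suc m / (1 - q ^ Suc m)"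
  note wf = cube_root_facts[OF w]
  have "(\<lambda>m. 3 * (if 3 dvd Suc m then ?l m else 0) - ?l m) sums (3 * (of_nat 3 * double_pole_sum (q ^ 3) (q ^ 3)) - double_pole_sum q q)"
    by (intro sums_diff sums_mult double_pole_sum_multiples double_pole_sum_Lambert(1) q) auto
  also have "(\<lambda>m. 3 * (if 3 dvd Suc m then ?l m else 0) - ?l m) = (\<lambda>m. (w ^ Suc m + inverse w ^ Suc m) * ?l m)"
  proof
    fix m
    have c: "w ^ n + inverse w ^ n = (if 3 dvd n then 2 else - 1)" for n
    proof -
      have "w ^ n + inverse w ^ n = w ^ (n mod 3) + inverse w ^ (n mod 3)"
        using power_periodic[of w 3 n] power_periodic[of "inverse w" 3 n] wf(3) by (simp add: power_inverse)
      moreover have "w + inverse w = - 1" "w ^ 2 + inverse w ^ 2 = - 1"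
        unfolding wf(2) using w by algebra+
      moreover have "n mod 3 = 0 \<or> n mod 3 = 1 \<or> n mod 3 = 2" by presburger
      ultimately show ?thesis by (auto simp: dvd_eq_mod_eq_0)
    qed
    show "3 * (if 3 dvd Suc m then ?l m else 0) - ?l m = (w ^ Suc m + inverse w ^ Suc m) * ?l m"
      unfolding c by simp
  qed
  finally have "wp w q - w / (1 - w) ^ 2 = 3 * (of_nat 3 * double_pole_sum (q ^ 3) (q ^ 3)) - double_pole_sum q q"
    using wp_unit_sums[OF q(2) norm_w] sums_unique2 by blast
  moreover have "w / (1 - w) ^ 2 = - 1 / 3"
  proof -
    have "(1 - w) ^ 2 = - 3 * w" using w by algebra
    then show ?thesis using wf(1) by simp
  qed
  ultimately show ?thesis by (simp add: algebra_simps)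
qed

text \<open>Here the coefficients are c_6(n) = 6 [6 | n] - 3 [3 | n] - 2 [2 | n] + 1; each indicator
  of multiples of k brings another factor k.\<close>

lemma wp_minus_w: "wp (- w) q = - 1 + 36 * double_pole_sum (q ^ 6) (q ^ 6) - 9 * double_pole_sum (q ^ 3) (q ^ 3) - 4 * double_pole_sum (q ^ 2) (q ^ 2) + double_pole_sum q q"
proof -
  let ?l = "\<lambda>m. of_nat (Suc m) * q ^ Suc m / (1 - q ^ Suc m)"
  let ?i = "\<lambda>k m. if k dvd Suc m then ?l m else 0"
  note wf = cube_root_facts[OF w]
  have "(\<lambda>m. 6 * ?i 6 m - 3 * ?i 3 m - 2 * ?i 2 m + ?l m) sums
     (6 * (of_nat 6 * double_pole_sum (q ^ 6) (q ^ 6)) - 3 * (of_nat 3 * double_pole_sum (q ^ 3) (q ^ 3)) - 2 * (of_nat 2 * double_pole_sum (q ^ 2) (q ^ 2)) + double_pole_sum q q)"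
    by (intro sums_diff sums_add sums_mult double_pole_sum_multiples double_pole_sum_Lambert(1) q) auto
  also have "(\<lambda>m. 6 * ?i 6 m - 3 * ?i 3 m - 2 * ?i 2 m + ?l m) = (\<lambda>m. ((- w) ^ Suc m + inverse (- w) ^ Suc m) * ?l m)"
  proof
    fix m
    define v where "v = - w"
    have v: "v ^ 2 - v + 1 = 0" using w by (simp add: v_def)
    have v6: "v ^ 6 = 1" using v by algebra
    have iv: "inverse v = v ^ 5" by (rule inverse_unique) (use v6 in \<open>simp flip: power_Suc\<close>)
    have c: "v ^ n + inverse v ^ n = (if 6 dvd n then 2 else if 3 dvd n then - 2 else if 2 dvd n then - 1 else 1)" for n
    proof -
      have "v ^ n + inverse v ^ n = v ^ (n mod 6) + inverse v ^ (n mod 6)"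
        using power_periodic[of v 6 n] power_periodic[of "inverse v" 6 n] v6 by (simp add: power_inverse)
      moreover have "v + inverse v = 1" "v ^ 2 + inverse v ^ 2 = - 1" "v ^ 3 + inverse v ^ 3 = - 2"
         "v ^ 4 + inverse v ^ 4 = - 1" "v ^ 5 + inverse v ^ 5 = 1"
        unfolding iv using v by algebra+
      moreover have "n mod 6 = 0 \<or> n mod 6 = 1 \<or> n mod 6 = 2 \<or> n mod 6 = 3 \<or> n mod 6 = 4 \<or> n mod 6 = 5" by presburger
      moreover have "6 dvd n \<longleftrightarrow> n mod 6 = 0" "3 dvd n \<longleftrightarrow> n mod 6 = 0 \<or> n mod 6 = 3" "2 dvd n \<longleftrightarrow> n mod 6 = 0 \<or> n mod 6 = 2 \<or> n mod 6 = 4"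
        by presburger+
      ultimately show ?thesis by (elim disjE) simp_all
    qed
    have d: "6 dvd Suc m \<longleftrightarrow> 2 dvd Suc m \<and> 3 dvd Suc m" by presburger
    have "6 * (if 6 dvd Suc m then L else 0) - 3 * (if 3 dvd Suc m then L else 0) - 2 * (if 2 dvd Suc m then L else 0) + L =
      (if 6 dvd Suc m then 2 else if 3 dvd Suc m then - 2 else if 2 dvd Suc m then - 1 else 1) * L" for L :: complex
      unfolding d by (cases "2 dvd Suc m"; cases "3 dvd Suc m") (simp_all only: if_True if_False simp_thms, simp_all)
    then show "6 * ?i 6 m - 3 * ?i 3 m - 2 * ?i 2 m + ?l m = ((- w) ^ Suc m + inverse (- w) ^ Suc m) * ?l m"
      unfolding v_def[symmetric] c .
  qed
  finally have H: "(\<lambda>m. ((- w) ^ Suc m + inverse (- w) ^ Suc m) * ?l m) sums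
     (6 * (of_nat 6 * double_pole_sum (q ^ 6) (q ^ 6)) - 3 * (of_nat 3 * double_pole_sum (q ^ 3) (q ^ 3)) - 2 * (of_nat 2 * double_pole_sum (q ^ 2) (q ^ 2)) + double_pole_sum q q)" .
  have W: "wp (- w) q - (- w) / (1 - - w) ^ 2 =
     6 * (of_nat 6 * double_pole_sum (q ^ 6) (q ^ 6)) - 3 * (of_nat 3 * double_pole_sum (q ^ 3) (q ^ 3)) - 2 * (of_nat 2 * double_pole_sum (q ^ 2) (q ^ 2)) + double_pole_sum q q"
    by (rule sums_unique2[OF wp_unit_sums[OF q(2)] H]) (simp add: norm_w)
  have C: "(- w) / (1 - - w) ^ 2 = - 1"
  proof -
    have "(1 - - w) ^ 2 = w" using w by algebra
    then show ?thesis using wf(1) by simp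
  qed
  show ?thesis using W unfolding C by (simp add: algebra_simps)
qed

end

text \<open>Here the coefficients are c_4(n) = 4 [4 | n] - 2 [2 | n].\<close>

lemma wp_i:
  assumes q: "q \<noteq> 0" "norm q < 1"
  shows "wp \<i> q = - 1 / 2 + 16 * double_pole_sum (q ^ 4) (q ^ 4) - 4 * double_pole_sum (q ^ 2) (q ^ 2)"
proof -
  let ?l = "\<lambda>m. of_nat (Suc m) * q ^ Suc m / (1 - q ^ Suc m)"
  have "(\<lambda>m. 4 * (if 4 dvd Suc m then ?l m else 0) - 2 * (if 2 dvd Suc m then ?l m else 0)) sums
     (4 * (of_nat 4 * double_pole_sum (q ^ 4) (q ^ 4)) - 2 * (of_nat 2 * double_pole_sum (q ^ 2) (q ^ 2)))"
    by (intro sums_diff sums_mult double_pole_sum_multiples q) auto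
  also have "(\<lambda>m. 4 * (if 4 dvd Suc m then ?l m else 0) - 2 * (if 2 dvd Suc m then ?l m else 0)) =
     (\<lambda>m. (\<i> ^ Suc m + inverse \<i> ^ Suc m) * ?l m)"
  proof
    fix m
    have c: "\<i> ^ n + inverse \<i> ^ n = (if 4 dvd n then 2 else if 2 dvd n then - 2 else 0)" for n
    proof -
      have "\<i> ^ n + inverse \<i> ^ n = \<i> ^ (n mod 4) + inverse \<i> ^ (n mod 4)"
        using power_periodic[of \<i> 4 n] power_periodic[of "inverse \<i>" 4 n] by (simp add: power_inverse)
      moreover have "n mod 4 = 0 \<or> n mod 4 = 1 \<or> n mod 4 = 2 \<or> n mod 4 = 3" by presburger
      moreover have "4 dvd n \<longleftrightarrow> n mod 4 = 0" "2 dvd n \<longleftrightarrow> n mod 4 = 0 \<or> n mod 4 = 2"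
        by presburger+
      moreover have "\<i> ^ 3 = - \<i>" "(- \<i>) ^ 3 = \<i>" by (simp_all add: power3_eq_cube)
      ultimately show ?thesis by (elim disjE) (simp_all del: power_minus_odd)
    qed
    have d: "4 dvd Suc m \<Longrightarrow> 2 dvd Suc m" by presburger
    have "4 * (if 4 dvd Suc m then L else 0) - 2 * (if 2 dvd Suc m then L else 0) =
      (if 4 dvd Suc m then 2 else if 2 dvd Suc m then - 2 else 0) * L" for L :: complex
      using d by (cases "4 dvd Suc m"; cases "2 dvd Suc m") (simp_all only: if_True if_False simp_thms, simp_all)
    then show "4 * (if 4 dvd Suc m then ?l m else 0) - 2 * (if 2 dvd Suc m then ?l m else 0) = (\<i> ^ Suc m + inverse \<i> ^ Suc m) * ?l m"
      unfolding c .
  qed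
  finally have H: "(\<lambda>m. (\<i> ^ Suc m + inverse \<i> ^ Suc m) * ?l m) sums
     (4 * (of_nat 4 * double_pole_sum (q ^ 4) (q ^ 4)) - 2 * (of_nat 2 * double_pole_sum (q ^ 2) (q ^ 2)))" .
  have "wp \<i> q - \<i> / (1 - \<i>) ^ 2 = 4 * (of_nat 4 * double_pole_sum (q ^ 4) (q ^ 4)) - 2 * (of_nat 2 * double_pole_sum (q ^ 2) (q ^ 2))"
    by (rule sums_unique2[OF wp_unit_sums[OF q(2)] H]) simp
  moreover have "\<i> / (1 - \<i>) ^ 2 = - 1 / 2"
  proof -
    have "(1 - \<i>) ^ 2 = - 2 * \<i>" by (simp add: power2_eq_square algebra_simps)
    then show ?thesis by simp
  qed
  ultimately show ?thesis by (simp add: algebra_simps)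
qed

text \<open>Both halves have arguments inside the unit disc, and their Lambert terms combine by (y +
  y^2) / (1 - y^3) = y / (1 - y) - y^3 / (1 - y^3) with y = q^m.\<close>

lemma wp_q_q3:
  assumes q: "q \<noteq> 0" "norm q < 1"
  shows "wp q (q ^ 3) = double_pole_sum q q - double_pole_sum (q ^ 3) (q ^ 3)"
proof -
  have n: "norm (q ^ 3) < 1" "norm (q ^ 2) < 1" using norm_pow_lt_1[OF q] by auto
  have "q ^ 3 / q = q ^ 2" using q by (simp add: field_simps power3_eq_cube power2_eq_square)
  then have e: "wp q (q ^ 3) = double_pole_sum q (q ^ 3) + double_pole_sum (q ^ 2) (q ^ 3)" by (simp add: wp_def)
  have "(\<lambda>m. of_nat (Suc m) * q ^ Suc m / (1 - (q ^ 3) ^ Suc m) + of_nat (Suc m) * (q ^ 2) ^ Suc m / (1 - (q ^ 3) ^ Suc m)) sums wp q (q ^ 3)"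
    unfolding e by (intro sums_add double_pole_sum_Lambert(1) n q)
  also have "(\<lambda>m. of_nat (Suc m) * q ^ Suc m / (1 - (q ^ 3) ^ Suc m) + of_nat (Suc m) * (q ^ 2) ^ Suc m / (1 - (q ^ 3) ^ Suc m)) =
    (\<lambda>m. of_nat (Suc m) * q ^ Suc m / (1 - q ^ Suc m) - of_nat (Suc m) * (q ^ 3) ^ Suc m / (1 - (q ^ 3) ^ Suc m))"
  proof
    fix m
    define y where "y = q ^ Suc m"
    have y: "norm y < 1" unfolding y_def by (rule norm_pow_lt_1[OF q]) simp
    have "norm (y ^ 3) < 1" using y by (simp add: norm_power power_less_one_iff)
    then have "y ^ 3 \<noteq> 1" by auto
    then have y1: "1 - y \<noteq> 0" "1 - y ^ 3 \<noteq> 0" using y by auto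
    have p: "(q ^ 2) ^ Suc m = y ^ 2" "(q ^ 3) ^ Suc m = y ^ 3"
      unfolding y_def by (simp_all only: power_mult[symmetric] mult.commute)
    show "of_nat (Suc m) * q ^ Suc m / (1 - (q ^ 3) ^ Suc m) + of_nat (Suc m) * (q ^ 2) ^ Suc m / (1 - (q ^ 3) ^ Suc m) =
      of_nat (Suc m) * q ^ Suc m / (1 - q ^ Suc m) - of_nat (Suc m) * (q ^ 3) ^ Suc m / (1 - (q ^ 3) ^ Suc m)"
    proof -
      have "c * y / (1 - y ^ 3) + c * y ^ 2 / (1 - y ^ 3) = c * y / (1 - y) - c * y ^ 3 / (1 - y ^ 3)" for c
      proof -
        have "1 - y ^ 3 = (1 - y) * (1 + y + y ^ 2)" by algebra
        then have "y / (1 - y) = y * (1 + y + y ^ 2) / (1 - y ^ 3)" using y1 by simp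
        then have "c * y / (1 - y) = c * (y * (1 + y + y ^ 2)) / (1 - y ^ 3)" by (metis times_divide_eq_right)
        then show ?thesis by (simp add: add_divide_distrib algebra_simps power3_eq_cube power2_eq_square)
      qed
      then show ?thesis unfolding p y_def[symmetric] .
    qed
  qed
  finally have "(\<lambda>m. of_nat (Suc m) * q ^ Suc m / (1 - q ^ Suc m) - of_nat (Suc m) * (q ^ 3) ^ Suc m / (1 - (q ^ 3) ^ Suc m)) sums wp q (q ^ 3)" .
  moreover have "(\<lambda>m. of_nat (Suc m) * q ^ Suc m / (1 - q ^ Suc m) - of_nat (Suc m) * (q ^ 3) ^ Suc m / (1 - (q ^ 3) ^ Suc m)) sums
    (double_pole_sum q q - double_pole_sum (q ^ 3) (q ^ 3))"
    by (intro sums_diff double_pole_sum_Lambert(1) n q)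
  ultimately show ?thesis by (rule sums_unique2)
qed

lemma wp_q_q2:
  assumes q: "q \<noteq> 0" "norm q < 1"
  shows "wp q (q ^ 2) = 2 * (double_pole_sum q q - double_pole_sum (q ^ 2) (q ^ 2))"
proof -
  have n: "norm (q ^ 2) < 1" using norm_pow_lt_1[OF q] by auto
  have "q ^ 2 / q = q" using q by (simp add: field_simps power2_eq_square)
  then have e: "wp q (q ^ 2) = 2 * double_pole_sum q (q ^ 2)" by (simp add: wp_def)
  have "(\<lambda>m. of_nat (Suc m) * q ^ Suc m / (1 - (q ^ 2) ^ Suc m)) sums double_pole_sum q (q ^ 2)"
    by (intro double_pole_sum_Lambert(1) n q)
  also have "(\<lambda>m. of_nat (Suc m) * q ^ Suc m / (1 - (q ^ 2) ^ Suc m)) =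
    (\<lambda>m. of_nat (Suc m) * q ^ Suc m / (1 - q ^ Suc m) - of_nat (Suc m) * (q ^ 2) ^ Suc m / (1 - (q ^ 2) ^ Suc m))"
  proof
    fix m
    define y where "y = q ^ Suc m"
    have y: "norm y < 1" unfolding y_def by (rule norm_pow_lt_1[OF q]) simp
    have p: "(q ^ 2) ^ Suc m = y ^ 2"
      unfolding y_def by (simp only: power_mult[symmetric] mult.commute)
    have "y \<noteq> - 1" using y by auto
    then have y1: "1 - y \<noteq> 0" "1 + y \<noteq> 0"
      using y by (auto simp: add_eq_0_iff)
    have "c * y / (1 - y ^ 2) = c * y / (1 - y) - c * y ^ 2 / (1 - y ^ 2)" for c
    proof -
      have "1 - y ^ 2 = (1 - y) * (1 + y)" by algebra
      then have "y / (1 - y) = y * (1 + y) / (1 - y ^ 2)" using y1 by simp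
      then have "c * y / (1 - y) = c * (y * (1 + y)) / (1 - y ^ 2)" by (metis times_divide_eq_right)
      then show ?thesis by (simp add: add_divide_distrib algebra_simps power2_eq_square)
    qed
    then show "of_nat (Suc m) * q ^ Suc m / (1 - (q ^ 2) ^ Suc m) =
      of_nat (Suc m) * q ^ Suc m / (1 - q ^ Suc m) - of_nat (Suc m) * (q ^ 2) ^ Suc m / (1 - (q ^ 2) ^ Suc m)"
      unfolding p y_def[symmetric] .
  qed
  finally have "(\<lambda>m. of_nat (Suc m) * q ^ Suc m / (1 - q ^ Suc m) - of_nat (Suc m) * (q ^ 2) ^ Suc m / (1 - (q ^ 2) ^ Suc m)) sums double_pole_sum q (q ^ 2)" .
  moreover have "(\<lambda>m. of_nat (Suc m) * q ^ Suc m / (1 - q ^ Suc m) - of_nat (Suc m) * (q ^ 2) ^ Suc m / (1 - (q ^ 2) ^ Suc m)) sums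
    (double_pole_sum q q - double_pole_sum (q ^ 2) (q ^ 2))"
    by (intro sums_diff double_pole_sum_Lambert(1) n q)
  ultimately have "double_pole_sum q (q ^ 2) = double_pole_sum q q - double_pole_sum (q ^ 2) (q ^ 2)" by (rule sums_unique2)
  then show ?thesis unfolding e by simp
qed

lemma rr_frac_pow5:
  assumes "0 \<le> q" "q < 1"
  shows "rr_frac q ^ 5 = q * (progression_prod 5 1 q * progression_prod 5 4 q / (progression_prod 5 2 q * progression_prod 5 3 q)) ^ 5"
proof -
  have a: "\<bar>q\<bar> < 1" using assms by simp
  have "(\<lambda>j. ((1 - q ^ (5*j + 1)) * (1 - q ^ (5*j + 4))) / ((1 - q ^ (5*j + 2)) * (1 - q ^ (5*j + 3)))) has_prod
     ((progression_prod 5 1 q * progression_prod 5 4 q) / (progression_prod 5 2 q * progression_prod 5 3 q))"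
    by (intro has_prod_divide has_prod_mult progression_prod_facts(1)[OF a]) auto
  then have P: "(\<Prod>j. ((1 - q ^ (5*j + 1)) * (1 - q ^ (5*j + 4))) / ((1 - q ^ (5*j + 2)) * (1 - q ^ (5*j + 3)))) =
     progression_prod 5 1 q * progression_prod 5 4 q / (progression_prod 5 2 q * progression_prod 5 3 q)"
    by (rule has_prod_unique[symmetric])
  \<comment> \<open>For q = 0 this rests on the value 0 of \<open>0 powr (1/5)\<close>.\<close>
  have Q: "(q powr (1/5)) ^ 5 = q"
    using assms by (cases "q = 0") (auto simp: powr_power)
  show ?thesis unfolding rr_frac_def P power_mult_distrib Q ..
qed

section \<open>Lambert series of real argument as eta quotients\<close>

context
  fixes r :: real
  assumes r: "0 < r" "r < 1"
begin

lemma nome_cond: "complex_of_real r \<noteq> 0" "norm (complex_of_real r) < 1"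
  using r by auto

lemma pow_lt1: "k > 0 \<Longrightarrow> \<bar>r ^ k\<bar> < 1"
  using r by (simp add: power_less_one_iff)

lemma sigma_series_pow: "k > 0 \<Longrightarrow> double_pole_sum (complex_of_real r ^ k) (complex_of_real r ^ k) = of_real (sigma_series (r ^ k))"
  using sigma_series_sums(2)[OF pow_lt1, of k] by simp

lemma sigma_series_1: "double_pole_sum (complex_of_real r) (complex_of_real r) = of_real (sigma_series r)"
  using sigma_series_sums(2)[of r] r by simp

lemma eulerc_pow: "k > 0 \<Longrightarrow> eulerc (complex_of_real r ^ k) = of_real (euler_E (r ^ k))"
  using of_real_euler_E_pow[of r k] r by simp

lemma eulerc_1: "eulerc (complex_of_real r) = of_real (euler_E r)"
  using of_real_euler_E[of r] r by simp

text \<open>The difference at the points of order 3 and 6. Among the three it is the one whose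
  Lambert series is q times the logarithmic derivative of the antiderivative in (4).\<close>

lemma level6_lambert:
  "1 - 3 * sigma_series r + 6 * sigma_series (r ^ 2) + 27 * sigma_series (r ^ 3) - 54 * sigma_series (r ^ 6) =
   euler_E r ^ 3 * euler_E (r ^ 2) ^ 3 / (euler_E (r ^ 3) * euler_E (r ^ 6))" (is "?L = ?R")
proof -
  define w where "w = Complex (-1/2) (sqrt 3 / 2)"
  have w: "w ^ 2 + w + 1 = 0"
    by (simp add: w_def complex_eq_iff power2_eq_square)
  have "2 / 3 * complex_of_real ?R = wp w r - wp (- w) r"
    unfolding wp_level6(1)[OF nome_cond w] by (simp add: eulerc_pow eulerc_1)
  also have "\<dots> = 2 / 3 * complex_of_real ?L"
    unfolding wp_w[OF nome_cond w] wp_minus_w[OF nome_cond w] by (simp add: sigma_series_pow sigma_series_1 algebra_simps)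
  finally have "complex_of_real ?R = complex_of_real ?L" by (rule mult_left_cancelD) simp
  then show ?thesis by (simp only: of_real_eq_iff)
qed

lemma level9_lambert:
  "1 + 3 * sigma_series r - 27 * sigma_series (r ^ 9) = euler_E (r ^ 3) ^ 10 / (euler_E r ^ 3 * euler_E (r ^ 9) ^ 3)" (is "?L = ?R")
proof -
  define w where "w = Complex (-1/2) (sqrt 3 / 2)"
  have w: "w ^ 2 + w + 1 = 0"
    by (simp add: w_def complex_eq_iff power2_eq_square)
  have cr3: "complex_of_real r ^ 3 \<noteq> 0" "norm (complex_of_real r ^ 3) < 1"
    using nome_cond norm_pow_lt_1[OF nome_cond, of 3] by auto
  have "- 1 / 3 * complex_of_real ?R = wp w (complex_of_real r ^ 3) - wp r (complex_of_real r ^ 3)"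
    unfolding wp_level9[OF nome_cond w] by (simp add: eulerc_pow eulerc_1)
  also have "\<dots> = - 1 / 3 * complex_of_real ?L"
    unfolding wp_w[OF cr3 w] wp_q_q3[OF nome_cond] power_mult[symmetric] by (simp add: sigma_series_pow sigma_series_1 algebra_simps)
  finally have "complex_of_real ?R = complex_of_real ?L" by (rule mult_left_cancelD) simp
  then show ?thesis by (simp only: of_real_eq_iff)
qed

lemma level8_lambert:
  "1 + 4 * sigma_series r - 4 * sigma_series (r ^ 2) + 8 * sigma_series (r ^ 4) - 32 * sigma_series (r ^ 8) =
   euler_E (r ^ 2) ^ 6 * euler_E (r ^ 4) ^ 6 / (euler_E r ^ 4 * euler_E (r ^ 8) ^ 4)" (is "?L = ?R")
proof -
  have cr2: "complex_of_real r ^ 2 \<noteq> 0" "norm (complex_of_real r ^ 2) < 1"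
    using nome_cond norm_pow_lt_1[OF nome_cond, of 2] by auto
  have "- 1 / 2 * complex_of_real ?R = wp \<i> (complex_of_real r ^ 2) - wp r (complex_of_real r ^ 2)"
    unfolding wp_level8[OF nome_cond] by (simp add: eulerc_pow eulerc_1)
  also have "\<dots> = - 1 / 2 * complex_of_real ?L"
    unfolding wp_i[OF cr2] wp_q_q2[OF nome_cond] power_mult[symmetric] by (simp add: sigma_series_pow sigma_series_1 algebra_simps)
  finally have "complex_of_real ?R = complex_of_real ?L" by (rule mult_left_cancelD) simp
  then show ?thesis by (simp only: of_real_eq_iff)
qed

lemma level6_relation_real:
  "euler_E r ^ 9 * euler_E (r ^ 6) ^ 3 / (euler_E (r ^ 2) ^ 9 * euler_E (r ^ 3) ^ 3) + 8 =
   9 * (euler_E r * euler_E (r ^ 3) ^ 5 / (euler_E (r ^ 2) ^ 5 * euler_E (r ^ 6)))" (is "?L = ?R")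
proof -
  have "complex_of_real ?L = complex_of_real ?R"
    using level6_relation[OF nome_cond] by (simp add: eulerc_pow eulerc_1)
  then show ?thesis by (simp only: of_real_eq_iff)
qed

lemma progression_dlog_sums:
  assumes b: "b \<in> {1..4}"
  shows "(\<lambda>m. if Suc m mod 5 = b then real (Suc m) * r ^ Suc m / (1 - r ^ Suc m) else 0) sums (r * progression_dlog 5 b r)"
proof -
  let ?f = "\<lambda>m. if Suc m mod 5 = b then real (Suc m) * r ^ Suc m / (1 - r ^ Suc m) else 0"
  define g where "g = (\<lambda>j. 5 * j + b - 1)"
  have Sg: "Suc (g j) = 5 * j + b" for j using b by (simp add: g_def)
  have "strict_mono g" using b by (auto simp: strict_mono_def g_def)
  moreover have "?f n = 0" if "n \<notin> range g" for n
  proof -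
    have "Suc n mod 5 \<noteq> b"
    proof
      assume "Suc n mod 5 = b"
      then have "Suc n = 5 * (Suc n div 5) + b" by presburger
      then have "n = g (Suc n div 5)" using Sg[of "Suc n div 5"] by simp
      then show False using that by blast
    qed
    then show ?thesis by simp
  qed
  ultimately have "(\<lambda>n. ?f (g n)) sums (r * progression_dlog 5 b r) \<longleftrightarrow> ?f sums (r * progression_dlog 5 b r)"
    by (intro sums_mono_reindex) auto
  moreover have "(\<lambda>n. ?f (g n)) sums (r * progression_dlog 5 b r)"
  proof -
    have "(\<lambda>j. real (5 * j + b) * r ^ (5 * j + b - 1) / (1 - r ^ (5 * j + b))) sums progression_dlog 5 b r"
      using r b by (intro progression_prod_facts(4)) auto
    from sums_mult[OF this, of r]
    have "(\<lambda>j. r * (real (5 * j + b) * r ^ (5 * j + b - 1) / (1 - r ^ (5 * j + b)))) sums (r * progression_dlog 5 b r)" .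
    also have "(\<lambda>j. r * (real (5 * j + b) * r ^ (5 * j + b - 1) / (1 - r ^ (5 * j + b)))) = (\<lambda>n. ?f (g n))"
    proof
      fix j
      have "r ^ (5 * j + b) = r * r ^ (5 * j + b - 1)" using b by (simp flip: power_Suc)
      moreover have "(5 * j + b) mod 5 = b" using b by auto
      ultimately show "r * (real (5 * j + b) * r ^ (5 * j + b - 1) / (1 - r ^ (5 * j + b))) = ?f (g j)"
        unfolding Sg by simp
    qed
    finally show ?thesis .
  qed
  ultimately show ?thesis by simp
qed

text \<open>z^n + z^(-n) - z^(2 n) - z^(-2 n) is the Legendre symbol of n modulo 5 times the Gauss
  sum \<open>s\<close>, which also occurs in \<open>wp_level5\<close>. Only s^2 = 5 survives, so the
  choice of \<open>z\<close> does not matter.\<close>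

lemma level5_lambert:
  "1 - 5 * (r * progression_dlog 5 1 r - r * progression_dlog 5 2 r - r * progression_dlog 5 3 r + r * progression_dlog 5 4 r) = euler_E r ^ 5 / euler_E (r ^ 5)" (is "1 - 5 * ?G = ?R")
proof -
  obtain z :: complex where z: "z ^ 4 + z ^ 3 + z ^ 2 + z + 1 = 0"
    using exists_fifth_root by blast
  note zf = fifth_root_facts[OF z]
  have nz1: "norm z = 1"
    using zf(2) by (metis norm_one norm_power power_eq_1_iff zero_neq_numeral norm_ge_zero)
  define s where "s = z * (1 - z) * (1 - z ^ 2)"
  have s2: "s ^ 2 = 5" unfolding s_def using z by algebra
  let ?l = "\<lambda>m. real (Suc m) * r ^ Suc m / (1 - r ^ Suc m)"
  let ?c = "\<lambda>m. complex_of_nat (Suc m) * complex_of_real r ^ Suc m / (1 - complex_of_real r ^ Suc m)"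
  let ?i = "\<lambda>b m. if Suc m mod 5 = b then ?l m else 0"
  have "(\<lambda>m. ?i 1 m - ?i 2 m - ?i 3 m + ?i 4 m) sums ?G"
    by (intro sums_add sums_diff progression_dlog_sums) auto
  then have "(\<lambda>m. s * complex_of_real (?i 1 m - ?i 2 m - ?i 3 m + ?i 4 m)) sums (s * of_real ?G)"
    by (intro sums_mult sums_of_real)
  also have "(\<lambda>m. s * complex_of_real (?i 1 m - ?i 2 m - ?i 3 m + ?i 4 m)) =
     (\<lambda>m. (z ^ Suc m + inverse z ^ Suc m) * ?c m - ((z ^ 2) ^ Suc m + inverse (z ^ 2) ^ Suc m) * ?c m)"
  proof
    fix m
    have c: "z ^ n + inverse z ^ n - ((z ^ 2) ^ n + inverse (z ^ 2) ^ n) =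
      s * ((if n mod 5 = 1 then 1 else 0) - (if n mod 5 = 2 then 1 else 0) - (if n mod 5 = 3 then 1 else 0) + (if n mod 5 = 4 then 1 else 0))" for n
    proof -
      have "(z ^ 2) ^ 5 = (z ^ 5) ^ 2" by (simp flip: power_mult)
      then have p5: "(z ^ 2) ^ 5 = 1" "inverse z ^ 5 = 1" "inverse (z ^ 2) ^ 5 = 1"
        unfolding power_inverse zf(2) by simp_all
      have "z ^ n + inverse z ^ n - ((z ^ 2) ^ n + inverse (z ^ 2) ^ n) =
        z ^ (n mod 5) + inverse z ^ (n mod 5) - ((z ^ 2) ^ (n mod 5) + inverse (z ^ 2) ^ (n mod 5))"
        by (simp only: power_periodic[OF zf(2), of n] power_periodic[OF p5(1), of n] power_periodic[OF p5(2), of n] power_periodic[OF p5(3), of n])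
      moreover have "z ^ 1 + inverse z ^ 1 - ((z ^ 2) ^ 1 + inverse (z ^ 2) ^ 1) = s"
        "z ^ 2 + inverse z ^ 2 - ((z ^ 2) ^ 2 + inverse (z ^ 2) ^ 2) = - s"
        "z ^ 3 + inverse z ^ 3 - ((z ^ 2) ^ 3 + inverse (z ^ 2) ^ 3) = - s"
        "z ^ 4 + inverse z ^ 4 - ((z ^ 2) ^ 4 + inverse (z ^ 2) ^ 4) = s"
      proof -
        have pp: "z ^ 6 = z" "z ^ 8 = z ^ 3" "z ^ 9 = z ^ 4" "z ^ 12 = z ^ 2" "z ^ 16 = z"
          using power_periodic[OF zf(2), of 6] power_periodic[OF zf(2), of 8] power_periodic[OF zf(2), of 9]
            power_periodic[OF zf(2), of 12] power_periodic[OF zf(2), of 16] by simp_all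
        have se: "s = z - z ^ 2 - z ^ 3 + z ^ 4" unfolding s_def by algebra
        show "z ^ 1 + inverse z ^ 1 - ((z ^ 2) ^ 1 + inverse (z ^ 2) ^ 1) = s"
          "z ^ 2 + inverse z ^ 2 - ((z ^ 2) ^ 2 + inverse (z ^ 2) ^ 2) = - s"
          "z ^ 3 + inverse z ^ 3 - ((z ^ 2) ^ 3 + inverse (z ^ 2) ^ 3) = - s"
          "z ^ 4 + inverse z ^ 4 - ((z ^ 2) ^ 4 + inverse (z ^ 2) ^ 4) = s"
          unfolding zf(5,6) se power_mult[symmetric] by (simp_all add: pp)
      qed
      moreover have "n mod 5 = 0 \<or> n mod 5 = 1 \<or> n mod 5 = 2 \<or> n mod 5 = 3 \<or> n mod 5 = 4" by presburger
      ultimately show ?thesis by (elim disjE) (simp_all only:, simp_all)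
    qed
    have lc: "?c m = complex_of_real (?l m)" by simp
    have "s * complex_of_real ((if a then L else 0) - (if b then L else 0) - (if d then L else 0) + (if e then L else 0)) =
       (s * ((if a then 1 else 0) - (if b then 1 else 0) - (if d then 1 else 0) + (if e then 1 else 0))) * complex_of_real L" for a b d e L
      by simp
    then show "s * complex_of_real (?i 1 m - ?i 2 m - ?i 3 m + ?i 4 m) =
      (z ^ Suc m + inverse z ^ Suc m) * ?c m - ((z ^ 2) ^ Suc m + inverse (z ^ 2) ^ Suc m) * ?c m"
      unfolding left_diff_distrib[symmetric] c lc by blast
  qed
  finally have H: "(\<lambda>m. (z ^ Suc m + inverse z ^ Suc m) * ?c m - ((z ^ 2) ^ Suc m + inverse (z ^ 2) ^ Suc m) * ?c m) sums (s * of_real ?G)" .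
  have "(wp z r - z / (1 - z) ^ 2) - (wp (z ^ 2) r - z ^ 2 / (1 - z ^ 2) ^ 2) = s * of_real ?G"
    by (rule sums_unique2[OF sums_diff[OF wp_unit_sums wp_unit_sums] H]) (use nome_cond nz1 in \<open>auto simp: norm_power\<close>)
  \<comment> \<open>The two terms split off in \<open>wp_unit_sums\<close>; they supply the constant
    1 of the claim.\<close>
  moreover have "z / (1 - z) ^ 2 - z ^ 2 / (1 - z ^ 2) ^ 2 = - (1 / s)"
  proof -
    define a b where "a = 1 - z" and "b = 1 + z"
    have ab: "1 - z ^ 2 = a * b" unfolding a_def b_def by algebra
    have nz: "a \<noteq> 0" "b \<noteq> 0" using zf(3,4) ab by (auto simp: a_def)
    have key: "(z * b ^ 2 - z ^ 2) * z = - b" unfolding b_def using z by algebra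
    have "z / a ^ 2 - z ^ 2 / (a * b) ^ 2 = ((z * b ^ 2 - z ^ 2) * z) / (z * (a * b) ^ 2)"
      using nz zf(1) by (simp add: field_simps power2_eq_square)
    also have "\<dots> = - (1 / (z * a * (a * b)))"
      unfolding key using nz zf(1) by (simp add: power2_eq_square)
    finally show ?thesis unfolding s_def ab unfolding a_def .
  qed
  moreover have "wp z r - wp (z ^ 2) r = - (complex_of_real ?R / s)"
    unfolding wp_level5[OF z nome_cond] s_def by (simp add: eulerc_pow eulerc_1)
  moreover have "s \<noteq> 0" using s2 by auto
  moreover have "1 - R = s * (s * X)"
    if "(A - B) - (C - D) = s * X" "B - D = - (1 / s)" "A - C = - (R / s)" "s \<noteq> 0" for A B C D X R :: complex
  proof -
    have "(A - B) - (C - D) = (A - C) - (B - D)" by simp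
    then have "- (R / s) + 1 / s = s * X" using that by simp
    then show ?thesis using that(4) by (simp add: field_simps)
  qed
  ultimately have "1 - complex_of_real ?R = s * (s * of_real ?G)" by blast
  also have "\<dots> = 5 * of_real ?G" using s2 by (simp add: power2_eq_square mult.assoc[symmetric])
  finally have "complex_of_real (1 - 5 * ?G) = complex_of_real ?R" by (simp add: algebra_simps)
  then show ?thesis by (simp only: of_real_eq_iff)
qed

text \<open>This is \<open>rr_fifth_power_identity\<close> at the real fifth root p of r, where p^5
  T^5 is \<open>rr_frac r ^ 5\<close>, divided by r.\<close>

lemma rr_frac_relation:
  "1 / rr_frac r ^ 5 - 11 - rr_frac r ^ 5 = euler_E r ^ 6 / (r * euler_E (r ^ 5) ^ 6)"
proof -
  define p where "p = complex_of_real (root 5 r)"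
  have p5: "p ^ 5 = of_real r"
    unfolding p_def using r by (simp add: real_root_pow_pos2 flip: of_real_power)
  have p: "p \<noteq> 0" "norm p < 1" unfolding p_def using r by (auto simp: real_root_lt_1_iff)
  have p10: "p ^ 10 = of_real r ^ 2" and p25: "p ^ 25 = of_real r ^ 5"
  proof -
    have "p ^ 10 = (p ^ 5) ^ 2" "p ^ 25 = (p ^ 5) ^ 5" by (simp_all flip: power_mult)
    then show "p ^ 10 = of_real r ^ 2" "p ^ 25 = of_real r ^ 5" unfolding p5 by simp_all
  qed
  define t where "t = progression_prod 5 1 r * progression_prod 5 4 r / (progression_prod 5 2 r * progression_prod 5 3 r)"
  have g: "progression_prod 5 b r > 0" if "b > 0" for b using r that by (intro progression_prod_facts(2)) auto
  have t0: "t > 0" unfolding t_def using g by simp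
  have "theta (of_real r) (of_real r ^ 5) = of_real (progression_prod 5 1 r * progression_prod 5 4 r)"
  proof -
    have "complex_of_real r ^ 5 / of_real r = of_real r ^ 4" using r by (simp add: field_simps flip: power_Suc)
    then show ?thesis unfolding theta_def using r of_real_progression_prod[of r 5 1] of_real_progression_prod[of r 5 4] by simp
  qed
  moreover have "theta (of_real r ^ 2) (of_real r ^ 5) = of_real (progression_prod 5 2 r * progression_prod 5 3 r)"
  proof -
    have "complex_of_real r ^ 5 / of_real r ^ 2 = of_real r ^ 3" using r by (simp add: field_simps flip: power_add)
    then show ?thesis unfolding theta_def using r of_real_progression_prod[of r 5 2] of_real_progression_prod[of r 5 3] by simp
  qed
  ultimately have "eulerc (of_real r) ^ 6 / eulerc (of_real r ^ 5) ^ 6 = 1 / (of_real t) ^ 5 - 11 * of_real r - of_real r ^ 2 * of_real t ^ 5"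
    using rr_fifth_power_identity[OF p] unfolding p5 p10 p25 t_def by simp
  then have "complex_of_real (euler_E r ^ 6 / euler_E (r ^ 5) ^ 6) = complex_of_real (1 / t ^ 5 - 11 * r - r ^ 2 * t ^ 5)"
    by (simp add: eulerc_pow eulerc_1)
  then have "euler_E r ^ 6 / euler_E (r ^ 5) ^ 6 = 1 / t ^ 5 - 11 * r - r ^ 2 * t ^ 5"
    by (simp only: of_real_eq_iff)
  then have "euler_E r ^ 6 / (r * euler_E (r ^ 5) ^ 6) = (1 / t ^ 5 - 11 * r - r ^ 2 * t ^ 5) / r"
    by (metis divide_divide_eq_left mult.commute)
  also have "\<dots> = 1 / (r * t ^ 5) - 11 - r * t ^ 5"
    using r t0 by (simp add: diff_divide_distrib power2_eq_square)
  also have "r * t ^ 5 = rr_frac r ^ 5"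
    unfolding t_def using r by (intro rr_frac_pow5[symmetric]) auto
  finally show ?thesis by simp
qed

end

section \<open>The transformation law of the eta function\<close>

text \<open>Differentiating rGamma z * rGamma (1 - z) = sin (pi z) / pi gives the cotangent formula
  for \<open>Digamma\<close>; differentiating once more gives the claim.\<close>

lemma Polygamma_1_reflection:
  fixes z :: complex
  assumes z: "z \<notin> \<int>"
  shows "Polygamma 1 z + Polygamma 1 (1 - z) = (of_real pi / sin (of_real pi * z)) ^ 2"
proof -
  have nonint: "w \<notin> \<int>\<^sub>\<le>\<^sub>0" "1 - w \<notin> \<int>\<^sub>\<le>\<^sub>0" "sin (of_real pi * w) \<noteq> 0" if "w \<notin> \<int>" for w :: complex
  proof -
    show "w \<notin> \<int>\<^sub>\<le>\<^sub>0" using that nonpos_Ints_Int by blast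
    have "1 - w \<notin> \<int>" using that by (metis Ints_1 Ints_diff diff_diff_eq2 add_diff_cancel_left')
    then show "1 - w \<notin> \<int>\<^sub>\<le>\<^sub>0" using nonpos_Ints_Int by blast
    show "sin (of_real pi * w) \<noteq> 0"
      using that by (auto simp: sin_eq_0 mult.commute)
  qed
  have cot: "Digamma (1 - w) - Digamma w = of_real pi * cos (of_real pi * w) / sin (of_real pi * w)" if "w \<notin> \<int>" for w :: complex
  proof -
    have "((\<lambda>z. rGamma z * rGamma (1 - z)) has_field_derivative
        (rGamma w * rGamma (1 - w) * (Digamma (1 - w) - Digamma w))) (at w)"
      using nonint[OF that]
      by (auto intro!: derivative_eq_intros simp: algebra_simps)
    moreover have "((\<lambda>z::complex. rGamma z * rGamma (1 - z)) has_field_derivative cos (of_real pi * w)) (at w)"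
      unfolding rGamma_reflection_complex by (auto intro!: derivative_eq_intros)
    ultimately have "rGamma w * rGamma (1 - w) * (Digamma (1 - w) - Digamma w) = cos (of_real pi * w)"
      by (rule DERIV_unique)
    then show ?thesis
      unfolding rGamma_reflection_complex using nonint(3)[OF that] by (simp add: field_simps)
  qed
  have "((\<lambda>z. Digamma (1 - z) - Digamma z) has_field_derivative (- Polygamma 1 (1 - z) - Polygamma 1 z)) (at z)"
    using nonint[OF z] by (auto intro!: derivative_eq_intros)
  moreover have "((\<lambda>z. Digamma (1 - z) - Digamma z) has_field_derivative (- ((of_real pi / sin (of_real pi * z)) ^ 2))) (at z)"
  proof (rule has_field_derivative_transform_within_open)
    show "open (- \<int> :: complex set)" "z \<in> - \<int>" using z closed_Ints by auto
    show "of_real pi * cos (of_real pi * w) / sin (of_real pi * w) = Digamma (1 - w) - Digamma w" if "w \<in> - \<int>" for w :: complex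
      using cot[of w] that by simp
    define S C where "S = sin (of_real pi * z)" and "C = cos (of_real pi * z)"
    have "((\<lambda>w. of_real pi * cos (of_real pi * w) / sin (of_real pi * w)) has_field_derivative
        ((of_real pi * (- S * of_real pi)) * S - of_real pi * C * (C * of_real pi)) / (S * S)) (at z)"
      unfolding S_def C_def using nonint(3)[OF z] by (auto intro!: derivative_eq_intros)
    also have "(of_real pi * (- S * of_real pi)) * S - of_real pi * C * (C * of_real pi) = - (of_real pi ^ 2 * (S ^ 2 + C ^ 2))"
      by (simp add: power2_eq_square algebra_simps)
    also have "S ^ 2 + C ^ 2 = 1" unfolding S_def C_def by simp
    also have "- (of_real pi ^ 2 * 1) / (S * S) = - ((of_real pi / S) ^ 2)"
      by (simp add: power2_eq_square)
    finally show "((\<lambda>w. of_real pi * cos (of_real pi * w) / sin (of_real pi * w)) has_field_derivative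
        (- ((of_real pi / sin (of_real pi * z)) ^ 2))) (at z)"
      unfolding S_def .
  qed
  ultimately have "- Polygamma 1 (1 - z) - Polygamma 1 z = - ((of_real pi / sin (of_real pi * z)) ^ 2)"
    by (rule DERIV_unique)
  moreover have "Polygamma 1 z + Polygamma 1 (1 - z) = - (- Polygamma 1 (1 - z) - Polygamma 1 z)" by simp
  ultimately show ?thesis by simp
qed

text \<open>Partial fractions of (pi / sin (pi z))^2 at z = i y. The terms for m and -m are complex
  conjugates; the term for m = 0 has moved to the right as 1 / y^2.\<close>

lemma inverse_sinh_square_pfd:
  fixes y :: real
  assumes y: "y > 0"
  shows "(\<lambda>m. 2 * Re (1 / Complex (real (Suc m)) y ^ 2)) sums
    (1 / y ^ 2 - 4 * pi ^ 2 * (exp (- 2 * pi * y) / (1 - exp (- 2 * pi * y)) ^ 2))"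
proof -
  define z where "z = Complex 0 y"
  have zI: "z \<notin> \<int>" using y by (auto simp: z_def Ints_def complex_eq_iff)
  have z0: "z \<noteq> 0" "1 - z \<noteq> 0" using y by (auto simp: z_def complex_eq_iff)
  have P: "Polygamma 1 w = (\<Sum>k. inverse ((w + of_nat k) ^ 2))" for w :: complex
    by (simp add: Polygamma_def numeral_2_eq_2)
  have s1: "summable (\<lambda>k. inverse ((z + of_nat k) ^ 2))" and s2: "summable (\<lambda>k. inverse (((1 - z) + of_nat k) ^ 2))"
    using z0 by (intro Polygamma_converges'; simp)+
  have "(\<lambda>k. inverse ((z + of_nat k) ^ 2)) sums Polygamma 1 z" "(\<lambda>k. inverse (((1 - z) + of_nat k) ^ 2)) sums Polygamma 1 (1 - z)"
    unfolding P using s1 s2 by (auto intro: summable_sums)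
  note S1 = this(1) and S2 = this(2)
  have "(\<lambda>k. inverse ((z + of_nat (Suc k)) ^ 2)) sums (Polygamma 1 z - inverse ((z + of_nat 0) ^ 2))"
    using sums_Suc_iff[of "\<lambda>k. inverse ((z + of_nat k) ^ 2)"] S1 by simp
  then have "(\<lambda>k. inverse ((z + of_nat (Suc k)) ^ 2)) sums (Polygamma 1 z - inverse (z ^ 2))" by (simp only: of_nat_0 add_0_right)
  from sums_add[OF this S2]
  have "(\<lambda>k. inverse ((z + of_nat (Suc k)) ^ 2) + inverse (((1 - z) + of_nat k) ^ 2)) sums
     ((Polygamma 1 z - inverse (z ^ 2)) + Polygamma 1 (1 - z))" .
  also have "(\<lambda>k. inverse ((z + of_nat (Suc k)) ^ 2) + inverse (((1 - z) + of_nat k) ^ 2)) =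
     (\<lambda>m. complex_of_real (2 * Re (1 / Complex (real (Suc m)) y ^ 2)))"
  proof
    fix k
    define c where "c = Complex (real (Suc k)) y"
    have "z + of_nat (Suc k) = c" "(1 - z) + of_nat k = cnj c"
      by (auto simp: z_def c_def complex_eq_iff)
    then have "inverse ((z + of_nat (Suc k)) ^ 2) + inverse (((1 - z) + of_nat k) ^ 2) = 1 / c ^ 2 + cnj (1 / c ^ 2)"
      by (simp add: inverse_eq_divide)
    also have "\<dots> = complex_of_real (2 * Re (1 / c ^ 2))" by (rule complex_add_cnj)
    finally show "inverse ((z + of_nat (Suc k)) ^ 2) + inverse (((1 - z) + of_nat k) ^ 2) = complex_of_real (2 * Re (1 / Complex (real (Suc k)) y ^ 2))"
      unfolding c_def .
  qed
  also have "(Polygamma 1 z - inverse (z ^ 2)) + Polygamma 1 (1 - z) =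
     complex_of_real (1 / y ^ 2 - 4 * pi ^ 2 * (exp (- 2 * pi * y) / (1 - exp (- 2 * pi * y)) ^ 2))"
  proof -
    have zi: "z = \<i> * of_real y" by (simp add: z_def complex_eq_iff)
    define u where "u = exp (- pi * y)"
    have u: "u > 0" "u < 1" "u ^ 2 = exp (- 2 * pi * y)"
      using y by (auto simp: u_def simp flip: exp_double)
    have u1: "1 - u ^ 2 \<noteq> 0" using u by (auto simp: power2_eq_1_iff)
    have "sin (of_real pi * z) = (exp (\<i> * (of_real pi * z)) - exp (- (\<i> * (of_real pi * z)))) / (2 * \<i>)"
      by (simp add: sin_exp_eq)
    also have "\<i> * (of_real pi * z) = of_real (- pi * y)" by (simp add: zi complex_eq_iff)
    also have "exp (complex_of_real (- pi * y)) = of_real u" unfolding u_def by (metis exp_of_real)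
    also have "exp (- complex_of_real (- pi * y)) = of_real (1 / u)"
    proof -
      have "- complex_of_real (- pi * y) = of_real (pi * y)" by simp
      moreover have "exp (pi * y) = 1 / u" unfolding u_def by (simp add: exp_minus inverse_eq_divide)
      ultimately show ?thesis by (simp only: exp_of_real)
    qed
    finally have "sin (of_real pi * z) ^ 2 = - (of_real (u - 1 / u) ^ 2 / 4)"
      by (simp add: power_divide power_mult_distrib)
    also have "\<dots> = of_real (- ((1 - u ^ 2) ^ 2 / (4 * u ^ 2)))"
    proof -
      have "(u - 1 / u) ^ 2 = (1 - u ^ 2) ^ 2 / u ^ 2" using u by (simp add: field_simps power2_eq_square)
      then have "- ((u - 1 / u) ^ 2 / 4) = - ((1 - u ^ 2) ^ 2 / (4 * u ^ 2))" by simp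
      moreover have "- (complex_of_real (u - 1 / u) ^ 2 / 4) = of_real (- ((u - 1 / u) ^ 2 / 4))" by simp
      ultimately show ?thesis by (simp only:)
    qed
    finally have "(of_real pi / sin (of_real pi * z)) ^ 2 = complex_of_real (- (4 * pi ^ 2 * (u ^ 2 / (1 - u ^ 2) ^ 2)))"
      using u by (simp add: power_divide)
    moreover have "inverse (z ^ 2) = of_real (- (1 / y ^ 2))"
      by (simp add: zi power_mult_distrib inverse_eq_divide)
    moreover have "(Polygamma 1 z - inverse (z ^ 2)) + Polygamma 1 (1 - z) = (of_real pi / sin (of_real pi * z)) ^ 2 - inverse (z ^ 2)"
      using Polygamma_1_reflection[OF zI] by (simp add: algebra_simps)
    ultimately show ?thesis unfolding u(3) by simp
  qed
  finally show ?thesis by (simp only: sums_of_real_iff)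
qed

lemma sigma_series_alt_sums:
  assumes "0 < q" "q < 1"
  shows "(\<lambda>j. q ^ Suc j / (1 - q ^ Suc j) ^ 2) sums sigma_series q"
proof -
  have "summable (\<lambda>j. complex_of_real q * of_real q ^ j / (1 - of_real q * of_real q ^ j) ^ 2)"
    by (rule summable_norm_cancel, rule abs_summable_double_pole_sum) (use assms in simp)
  then have "(\<lambda>j. complex_of_real q * of_real q ^ j / (1 - of_real q * of_real q ^ j) ^ 2) sums double_pole_sum q q"
    unfolding double_pole_sum_def by (rule summable_sums)
  then have "(\<lambda>j. complex_of_real (q ^ Suc j / (1 - q ^ Suc j) ^ 2)) sums of_real (sigma_series q)"
    using sigma_series_sums(2)[of q] assms by simp
  then show ?thesis by (simp only: sums_of_real_iff)
qed

text \<open>Comparison with the integral of 2 M / (M^2 + (t x)^2), whose antiderivative in t is (2 /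
  x) arctan (t x / M). The lower bound loses the interval from 0 to 1, an error that tends to 0 as M
  grows.\<close>

lemma lorentz_sum:
  fixes M x :: real
  assumes M: "M > 0" and x: "x > 0"
  shows "summable (\<lambda>n. 2 * M / (M ^ 2 + (real (Suc n) * x) ^ 2))"
    "(\<Sum>n. 2 * M / (M ^ 2 + (real (Suc n) * x) ^ 2)) \<le> pi / x"
    "(\<Sum>n. 2 * M / (M ^ 2 + (real (Suc n) * x) ^ 2)) \<ge> pi / x - 2 / x * arctan (x / M)"
proof -
  define g where "g = (\<lambda>n::nat. 2 / x * arctan (real n * (x / M)))"
  define f where "f = (\<lambda>n. 2 * M / (M ^ 2 + (real n * x) ^ 2))"
  have xM: "x / M > 0" using assms by simp
  have lim: "g \<longlonglongrightarrow> 2 / x * (pi / 2)"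
  proof -
    have "filterlim (\<lambda>n. real n * (x / M)) at_top sequentially"
      by (rule filterlim_at_top_mult_tendsto_pos[OF tendsto_const xM filterlim_real_sequentially])
    then have "(\<lambda>n. arctan (real n * (x / M))) \<longlonglongrightarrow> pi / 2"
      by (rule filterlim_compose[OF tendsto_arctan_at_top])
    then show ?thesis unfolding g_def by (intro tendsto_intros)
  qed
  have fx: "f n = 2 / M / (1 + (real n * (x / M)) ^ 2)" for n
    using assms by (simp add: f_def field_simps power2_eq_square)
  have mvt: "\<exists>t. real n * (x / M) < t \<and> t < real (Suc n) * (x / M) \<and> g (Suc n) - g n = 2 / M / (1 + t ^ 2)" for n
  proof -
    have lt: "real n * (x / M) < real (Suc n) * (x / M)" using xM by (simp add: algebra_simps)
    from MVT2[OF lt, of arctan "\<lambda>t. inverse (1 + t ^ 2)"] obtain t where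
      t: "real n * (x / M) < t" "t < real (Suc n) * (x / M)"
        "arctan (real (Suc n) * (x / M)) - arctan (real n * (x / M)) = (real (Suc n) * (x / M) - real n * (x / M)) * inverse (1 + t ^ 2)"
      using DERIV_arctan by blast
    have "g (Suc n) - g n = 2 / x * (arctan (real (Suc n) * (x / M)) - arctan (real n * (x / M)))"
      unfolding g_def by (simp only: right_diff_distrib)
    also have "\<dots> = 2 / x * ((x / M) * inverse (1 + t ^ 2))"
      unfolding t(3) by (simp add: algebra_simps)
    also have "\<dots> = 2 / M / (1 + t ^ 2)" using assms by (simp add: divide_inverse)
    finally show ?thesis using t by blast
  qed
  have den: "1 + t ^ 2 > 0" for t :: real by (simp add: add_pos_nonneg)
  have upper: "f (Suc n) \<le> g (Suc n) - g n" for n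
  proof -
    obtain t where t: "real n * (x / M) < t" "t < real (Suc n) * (x / M)" "g (Suc n) - g n = 2 / M / (1 + t ^ 2)"
      using mvt by blast
    have "0 \<le> t" using t(1) xM by (smt (verit) mult_nonneg_nonneg of_nat_0_le_iff)
    then have "t ^ 2 \<le> (real (Suc n) * (x / M)) ^ 2" using t(2) by (intro power_mono) auto
    then show ?thesis unfolding fx t(3) using M by (intro divide_left_mono mult_pos_pos den) simp_all
  qed
  have lower: "g (Suc n) - g n \<le> f n" for n
  proof -
    obtain t where t: "real n * (x / M) < t" "t < real (Suc n) * (x / M)" "g (Suc n) - g n = 2 / M / (1 + t ^ 2)"
      using mvt by blast
    have "0 \<le> real n * (x / M)" using xM by (intro mult_nonneg_nonneg) auto
    then have "(real n * (x / M)) ^ 2 \<le> t ^ 2" using t(1) by (intro power_mono) auto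
    then show ?thesis unfolding fx t(3) using M by (intro divide_left_mono mult_pos_pos den) simp_all
  qed
  have tel: "(\<lambda>n. g (Suc n) - g n) sums (2 / x * (pi / 2) - g 0)" by (rule telescope_sums[OF lim])
  have tel': "(\<lambda>n. g (Suc (Suc n)) - g (Suc n)) sums (2 / x * (pi / 2) - g 1)"
    using telescope_sums[OF LIMSEQ_Suc[OF lim]] by simp
  have f0: "f n \<ge> 0" for n using M by (simp add: f_def)
  have sf: "summable (\<lambda>n. f (Suc n))"
    by (rule summable_comparison_test'[OF sums_summable[OF tel], of 0]) (use upper f0 in auto)
  then show "summable (\<lambda>n. 2 * M / (M ^ 2 + (real (Suc n) * x) ^ 2))" unfolding f_def .
  have "(\<Sum>n. f (Suc n)) \<le> 2 / x * (pi / 2) - g 0"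
    using suminf_le[OF upper sf sums_summable[OF tel]] sums_unique[OF tel] by simp
  then show "(\<Sum>n. 2 * M / (M ^ 2 + (real (Suc n) * x) ^ 2)) \<le> pi / x" unfolding f_def g_def by simp
  have "2 / x * (pi / 2) - g 1 \<le> (\<Sum>n. f (Suc n))"
    using suminf_le[OF lower sums_summable[OF tel'] sf] sums_unique[OF tel'] by simp
  then show "(\<Sum>n. 2 * M / (M ^ 2 + (real (Suc n) * x) ^ 2)) \<ge> pi / x - 2 / x * arctan (x / M)" unfolding f_def g_def by simp
qed

text \<open>Eisenstein's argument. The lattice terms \<open>a\<close> are not absolutely summable,
  but \<open>a - b\<close> with the telescoping \<open>b\<close> is. Summing \<open>D\<close> by
  rows and by columns gives the two Lambert series; the telescoping parts differ by pi / x, the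
  source of the non-modular term 1 / (4 pi x).\<close>

lemma sigma_series_transformation:
  fixes x :: real
  assumes x: "x > 0"
  shows "sigma_series (exp (- 2 * pi * x)) + sigma_series (exp (- 2 * pi * (1 / x))) / x ^ 2 = (1 + 1 / x ^ 2) / 24 - 1 / (4 * pi * x)"
proof -
  define z where "z = (\<lambda>n m. Complex (real (Suc m)) (real (Suc n) * x))"
  define a where "a = (\<lambda>n m. 2 * Re (1 / z n m ^ 2))"
  define b where "b = (\<lambda>n m. 2 * Re (1 / z n m - 1 / (z n m + 1)))"
  define cf where "cf = (\<lambda>M n. 2 * M / (M ^ 2 + (real (Suc n) * x) ^ 2))"
  define c where "c = (\<lambda>M. \<Sum>n. cf M n)"
  define D where "D = (\<lambda>(n, m). a n m - b n m)"
  define T where "T = (\<lambda>t. exp (- 2 * pi * t) / (1 - exp (- 2 * pi * t)) ^ 2)"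
  have z0: "z n m \<noteq> 0" "z n m + 1 \<noteq> 0" for n m by (auto simp: z_def complex_eq_iff)
  have Rez: "2 * Re (1 / z n m) = cf (real (Suc m)) n" for n m
    by (simp add: z_def cf_def Re_divide)
  have z1: "z n m + 1 = z n (Suc m)" for n m by (simp add: z_def complex_eq_iff)
  have bcf: "b n m = cf (real (Suc m)) n - cf (real (Suc (Suc m))) n" for n m
    unfolding b_def z1 Rez[symmetric] by simp
  \<comment> \<open>By this inequality of arithmetic and geometric means the bound for |z|^(-3) is a
    function of n times a function of m, each with exponent -3/2 and hence summable.\<close>
  have nz: "norm (z n m) ^ 2 \<ge> 2 * x * (real (Suc n) * real (Suc m))" for n m
  proof -
    have "norm (z n m) ^ 2 = real (Suc m) ^ 2 + (real (Suc n) * x) ^ 2"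
      by (simp add: z_def cmod_power2)
    moreover have "2 * x * (N * M) \<le> M ^ 2 + (N * x) ^ 2" for N M :: real
      using zero_le_power2[of "M - N * x"] by (simp add: power2_diff algebra_simps)
    ultimately show ?thesis by simp
  qed
  define g where "g = (\<lambda>n. real (Suc n) powr (- 3 / 2))"
  have Dbound: "norm (D (n, m)) \<le> 2 * (2 * x) powr (- 3 / 2) * (g n * g m)" for n m
  proof -
    have "1 / z n m ^ 2 - (1 / z n m - 1 / (z n m + 1)) = 1 / (z n m ^ 2 * (z n m + 1))"
    proof -
      have "1 / w ^ 2 - (1 / w - 1 / (w + 1)) = 1 / (w ^ 2 * (w + 1))" if "w \<noteq> 0" "w + 1 \<noteq> 0" for w :: complex
      proof -
        have "1 / w - 1 / (w + 1) = w / (w ^ 2 * (w + 1))" "1 / w ^ 2 = (w + 1) / (w ^ 2 * (w + 1))"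
          using that by (simp_all add: divide_simps power2_eq_square)
        then have "1 / w ^ 2 - (1 / w - 1 / (w + 1)) = (w + 1) / (w ^ 2 * (w + 1)) - w / (w ^ 2 * (w + 1))" by (simp only:)
        also have "\<dots> = 1 / (w ^ 2 * (w + 1))" unfolding diff_divide_distrib[symmetric] by simp
        finally show ?thesis .
      qed
      then show ?thesis using z0 by blast
    qed
    moreover have "D (n, m) = 2 * Re (1 / z n m ^ 2 - (1 / z n m - 1 / (z n m + 1)))"
      by (simp add: D_def a_def b_def)
    ultimately have "D (n, m) = 2 * Re (1 / (z n m ^ 2 * (z n m + 1)))" by simp
    then have "norm (D (n, m)) \<le> 2 * norm (1 / (z n m ^ 2 * (z n m + 1)))"
      using abs_Re_le_cmod[of "1 / (z n m ^ 2 * (z n m + 1))"] by simp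
    also have "norm (1 / (z n m ^ 2 * (z n m + 1))) = 1 / (norm (z n m) ^ 2 * norm (z n m + 1))"
      by (simp add: norm_divide norm_mult norm_power)
    also have "\<dots> \<le> 1 / (norm (z n m) ^ 2 * norm (z n m))"
    proof -
      have "norm (z n m) ^ 2 \<le> norm (z n m + 1) ^ 2"
        unfolding cmod_power2 by (simp add: z_def)
      then have "norm (z n m) \<le> norm (z n m + 1)" by (rule power2_le_imp_le) simp
      then show ?thesis using z0[of n m] by (intro divide_left_mono mult_left_mono mult_pos_pos) auto
    qed
    also have "\<dots> = (norm (z n m) ^ 2) powr (- 3 / 2)"
    proof -
      have "(norm (z n m) ^ 2) powr (- 3 / 2) = norm (z n m) powr (- 3)"
        using z0[of n m] by (simp add: powr_powr flip: powr_numeral)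
      also have "\<dots> = 1 / norm (z n m) ^ 3"
        using z0[of n m] by (simp add: powr_minus_divide)
      finally show ?thesis by (simp add: power3_eq_cube power2_eq_square)
    qed
    also have "\<dots> \<le> (2 * x * (real (Suc n) * real (Suc m))) powr (- 3 / 2)"
      using nz[of m n] nz[of n m] x by (intro powr_mono2') auto
    also have "\<dots> = (2 * x) powr (- 3 / 2) * (g n * g m)"
      unfolding g_def using x by (simp add: powr_mult)
    finally show ?thesis by simp
  qed
  have gsum: "summable g"
  proof -
    have "summable (\<lambda>n. real n powr (- 3 / 2))" by (simp add: summable_real_powr_iff)
    then show ?thesis unfolding g_def by (subst summable_Suc_iff)
  qed
  have g0: "g n \<ge> 0" for n by (simp add: g_def)
  have Dabs: "(\<lambda>p. norm (D p)) summable_on UNIV \<times> UNIV"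
  proof (rule Infinite_Sum.abs_summable_on_comparison_test')
    have gs: "(\<lambda>n. norm (complex_of_real (g n))) summable_on UNIV"
      using gsum g0 by (intro summable_nonneg_imp_summable_on) auto
    obtain G where G: "((\<lambda>n. complex_of_real (g n)) has_sum G) UNIV"
      using abs_summable_summable[OF gs] by (auto simp: summable_on_def)
    have "(\<lambda>(n, m). complex_of_real (g n) * complex_of_real (g m)) summable_on UNIV \<times> UNIV"
      using has_sum_product[OF G G gs gs] by (rule has_sum_imp_summable)
    then have "(\<lambda>p. norm (case p of (n, m) \<Rightarrow> complex_of_real (g n) * complex_of_real (g m))) summable_on UNIV \<times> UNIV"
      by (simp only: summable_on_iff_abs_summable_on_complex)
    then have "(\<lambda>(n, m). g n * g m) summable_on UNIV \<times> UNIV"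
      using g0 by (simp add: case_prod_unfold norm_mult)
    then show "(\<lambda>p. 2 * (2 * x) powr (- 3 / 2) * (case p of (n, m) \<Rightarrow> g n * g m)) summable_on UNIV \<times> UNIV"
      by (rule summable_on_cmult_right)
  qed (use Dbound in auto)
  then obtain S where S: "(D has_sum S) (UNIV \<times> UNIV)"
    using abs_summable_summable[OF Dabs] by (auto simp: summable_on_def)
  have Drow: "(\<lambda>m. D (n, m)) summable_on UNIV" for n
    using summable_on_SigmaD1[of "\<lambda>n m. D (n, m)" UNIV "\<lambda>_. UNIV" n] has_sum_imp_summable[OF S] by simp
  have Ssw: "((\<lambda>(m, n). D (n, m)) has_sum S) (UNIV \<times> UNIV)"
    using has_sum_swap[of D UNIV UNIV S] S by (simp add: case_prod_unfold)
  have Dcol: "(\<lambda>n. D (n, m)) summable_on UNIV" for m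
    using summable_on_SigmaD1[of "\<lambda>m n. D (n, m)" UNIV "\<lambda>_. UNIV" m] has_sum_imp_summable[OF Ssw] by simp
  have has_sumI: "(f has_sum s) UNIV" if "f summable_on UNIV" "f sums s" for f :: "nat \<Rightarrow> real" and s
    using has_sum_infsum[OF that(1)] sums_unique2[OF has_sum_imp_sums[OF has_sum_infsum[OF that(1)]] that(2)] by simp
  have tof: "exp (- 2 * pi * (real (Suc n) * t)) = exp (- 2 * pi * t) ^ Suc n" for n t
    by (subst exp_of_nat_mult[symmetric]) (simp only: mult_ac)
  define A where "A = (\<lambda>n. 1 / (real (Suc n) * x) ^ 2 - 4 * pi ^ 2 * T (real (Suc n) * x))"
  have A: "(\<lambda>m. a n m) sums A n" for n
    unfolding a_def z_def A_def T_def using x by (intro inverse_sinh_square_pfd) auto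
  have cfpos: "0 \<le> cf M n" if "M > 0" for M n using that by (simp add: cf_def)
  have cf0: "(\<lambda>m. cf (real (Suc m)) n) \<longlonglongrightarrow> 0" for n
  proof (rule tendsto_sandwich[of "\<lambda>_. 0" _ _ "\<lambda>m. 2 / real (Suc m)"])
    show "eventually (\<lambda>m. cf (real (Suc m)) n \<le> 2 / real (Suc m)) sequentially"
    proof (intro always_eventually allI)
      fix m
      have "cf M n \<le> 2 / M" if "M > 0" for M
      proof -
        have "2 * M / (M ^ 2 + (real (Suc n) * x) ^ 2) \<le> 2 * M / M ^ 2"
          using that by (intro divide_left_mono mult_pos_pos add_pos_nonneg) auto
        then show ?thesis using that by (simp add: cf_def power2_eq_square)
      qed
      then show "cf (real (Suc m)) n \<le> 2 / real (Suc m)" by simp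
    qed
    show "(\<lambda>m. 2 / real (Suc m)) \<longlonglongrightarrow> 0"
      using tendsto_mult[OF tendsto_const[of 2] LIMSEQ_inverse_real_of_nat] by (simp add: divide_inverse)
  qed (use cfpos in auto)
  have B: "(\<lambda>m. b n m) sums cf 1 n" for n
    unfolding bcf using telescope_sums'[OF cf0[of n]] by simp
  have rows: "((\<lambda>n. A n - cf 1 n) has_sum S) UNIV"
  proof (rule has_sum_Sigma'[OF S])
    fix n
    have "(\<lambda>m. D (n, m)) sums (A n - cf 1 n)"
      unfolding D_def using sums_diff[OF A B] by simp
    then show "((\<lambda>m. D (n, m)) has_sum (A n - cf 1 n)) UNIV" using has_sumI[OF Drow] by blast
  qed
  define \<alpha> where "\<alpha> = pi ^ 2 / 6 / x ^ 2 - 4 * pi ^ 2 * sigma_series (exp (- 2 * pi * x))"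
  have pfsum: "(\<lambda>n. T (real (Suc n) * t)) sums sigma_series (exp (- 2 * pi * t))" if "t > 0" for t
    unfolding T_def tof using that by (intro sigma_series_alt_sums) auto
  have sq: "(\<lambda>n. 1 / real (Suc n) ^ 2) sums (pi ^ 2 / 6)"
    using inverse_squares_sums by simp
  have As: "A sums \<alpha>"
  proof -
    have "(\<lambda>n. 1 / real (Suc n) ^ 2 / x ^ 2 - 4 * pi ^ 2 * T (real (Suc n) * x)) sums \<alpha>"
      unfolding \<alpha>_def by (intro sums_diff sums_divide sums_mult sq pfsum x)
    then show ?thesis unfolding A_def by (simp add: power_mult_distrib)
  qed
  have Cs: "cf 1 sums c 1"
    unfolding c_def using lorentz_sum(1)[of 1 x] x by (intro summable_sums) (simp add: cf_def)
  have S1: "S = \<alpha> - c 1"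
    by (rule sums_unique2[OF has_sum_imp_sums[OF rows] sums_diff[OF As Cs]])
  \<comment> \<open>Column sums: z n m is i x times the conjugate of (n + 1) + i (m + 1) / x, so the
    same partial fractions apply with 1 / x for x and with reversed sign.\<close>
  define A' where "A' = (\<lambda>m. - (1 / real (Suc m) ^ 2) + 4 * pi ^ 2 / x ^ 2 * T (real (Suc m) * (1 / x)))"
  have A': "(\<lambda>n. a n m) sums A' m" for m
  proof -
    define y where "y = real (Suc m) * (1 / x)"
    have y: "y > 0" using x by (simp add: y_def)
    have "(\<lambda>n. - (1 / x ^ 2) * (2 * Re (1 / Complex (real (Suc n)) y ^ 2))) sums (- (1 / x ^ 2) * (1 / y ^ 2 - 4 * pi ^ 2 * T y))"
      unfolding T_def by (intro sums_mult inverse_sinh_square_pfd y)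
    moreover have "- (1 / x ^ 2) * (2 * Re (1 / Complex (real (Suc n)) y ^ 2)) = a n m" for n
    proof -
      define v where "v = Complex (real (Suc n)) y"
      have "z n m = \<i> * of_real x * cnj v" using x by (simp add: z_def v_def y_def complex_eq_iff)
      then have "1 / z n m ^ 2 = - (1 / of_real (x ^ 2)) * cnj (1 / v ^ 2)"
        by (simp add: power_mult_distrib)
      also have "\<dots> = of_real (- (1 / x ^ 2)) * cnj (1 / v ^ 2)" by simp
      finally have e: "1 / z n m ^ 2 = of_real (- (1 / x ^ 2)) * cnj (1 / v ^ 2)" .
      have "Re (of_real s * cnj t) = s * Re t" for s t by simp
      then have "Re (1 / z n m ^ 2) = - (1 / x ^ 2) * Re (1 / v ^ 2)" unfolding e .
      then show ?thesis unfolding a_def v_def by simp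
    qed
    moreover have "- (1 / x ^ 2) * (1 / y ^ 2 - 4 * pi ^ 2 * T y) = A' m"
    proof -
      have "x ^ 2 * y ^ 2 = real (Suc m) ^ 2" using x by (simp add: y_def flip: power_mult_distrib)
      then have "1 / x ^ 2 * (1 / y ^ 2) = 1 / real (Suc m) ^ 2" by simp
      then show ?thesis unfolding A'_def y_def[symmetric] by (simp add: algebra_simps)
    qed
    ultimately show ?thesis by simp
  qed
  have cs: "cf M sums c M" if "M > 0" for M
    unfolding c_def using lorentz_sum(1)[OF that x] by (intro summable_sums) (simp add: cf_def)
  have B': "(\<lambda>n. b n m) sums (c (real (Suc m)) - c (real (Suc (Suc m))))" for m
    unfolding bcf by (intro sums_diff cs) auto
  have cols: "((\<lambda>m. A' m - (c (real (Suc m)) - c (real (Suc (Suc m))))) has_sum S) UNIV"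
  proof (rule has_sum_Sigma'[OF Ssw])
    fix m
    have "(\<lambda>n. D (n, m)) sums (A' m - (c (real (Suc m)) - c (real (Suc (Suc m)))))"
      unfolding D_def using sums_diff[OF A' B'] by simp
    then show "((\<lambda>n. case (m, n) of (m, n) \<Rightarrow> D (n, m)) has_sum (A' m - (c (real (Suc m)) - c (real (Suc (Suc m)))))) UNIV"
      using has_sumI[OF Dcol] by simp
  qed
  define \<alpha>' where "\<alpha>' = - (pi ^ 2 / 6) + 4 * pi ^ 2 / x ^ 2 * sigma_series (exp (- 2 * pi * (1 / x)))"
  have As': "A' sums \<alpha>'"
    unfolding A'_def \<alpha>'_def using x by (intro sums_add sums_mult sums_minus sq pfsum) auto
  \<comment> \<open>\<open>c M\<close> is a Riemann sum of an integral with value pi / x. This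
    nonzero limit is what the exchange of summations leaves behind; \<open>c 1\<close> occurs in
    both evaluations of \<open>S\<close> and cancels.\<close>
  have clim: "(\<lambda>m. c (real (Suc m))) \<longlonglongrightarrow> pi / x"
  proof (rule tendsto_sandwich[of "\<lambda>m. pi / x - 2 / x * arctan (x / real (Suc m))" _ _ "\<lambda>_. pi / x"])
    show "eventually (\<lambda>m. c (real (Suc m)) \<le> pi / x) sequentially"
      unfolding c_def cf_def using x by (intro always_eventually allI lorentz_sum(2)) auto
    show "eventually (\<lambda>m. pi / x - 2 / x * arctan (x / real (Suc m)) \<le> c (real (Suc m))) sequentially"
      unfolding c_def cf_def using x by (intro always_eventually allI lorentz_sum(3)) auto
    have "(\<lambda>m. x / real (Suc m)) \<longlonglongrightarrow> 0"
      using tendsto_mult[OF tendsto_const[of x] LIMSEQ_inverse_real_of_nat] by (simp add: divide_inverse)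
    then have "(\<lambda>m. pi / x - 2 / x * arctan (x / real (Suc m))) \<longlonglongrightarrow> pi / x - 2 / x * arctan 0"
      by (intro tendsto_intros)
    then show "(\<lambda>m. pi / x - 2 / x * arctan (x / real (Suc m))) \<longlonglongrightarrow> pi / x" by simp
  qed auto
  have Cs': "(\<lambda>m. c (real (Suc m)) - c (real (Suc (Suc m)))) sums (c 1 - pi / x)"
    using telescope_sums'[OF clim] by simp
  have "S = \<alpha>' - (c 1 - pi / x)"
    by (rule sums_unique2[OF has_sum_imp_sums[OF cols] sums_diff[OF As' Cs']])
  with S1 have "\<alpha> = \<alpha>' + pi / x" by simp
  then have "4 * pi ^ 2 * (sigma_series (exp (- 2 * pi * x)) + sigma_series (exp (- 2 * pi * (1 / x))) / x ^ 2) = pi ^ 2 / 6 * (1 + 1 / x ^ 2) - pi / x"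
    unfolding \<alpha>_def \<alpha>'_def by (simp add: algebra_simps add_divide_distrib)
  then have "sigma_series (exp (- 2 * pi * x)) + sigma_series (exp (- 2 * pi * (1 / x))) / x ^ 2 = (pi ^ 2 / 6 * (1 + 1 / x ^ 2) - pi / x) / (4 * pi ^ 2)"
    by (intro eq_divide_of_mult) auto
  also have "\<dots> = (1 + 1 / x ^ 2) / 24 - 1 / (4 * pi * x)"
    using x by (simp add: diff_divide_distrib power2_eq_square)
  finally show ?thesis .
qed

text \<open>Dedekind's eta function on the imaginary axis, at the point i x.\<close>

definition eta :: "real \<Rightarrow> real" where
  "eta x = exp (- pi * x / 12) * euler_E (exp (- 2 * pi * x))"

lemma eta_pos: "x > 0 \<Longrightarrow> eta x > 0"
  unfolding eta_def by (intro mult_pos_pos euler_E_pos) auto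

text \<open>The logarithmic derivative of the quotient of both sides vanishes by
  \<open>sigma_series_transformation\<close>; the fixed point x = 1 determines the constant.\<close>

theorem eta_transformation:
  assumes x: "x > 0"
  shows "eta (1 / x) = sqrt x * eta x"
proof -
  define F where "F = (\<lambda>x. - pi * x / 12 + ln (euler_E (exp (- 2 * pi * x))))"
  define h where "h = (\<lambda>x. ln x / 2 + F x - F (1 / x))"
  have E: "euler_E (exp (- 2 * pi * y)) > 0" if "y > 0" for y using that by (intro euler_E_pos) auto
  have Feta: "F y = ln (eta y)" if "y > 0" for y
    unfolding F_def eta_def using E[OF that] by (simp add: ln_mult)
  have dF: "(F has_real_derivative (- pi / 12 + 2 * pi * sigma_series (exp (- 2 * pi * y)))) (at y)" if "y > 0" for y
  proof -
    let ?q = "exp (- 2 * pi * y)"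
    have "(euler_E has_real_derivative (- euler_E ?q * sigma_series ?q / ?q)) (at ?q)"
      using that by (intro euler_E_deriv) auto
    then have "((\<lambda>y. euler_E (exp (- 2 * pi * y))) has_real_derivative (- euler_E ?q * sigma_series ?q / ?q * (?q * (- 2 * pi)))) (at y)"
      by (rule DERIV_chain2) (auto intro!: derivative_eq_intros)
    also have "- euler_E ?q * sigma_series ?q / ?q * (?q * (- 2 * pi)) = euler_E ?q * (2 * pi * sigma_series ?q)" by simp
    finally have "((\<lambda>y. ln (euler_E (exp (- 2 * pi * y)))) has_real_derivative (euler_E ?q * (2 * pi * sigma_series ?q) / euler_E ?q)) (at y)"
      using E[OF that] by (auto intro!: derivative_eq_intros)
    also have "euler_E ?q * (2 * pi * sigma_series ?q) / euler_E ?q = 2 * pi * sigma_series ?q"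
      using E[OF that] by (intro nonzero_mult_div_cancel_left) simp
    finally have G: "((\<lambda>y. ln (euler_E (exp (- 2 * pi * y)))) has_real_derivative (2 * pi * sigma_series ?q)) (at y)" .
    have "((\<lambda>x. - pi * x / 12) has_real_derivative (- pi / 12)) (at y)"
      by (auto intro!: derivative_eq_intros)
    from DERIV_add[OF this G] show ?thesis unfolding F_def .
  qed
  have dh: "(h has_real_derivative 0) (at y)" if y0: "y > 0" for y
  proof -
    have "((\<lambda>y. F (1 / y)) has_real_derivative ((- pi / 12 + 2 * pi * sigma_series (exp (- 2 * pi * (1 / y)))) * (- 1 / y ^ 2))) (at y)"
      by (rule DERIV_chain2[OF dF]) (use y0 in \<open>auto intro!: derivative_eq_intros simp: power2_eq_square\<close>)
    note dF' = this
    have "((\<lambda>y. ln y / 2) has_real_derivative (1 / y / 2)) (at y)"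
      using y0 by (auto intro!: derivative_eq_intros)
    from DERIV_diff[OF DERIV_add[OF this dF[OF y0]] dF']
    have "(h has_real_derivative (1 / y / 2 + (- pi / 12 + 2 * pi * sigma_series (exp (- 2 * pi * y)))
        - (- pi / 12 + 2 * pi * sigma_series (exp (- 2 * pi * (1 / y)))) * (- 1 / y ^ 2))) (at y)"
      unfolding h_def .
    moreover have "1 / y / 2 + (- pi / 12 + 2 * pi * l) - (- pi / 12 + 2 * pi * l') * (- 1 / y ^ 2) = 0"
      if "l + l' / y ^ 2 = (1 + 1 / y ^ 2) / 24 - 1 / (4 * pi * y)" for l l'
    proof -
      have "1 / y / 2 + (- pi / 12 + 2 * pi * l) - (- pi / 12 + 2 * pi * l') * (- 1 / y ^ 2) =
        1 / (2 * y) - pi / 12 * (1 + 1 / y ^ 2) + 2 * pi * (l + l' / y ^ 2)"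
        using y0 by (simp add: field_simps)
      also have "\<dots> = 0" unfolding that using y0 by (simp add: field_simps)
      finally show ?thesis .
    qed
    ultimately show ?thesis using sigma_series_transformation[OF y0] by metis
  qed
  have "\<exists>c. \<forall>y\<in>{0<..}. h y = c"
    by (rule has_field_derivative_zero_constant) (auto intro: has_field_derivative_at_within dh)
  then have "h x = h 1" using x by auto
  also have "h 1 = 0" by (simp add: h_def)
  finally have "ln x / 2 + ln (eta x) - ln (eta (1 / x)) = 0"
    unfolding h_def using Feta x by simp
  moreover have "ln (sqrt x * eta x) = ln x / 2 + ln (eta x)"
    using x eta_pos[OF x] by (simp add: ln_mult ln_sqrt)
  ultimately have "ln (eta (1 / x)) = ln (sqrt x * eta x)" by simp
  then show ?thesis using x eta_pos[OF x] eta_pos[of "1 / x"] by (subst (asm) ln_inj_iff) auto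
qed

section \<open>Integrals and special values\<close>

text \<open>With w = exp (pi x / 12) the exponential factors are powers of w, and q = w^(-24) by
  \<open>eta_nome\<close>. Passing from Euler products to eta values then only requires counting
  exponents of w.\<close>

lemma euler_E_eta:
  assumes "x > 0" "k > 0"
  shows "euler_E (exp (- 2 * pi * x) ^ k) = exp (pi * x / 12) ^ k * eta (real k * x)"
proof -
  have "exp (- 2 * pi * x) ^ k = exp (- 2 * pi * (real k * x))"
    by (subst exp_of_nat_mult[symmetric]) (simp only: mult_ac)
  moreover have "exp (pi * x / 12) ^ k = exp (pi * (real k * x) / 12)"
    by (subst exp_of_nat_mult[symmetric]) (simp add: mult_ac)
  ultimately show ?thesis unfolding eta_def by (simp flip: exp_add)
qed

lemma eta_nome: "exp (- 2 * pi * x) = 1 / exp (pi * x / 12) ^ 24"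
  by (simp add: exp_minus inverse_eq_divide flip: exp_of_nat_mult)

lemma eta_transformation':
  assumes "y > 0" "x * y = 1"
  shows "eta x = sqrt y * eta y"
proof -
  have "x = 1 / y" using assms by (simp add: field_simps)
  then show ?thesis using eta_transformation[OF assms(1)] by simp
qed

text \<open>At 0 only continuity of the antiderivative is used: its derivative is computed from
  logarithmic derivatives, which contain 1 / t.\<close>

lemma has_integral_of_deriv:
  fixes f g :: "real \<Rightarrow> real"
  assumes "0 < q" "q < 1" "f 0 = 0"
    and "\<And>t. 0 \<le> t \<Longrightarrow> t < 1 \<Longrightarrow> isCont f t"
    and "\<And>t. 0 < t \<Longrightarrow> t < 1 \<Longrightarrow> (f has_real_derivative g t) (at t)"
  shows "(g has_integral f q) {0..q}"
proof -
  have "(g has_integral (f q - f 0)) {0..q}"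
  proof (rule fundamental_theorem_of_calculus_interior)
    show "continuous_on {0..q} f"
      using assms by (intro continuous_at_imp_continuous_on) auto
    show "(f has_vector_derivative g t) (at t)" if "t \<in> {0<..<q}" for t
      using assms that by (auto simp flip: has_real_derivative_iff_has_vector_derivative)
  qed (use assms in auto)
  then show ?thesis using assms by simp
qed

text \<open>Derivatives are kept as value times logarithmic derivative, so that for an eta quotient
  the second factor is assembled additively.\<close>

lemma dlog_mult:
  fixes f g :: "real \<Rightarrow> real"
  assumes "(f has_real_derivative f t * a) (at t)" "(g has_real_derivative g t * b) (at t)"
  shows "((\<lambda>t. f t * g t) has_real_derivative (f t * g t) * (a + b)) (at t)"
  using DERIV_mult[OF assms] by (simp add: algebra_simps)

lemma dlog_divide:
  fixes f g :: "real \<Rightarrow> real"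
  assumes "(f has_real_derivative f t * a) (at t)" "(g has_real_derivative g t * b) (at t)" "g t \<noteq> 0"
  shows "((\<lambda>t. f t / g t) has_real_derivative (f t / g t) * (a - b)) (at t)"
proof -
  have "(f t * a * g t - f t * (g t * b)) / (g t * g t) = (f t / g t) * (a - b)"
    using assms(3) by (simp add: field_simps)
  then show ?thesis using DERIV_divide[OF assms] by simp
qed

lemma dlog_power:
  fixes f :: "real \<Rightarrow> real"
  assumes "(f has_real_derivative f t * a) (at t)"
  shows "((\<lambda>t. f t ^ n) has_real_derivative (f t ^ n) * (real n * a)) (at t)"
proof (cases n)
  case (Suc m)
  then show ?thesis using DERIV_power[OF assms, of n] by (simp add: algebra_simps)
qed auto

lemma dlog_ident: "t \<noteq> 0 \<Longrightarrow> ((\<lambda>t. t) has_real_derivative t * (1 / t)) (at t)"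
  by simp

lemma euler_E_isCont:
  assumes "0 \<le> t" "t < 1"
  shows "isCont euler_E t" "k > 0 \<Longrightarrow> isCont (\<lambda>t. euler_E (t ^ k)) t"
    "euler_E t \<noteq> 0" "k > 0 \<Longrightarrow> euler_E (t ^ k) \<noteq> 0"
proof -
  show "isCont (\<lambda>t. euler_E (t ^ k)) t" if "k > 0" for k using euler_E_pow_cont that assms by auto
  from this[of 1] show "isCont euler_E t" by simp
  show "euler_E t \<noteq> 0" using euler_E_pos[of t] assms by auto
  show "euler_E (t ^ k) \<noteq> 0" if "k > 0" using euler_E_pos[of "t ^ k"] assms that by (auto simp: power_less_one_iff)
qed

section \<open>Differentiation of the antiderivatives\<close>

context
  fixes q :: real
  assumes q: "0 < q" "q < 1"
begin

lemma E_pos: "euler_E q > 0" "k > 0 \<Longrightarrow> euler_E (q ^ k) > 0"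
  using q by (auto intro!: euler_E_pos simp: power_less_one_iff)

lemma E_deriv: "(euler_E has_real_derivative (- euler_E q * (sigma_series q / q))) (at q)"
  using euler_E_deriv[of q] q by simp

lemmas E_pow_deriv = euler_E_pow_deriv[OF q]

text \<open>This is \<open>level6_relation_real\<close> at p = exp (-2 pi y) with y = 1 / (6 x): the
  eta values at y, 2 y, 3 y, 6 y become those at 6 x, 3 x, 2 x, x. The accompanying square roots
  leave the factors 8 and 8/9.\<close>

lemma level6_relation_fricke:
  "1 + q * euler_E q ^ 3 * euler_E (q ^ 6) ^ 9 / (euler_E (q ^ 2) ^ 3 * euler_E (q ^ 3) ^ 9) =
   euler_E (q ^ 2) ^ 5 * euler_E (q ^ 6) / (euler_E q * euler_E (q ^ 3) ^ 5)"
proof -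
  define x where "x = - ln q / (2 * pi)"
  have x: "x > 0" using q by (simp add: x_def divide_neg_pos)
  have qx: "q = exp (- 2 * pi * x)" using q by (simp add: x_def)
  define w where "w = exp (pi * x / 12)"
  have w: "w > 0" by (simp add: w_def)
  define y where "y = 1 / (6 * x)"
  have y: "y > 0" using x by (simp add: y_def)
  define v where "v = exp (pi * y / 12)"
  have v: "v > 0" by (simp add: v_def)
  define p where "p = exp (- 2 * pi * y)"
  have p: "0 < p" "p < 1" using y by (auto simp: p_def)
  define s a b where "s = sqrt x" and "a = sqrt 2" and "b = sqrt 3"
  have sab: "s > 0" "a > 0" "b > 0" "a ^ 2 = 2" "b ^ 2 = 3" using x by (auto simp: s_def a_def b_def)
  define e1 e2 e3 e6 where e: "e1 = eta x" "e2 = eta (2 * x)" "e3 = eta (3 * x)" "e6 = eta (6 * x)"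
  have epos: "e1 > 0" "e2 > 0" "e3 > 0" "e6 > 0" unfolding e using x by (auto intro!: eta_pos)
  have sq: "sqrt (6 * x) = a * b * s" "sqrt (3 * x) = b * s" "sqrt (2 * x) = a * s"
    unfolding s_def a_def b_def by (simp_all flip: real_sqrt_mult)
  have t1: "eta y = a * b * s * e6"
    unfolding sq(1)[symmetric] e by (rule eta_transformation') (use x in \<open>simp_all add: y_def\<close>)
  have t2: "eta (2 * y) = b * s * e3"
    unfolding sq(2)[symmetric] e by (rule eta_transformation') (use x in \<open>simp_all add: y_def\<close>)
  have t3: "eta (3 * y) = a * s * e2"
    unfolding sq(3)[symmetric] e by (rule eta_transformation') (use x in \<open>simp_all add: y_def\<close>)
  have t6: "eta (6 * y) = s * e1"
    unfolding s_def e by (rule eta_transformation') (use x in \<open>simp_all add: y_def\<close>)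
  have E1: "euler_E p = v * (a * b * s * e6)" and E2: "euler_E (p ^ 2) = v ^ 2 * (b * s * e3)"
    and E3: "euler_E (p ^ 3) = v ^ 3 * (a * s * e2)" and E6: "euler_E (p ^ 6) = v ^ 6 * (s * e1)"
    unfolding p_def v_def using euler_E_eta[OF y, of 1] euler_E_eta[OF y, of 2] euler_E_eta[OF y, of 3] euler_E_eta[OF y, of 6] t1 t2 t3 t6
    by simp_all
  have F1: "euler_E q = w * e1" and F2: "euler_E (q ^ 2) = w ^ 2 * e2"
    and F3: "euler_E (q ^ 3) = w ^ 3 * e3" and F6: "euler_E (q ^ 6) = w ^ 6 * e6" and F0: "q = 1 / w ^ 24"
    unfolding qx w_def e using euler_E_eta[OF x, of 1] euler_E_eta[OF x, of 2] euler_E_eta[OF x, of 3] euler_E_eta[OF x, of 6] eta_nome[of x]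
    by simp_all
  have L: "euler_E p ^ 9 * euler_E (p ^ 6) ^ 3 / (euler_E (p ^ 2) ^ 9 * euler_E (p ^ 3) ^ 3) = 8 * (e1 ^ 3 * e6 ^ 9 / (e2 ^ 3 * e3 ^ 9))"
  proof -
    have "euler_E p ^ 9 * euler_E (p ^ 6) ^ 3 / (euler_E (p ^ 2) ^ 9 * euler_E (p ^ 3) ^ 3) =
       (a ^ 9 / a ^ 3) * (v ^ 27 / v ^ 27) * (s ^ 12 / s ^ 12) * (b ^ 9 / b ^ 9) * (e1 ^ 3 * e6 ^ 9 / (e2 ^ 3 * e3 ^ 9))"
      unfolding E1 E2 E3 E6 using v sab epos by (simp add: power_mult_distrib flip: power_mult) (simp add: field_simps flip: power_add)
    moreover have "a ^ 9 / a ^ 3 = 8"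
    proof -
      have "a ^ 9 = (a ^ 2) ^ 3 * a ^ 3" by (simp flip: power_mult power_add)
      then show ?thesis unfolding sab(4) using sab by simp
    qed
    ultimately show ?thesis using v sab by simp
  qed
  have R: "euler_E p * euler_E (p ^ 3) ^ 5 / (euler_E (p ^ 2) ^ 5 * euler_E (p ^ 6)) = 8 / 9 * (e2 ^ 5 * e6 / (e1 * e3 ^ 5))"
  proof -
    have "euler_E p * euler_E (p ^ 3) ^ 5 / (euler_E (p ^ 2) ^ 5 * euler_E (p ^ 6)) =
       (a ^ 6 / 1) * (b / b ^ 5) * (v ^ 16 / v ^ 16) * (s ^ 6 / s ^ 6) * (e2 ^ 5 * e6 / (e1 * e3 ^ 5))"
      unfolding E1 E2 E3 E6 using v sab epos by (simp add: power_mult_distrib flip: power_mult) (simp add: field_simps eval_nat_numeral)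
    moreover have "a ^ 6 = 8" "b / b ^ 5 = 1 / 9"
    proof -
      have "a ^ 6 = (a ^ 2) ^ 3" by (simp flip: power_mult)
      then show "a ^ 6 = 8" unfolding sab(4) by simp
      have "b ^ 5 = b * (b ^ 2) ^ 2" by (simp flip: power_mult power_Suc)
      then show "b / b ^ 5 = 1 / 9" unfolding sab(5) using sab by simp
    qed
    ultimately show ?thesis using v sab by simp
  qed
  have "8 * (e1 ^ 3 * e6 ^ 9 / (e2 ^ 3 * e3 ^ 9)) + 8 = 9 * (8 / 9 * (e2 ^ 5 * e6 / (e1 * e3 ^ 5)))"
    using level6_relation_real[OF p] unfolding L R .
  moreover have "1 + P = Q" if "8 * P + 8 = 9 * (8 / 9 * Q)" for P Q :: real using that by simp
  ultimately have "1 + e1 ^ 3 * e6 ^ 9 / (e2 ^ 3 * e3 ^ 9) = e2 ^ 5 * e6 / (e1 * e3 ^ 5)" by blast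
  moreover have "q * euler_E q ^ 3 * euler_E (q ^ 6) ^ 9 / (euler_E (q ^ 2) ^ 3 * euler_E (q ^ 3) ^ 9) = e1 ^ 3 * e6 ^ 9 / (e2 ^ 3 * e3 ^ 9)"
  proof -
    have "q * euler_E q ^ 3 * euler_E (q ^ 6) ^ 9 / (euler_E (q ^ 2) ^ 3 * euler_E (q ^ 3) ^ 9) =
       (w ^ 57 / w ^ 57) * (e1 ^ 3 * e6 ^ 9 / (e2 ^ 3 * e3 ^ 9))"
      unfolding F1 F2 F3 F6 unfolding F0 using w epos by (simp add: power_mult_distrib flip: power_mult) (simp add: field_simps flip: power_add)
    then show ?thesis using w by simp
  qed
  moreover have "euler_E (q ^ 2) ^ 5 * euler_E (q ^ 6) / (euler_E q * euler_E (q ^ 3) ^ 5) = e2 ^ 5 * e6 / (e1 * e3 ^ 5)"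
  proof -
    have "euler_E (q ^ 2) ^ 5 * euler_E (q ^ 6) / (euler_E q * euler_E (q ^ 3) ^ 5) = (w ^ 16 / w ^ 16) * (e2 ^ 5 * e6 / (e1 * e3 ^ 5))"
      unfolding F1 F2 F3 F6 using w epos by (simp add: power_mult_distrib flip: power_mult) (simp add: field_simps eval_nat_numeral)
    then show ?thesis using w by simp
  qed
  ultimately show ?thesis by simp
qed

lemma E_pow_dlog: "k > 0 \<Longrightarrow> ((\<lambda>q. euler_E (q ^ k)) has_real_derivative euler_E (q ^ k) * - (real k * sigma_series (q ^ k) / q)) (at q)"
  using E_pow_deriv[of k] by simp

lemma E_dlog: "(euler_E has_real_derivative euler_E q * - (sigma_series q / q)) (at q)"
  using E_deriv by simp

lemma level6_f4_deriv:
  "((\<lambda>q. q * euler_E q ^ 3 * euler_E (q ^ 6) ^ 9 / (euler_E (q ^ 2) ^ 3 * euler_E (q ^ 3) ^ 9))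
     has_real_derivative euler_E q ^ 6 * euler_E (q ^ 6) ^ 8 / euler_E (q ^ 3) ^ 10) (at q)"
proof -
  let ?f = "q * euler_E q ^ 3 * euler_E (q ^ 6) ^ 9 / (euler_E (q ^ 2) ^ 3 * euler_E (q ^ 3) ^ 9)"
  let ?d = "1 / q + real 3 * - (sigma_series q / q) + real 9 * - (real 6 * sigma_series (q ^ 6) / q) -
        (real 3 * - (real 2 * sigma_series (q ^ 2) / q) + real 9 * - (real 3 * sigma_series (q ^ 3) / q))"
  have "((\<lambda>q. q * euler_E q ^ 3 * euler_E (q ^ 6) ^ 9 / (euler_E (q ^ 2) ^ 3 * euler_E (q ^ 3) ^ 9))
     has_real_derivative ?f * ?d) (at q)"
    by (intro dlog_divide dlog_mult dlog_power dlog_ident E_dlog E_pow_dlog) (use q E_pos in \<open>auto simp: less_imp_neq[symmetric]\<close>)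
  also have "?d = (1 - 3 * sigma_series q + 6 * sigma_series (q ^ 2) + 27 * sigma_series (q ^ 3) - 54 * sigma_series (q ^ 6)) / q"
    using q by (simp add: field_simps)
  also have "\<dots> = euler_E q ^ 3 * euler_E (q ^ 2) ^ 3 / (euler_E (q ^ 3) * euler_E (q ^ 6)) / q"
    unfolding level6_lambert[OF q] ..
  also have "?f * \<dots> = euler_E q ^ 6 * euler_E (q ^ 6) ^ 8 / euler_E (q ^ 3) ^ 10"
  proof -
    have *: "q * a ^ 3 * d ^ 9 / (b ^ 3 * c ^ 9) * (a ^ 3 * b ^ 3 / (c * d) / q) = a ^ 6 * d ^ 8 / c ^ 10"
      if "a > 0" "b > 0" "c > 0" "d > 0" for a b c d :: real
      using that q by (simp add: field_simps eval_nat_numeral)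
    show ?thesis by (rule *) (simp_all add: E_pos)
  qed
  finally show ?thesis .
qed

text \<open>Put K = 1 + u, an eta quotient by the Fricke relation. The other relation reads A + 8 =
  9 / K, so A K = 9 - 8 K = 1 - 8 u is an eta quotient as well. The remaining equations compare
  exponents.\<close>

lemma level6_f3_f2:
  fixes u :: real
  defines "u \<equiv> q * euler_E q ^ 3 * euler_E (q ^ 6) ^ 9 / (euler_E (q ^ 2) ^ 3 * euler_E (q ^ 3) ^ 9)"
  shows "u > 0"
    "1 + u = euler_E (q ^ 2) ^ 5 * euler_E (q ^ 6) / (euler_E q * euler_E (q ^ 3) ^ 5)"
    "1 - 8 * u = euler_E q ^ 8 * euler_E (q ^ 6) ^ 4 / (euler_E (q ^ 2) ^ 4 * euler_E (q ^ 3) ^ 8)"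
    "q * euler_E q ^ 4 * euler_E (q ^ 6) ^ 8 / (euler_E (q ^ 2) ^ 8 * euler_E (q ^ 3) ^ 4) = u / (1 + u)"
    "q * euler_E (q ^ 2) * euler_E (q ^ 6) ^ 5 / (euler_E q ^ 5 * euler_E (q ^ 3)) = u / (1 - 8 * u)"
proof -
  define a b c d where abcd: "a = euler_E q" "b = euler_E (q ^ 2)" "c = euler_E (q ^ 3)" "d = euler_E (q ^ 6)"
  have p: "a > 0" "b > 0" "c > 0" "d > 0" using E_pos by (auto simp: abcd)
  have u: "u = q * a ^ 3 * d ^ 9 / (b ^ 3 * c ^ 9)" by (simp add: u_def abcd)
  show "u > 0" unfolding u using p q by simp
  have K: "1 + u = b ^ 5 * d / (a * c ^ 5)" using level6_relation_fricke by (simp add: u_def abcd)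
  then show "1 + u = euler_E (q ^ 2) ^ 5 * euler_E (q ^ 6) / (euler_E q * euler_E (q ^ 3) ^ 5)" by (simp add: abcd)
  have AB: "a ^ 9 * d ^ 3 / (b ^ 9 * c ^ 3) + 8 = 9 * (a * c ^ 5 / (b ^ 5 * d))"
    using level6_relation_real[OF q] by (simp add: abcd)
  have "(a ^ 9 * d ^ 3 / (b ^ 9 * c ^ 3)) * (b ^ 5 * d / (a * c ^ 5)) = (9 * (a * c ^ 5 / (b ^ 5 * d)) - 8) * (b ^ 5 * d / (a * c ^ 5))"
    unfolding AB[symmetric] by simp
  also have "\<dots> = 9 - 8 * (b ^ 5 * d / (a * c ^ 5))"
  proof -
    have "(9 * (1 / k) - 8) * k = 9 - 8 * k" if "k \<noteq> 0" for k :: real using that by (simp add: left_diff_distrib)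
    from this[of "b ^ 5 * d / (a * c ^ 5)"] show ?thesis using p by simp
  qed
  also have "\<dots> = 1 - 8 * u" unfolding K[symmetric] by simp
  also have "(a ^ 9 * d ^ 3 / (b ^ 9 * c ^ 3)) * (b ^ 5 * d / (a * c ^ 5)) = a ^ 8 * d ^ 4 / (b ^ 4 * c ^ 8)"
    using p by (simp add: field_simps eval_nat_numeral)
  finally have M: "1 - 8 * u = a ^ 8 * d ^ 4 / (b ^ 4 * c ^ 8)" by simp
  then show "1 - 8 * u = euler_E q ^ 8 * euler_E (q ^ 6) ^ 4 / (euler_E (q ^ 2) ^ 4 * euler_E (q ^ 3) ^ 8)" by (simp add: abcd)
  have "q * a ^ 4 * d ^ 8 / (b ^ 8 * c ^ 4) = u / (1 + u)"
    unfolding K unfolding u using p q by (simp add: field_simps eval_nat_numeral)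
  then show "q * euler_E q ^ 4 * euler_E (q ^ 6) ^ 8 / (euler_E (q ^ 2) ^ 8 * euler_E (q ^ 3) ^ 4) = u / (1 + u)" by (simp add: abcd)
  have "q * b * d ^ 5 / (a ^ 5 * c) = u / (1 - 8 * u)"
    unfolding M unfolding u using p q by (simp add: field_simps eval_nat_numeral)
  then show "q * euler_E (q ^ 2) * euler_E (q ^ 6) ^ 5 / (euler_E q ^ 5 * euler_E (q ^ 3)) = u / (1 - 8 * u)" by (simp add: abcd)
qed

lemma level8_deriv:
  "((\<lambda>q. q * euler_E (q ^ 2) ^ 2 * euler_E (q ^ 8) ^ 4 / (euler_E q ^ 4 * euler_E (q ^ 4) ^ 2))
     has_real_derivative euler_E (q ^ 2) ^ 8 * euler_E (q ^ 4) ^ 4 / euler_E q ^ 8) (at q)"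
proof -
  let ?f = "q * euler_E (q ^ 2) ^ 2 * euler_E (q ^ 8) ^ 4 / (euler_E q ^ 4 * euler_E (q ^ 4) ^ 2)"
  let ?d = "1 / q + real 2 * - (real 2 * sigma_series (q ^ 2) / q) + real 4 * - (real 8 * sigma_series (q ^ 8) / q) -
        (real 4 * - (sigma_series q / q) + real 2 * - (real 4 * sigma_series (q ^ 4) / q))"
  have "((\<lambda>q. q * euler_E (q ^ 2) ^ 2 * euler_E (q ^ 8) ^ 4 / (euler_E q ^ 4 * euler_E (q ^ 4) ^ 2))
     has_real_derivative ?f * ?d) (at q)"
    by (intro dlog_divide dlog_mult dlog_power dlog_ident E_dlog E_pow_dlog) (use q E_pos in \<open>auto simp: less_imp_neq[symmetric]\<close>)
  also have "?d = (1 + 4 * sigma_series q - 4 * sigma_series (q ^ 2) + 8 * sigma_series (q ^ 4) - 32 * sigma_series (q ^ 8)) / q"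
    using q by (simp add: field_simps)
  also have "\<dots> = euler_E (q ^ 2) ^ 6 * euler_E (q ^ 4) ^ 6 / (euler_E q ^ 4 * euler_E (q ^ 8) ^ 4) / q"
    unfolding level8_lambert[OF q] ..
  also have "?f * \<dots> = euler_E (q ^ 2) ^ 8 * euler_E (q ^ 4) ^ 4 / euler_E q ^ 8"
  proof -
    have *: "q * b ^ 2 * d ^ 4 / (a ^ 4 * c ^ 2) * (b ^ 6 * c ^ 6 / (a ^ 4 * d ^ 4) / q) = b ^ 8 * c ^ 4 / a ^ 8"
      if "a > 0" "b > 0" "c > 0" "d > 0" for a b c d :: real
      using that q by (simp add: field_simps eval_nat_numeral)
    show ?thesis by (rule *) (simp_all add: E_pos)
  qed
  finally show ?thesis .
qed

lemma level9_deriv: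
  "((\<lambda>q. q * euler_E (q ^ 9) ^ 3 / euler_E q ^ 3) has_real_derivative euler_E (q ^ 3) ^ 10 / euler_E q ^ 6) (at q)"
proof -
  let ?f = "q * euler_E (q ^ 9) ^ 3 / euler_E q ^ 3"
  let ?d = "1 / q + real 3 * - (real 9 * sigma_series (q ^ 9) / q) - real 3 * - (sigma_series q / q)"
  have "((\<lambda>q. q * euler_E (q ^ 9) ^ 3 / euler_E q ^ 3) has_real_derivative ?f * ?d) (at q)"
    by (intro dlog_divide dlog_mult dlog_power dlog_ident E_dlog E_pow_dlog) (use q E_pos in \<open>auto simp: less_imp_neq[symmetric]\<close>)
  also have "?d = (1 + 3 * sigma_series q - 27 * sigma_series (q ^ 9)) / q"
    using q by (simp add: field_simps)
  also have "\<dots> = euler_E (q ^ 3) ^ 10 / (euler_E q ^ 3 * euler_E (q ^ 9) ^ 3) / q"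
    unfolding level9_lambert[OF q] ..
  also have "?f * \<dots> = euler_E (q ^ 3) ^ 10 / euler_E q ^ 6"
  proof -
    have *: "q * d ^ 3 / a ^ 3 * (c ^ 10 / (a ^ 3 * d ^ 3) / q) = c ^ 10 / a ^ 6"
      if "a > 0" "c > 0" "d > 0" for a c d :: real
      using that q by (simp add: field_simps eval_nat_numeral)
    show ?thesis by (rule *) (simp_all add: E_pos)
  qed
  finally show ?thesis .
qed

lemma level5_deriv:
  "((\<lambda>q. q * (progression_prod 5 1 q * progression_prod 5 4 q / (progression_prod 5 2 q * progression_prod 5 3 q)) ^ 5) has_real_derivative
     euler_E q ^ 5 / euler_E (q ^ 5) * rr_frac q ^ 5 / q) (at q)"
proof -
  have g: "(progression_prod 5 b has_real_derivative progression_prod 5 b q * - progression_dlog 5 b q) (at q)" "progression_prod 5 b q \<noteq> 0" if "b > 0" for b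
    using progression_prod_facts[of q 5 b] q that by auto
  let ?f = "q * (progression_prod 5 1 q * progression_prod 5 4 q / (progression_prod 5 2 q * progression_prod 5 3 q)) ^ 5"
  let ?d = "1 / q + real 5 * ((- progression_dlog 5 1 q + - progression_dlog 5 4 q) - (- progression_dlog 5 2 q + - progression_dlog 5 3 q))"
  have "((\<lambda>q. q * (progression_prod 5 1 q * progression_prod 5 4 q / (progression_prod 5 2 q * progression_prod 5 3 q)) ^ 5) has_real_derivative ?f * ?d) (at q)"
    by (intro dlog_divide dlog_mult dlog_power dlog_ident g) (use q g in auto)
  also have "?d = (1 - 5 * (q * progression_dlog 5 1 q - q * progression_dlog 5 2 q - q * progression_dlog 5 3 q + q * progression_dlog 5 4 q)) / q"
    using q by (simp add: field_simps)
  also have "\<dots> = euler_E q ^ 5 / euler_E (q ^ 5) / q" unfolding level5_lambert[OF q] ..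
  also have "?f = rr_frac q ^ 5" using q by (intro rr_frac_pow5[symmetric]) auto
  also have "rr_frac q ^ 5 * (euler_E q ^ 5 / euler_E (q ^ 5) / q) = euler_E q ^ 5 / euler_E (q ^ 5) * rr_frac q ^ 5 / q"
    by simp
  finally show ?thesis .
qed

end

text \<open>The derivative of u / (1 + u) is u' / (1 + u)^2, an eta quotient because both u' and 1 +
  u are.\<close>

lemma level6_f3_deriv:
  assumes q: "0 < q" "q < 1"
  shows "((\<lambda>q. q * euler_E q ^ 4 * euler_E (q ^ 6) ^ 8 / (euler_E (q ^ 2) ^ 8 * euler_E (q ^ 3) ^ 4))
     has_real_derivative euler_E q ^ 8 * euler_E (q ^ 6) ^ 6 / euler_E (q ^ 2) ^ 10) (at q)"
proof -
  define u where "u = (\<lambda>q. q * euler_E q ^ 3 * euler_E (q ^ 6) ^ 9 / (euler_E (q ^ 2) ^ 3 * euler_E (q ^ 3) ^ 9))"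
  have uf: "u q > 0" "1 + u q = euler_E (q ^ 2) ^ 5 * euler_E (q ^ 6) / (euler_E q * euler_E (q ^ 3) ^ 5)"
    "1 - 8 * u q = euler_E q ^ 8 * euler_E (q ^ 6) ^ 4 / (euler_E (q ^ 2) ^ 4 * euler_E (q ^ 3) ^ 8)"
    "q * euler_E q ^ 4 * euler_E (q ^ 6) ^ 8 / (euler_E (q ^ 2) ^ 8 * euler_E (q ^ 3) ^ 4) = u q / (1 + u q)"
    "q * euler_E (q ^ 2) * euler_E (q ^ 6) ^ 5 / (euler_E q ^ 5 * euler_E (q ^ 3)) = u q / (1 - 8 * u q)"
    if "0 < q" "q < 1" for q
    unfolding u_def by (rule level6_f3_f2[OF that])+
  define D where "D = euler_E q ^ 6 * euler_E (q ^ 6) ^ 8 / euler_E (q ^ 3) ^ 10"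
  have du: "(u has_real_derivative D) (at q)" unfolding u_def D_def by (rule level6_f4_deriv[OF q])
  have pos: "1 + u q > 0" using uf(1)[OF q] by simp
  have "((\<lambda>q. u q / (1 + u q)) has_real_derivative (D / (1 + u q) ^ 2)) (at q)"
  proof -
    have "((\<lambda>q. u q / (1 + u q)) has_real_derivative (D * (1 + u q) - u q * D) / ((1 + u q) * (1 + u q))) (at q)"
      using pos by (auto intro!: derivative_eq_intros du)
    then show ?thesis by (simp add: algebra_simps power2_eq_square)
  qed
  then have "((\<lambda>q. q * euler_E q ^ 4 * euler_E (q ^ 6) ^ 8 / (euler_E (q ^ 2) ^ 8 * euler_E (q ^ 3) ^ 4))
     has_real_derivative (D / (1 + u q) ^ 2)) (at q)"
    by (rule has_field_derivative_transform_within_open[of _ _ _ "{0<..<1}"]) (use q uf(4) in auto)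
  also have "D / (1 + u q) ^ 2 = euler_E q ^ 8 * euler_E (q ^ 6) ^ 6 / euler_E (q ^ 2) ^ 10"
  proof -
    have *: "a ^ 6 * d ^ 8 / c ^ 10 / (b ^ 5 * d / (a * c ^ 5)) ^ 2 = a ^ 8 * d ^ 6 / b ^ 10"
      if "a > 0" "b > 0" "c > 0" "d > 0" for a b c d :: real
      using that by (simp add: field_simps eval_nat_numeral)
    show ?thesis unfolding D_def uf(2)[OF q] by (rule *) (simp_all add: E_pos[OF q])
  qed
  finally show ?thesis .
qed

text \<open>The derivative of u / (1 - 8 u) is u' / (1 - 8 u)^2, again an eta quotient.\<close>

lemma level6_f2_deriv:
  assumes q: "0 < q" "q < 1"
  shows "((\<lambda>q. q * euler_E (q ^ 2) * euler_E (q ^ 6) ^ 5 / (euler_E q ^ 5 * euler_E (q ^ 3)))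
     has_real_derivative euler_E (q ^ 2) ^ 8 * euler_E (q ^ 3) ^ 6 / euler_E q ^ 10) (at q)"
proof -
  define u where "u = (\<lambda>q. q * euler_E q ^ 3 * euler_E (q ^ 6) ^ 9 / (euler_E (q ^ 2) ^ 3 * euler_E (q ^ 3) ^ 9))"
  have uf: "u q > 0" "1 + u q = euler_E (q ^ 2) ^ 5 * euler_E (q ^ 6) / (euler_E q * euler_E (q ^ 3) ^ 5)"
    "1 - 8 * u q = euler_E q ^ 8 * euler_E (q ^ 6) ^ 4 / (euler_E (q ^ 2) ^ 4 * euler_E (q ^ 3) ^ 8)"
    "q * euler_E q ^ 4 * euler_E (q ^ 6) ^ 8 / (euler_E (q ^ 2) ^ 8 * euler_E (q ^ 3) ^ 4) = u q / (1 + u q)"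
    "q * euler_E (q ^ 2) * euler_E (q ^ 6) ^ 5 / (euler_E q ^ 5 * euler_E (q ^ 3)) = u q / (1 - 8 * u q)"
    if "0 < q" "q < 1" for q
    unfolding u_def by (rule level6_f3_f2[OF that])+
  define D where "D = euler_E q ^ 6 * euler_E (q ^ 6) ^ 8 / euler_E (q ^ 3) ^ 10"
  have du: "(u has_real_derivative D) (at q)" unfolding u_def D_def by (rule level6_f4_deriv[OF q])
  \<comment> \<open>That u stays below 1/8 is read off from the eta quotient for 1 - 8 u, which is
    positive.\<close>
  have pos: "1 - 8 * u q \<noteq> 0"
  proof -
    have "1 - 8 * u q > 0" unfolding uf(3)[OF q] by (intro divide_pos_pos mult_pos_pos zero_less_power E_pos[OF q]) auto
    then show ?thesis by simp
  qed
  have "((\<lambda>q. u q / (1 - 8 * u q)) has_real_derivative (D / (1 - 8 * u q) ^ 2)) (at q)"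
  proof -
    have "((\<lambda>q. u q / (1 - 8 * u q)) has_real_derivative (D * (1 - 8 * u q) - u q * (- (8 * D))) / ((1 - 8 * u q) * (1 - 8 * u q))) (at q)"
      using pos by (auto intro!: derivative_eq_intros du)
    moreover have "D * (1 - 8 * u q) - u q * (- (8 * D)) = D" by (simp add: algebra_simps)
    ultimately show ?thesis by (simp only: power2_eq_square)
  qed
  then have "((\<lambda>q. q * euler_E (q ^ 2) * euler_E (q ^ 6) ^ 5 / (euler_E q ^ 5 * euler_E (q ^ 3)))
     has_real_derivative (D / (1 - 8 * u q) ^ 2)) (at q)"
    by (rule has_field_derivative_transform_within_open[of _ _ _ "{0<..<1}"]) (use q uf(5) in auto)
  also have "D / (1 - 8 * u q) ^ 2 = euler_E (q ^ 2) ^ 8 * euler_E (q ^ 3) ^ 6 / euler_E q ^ 10"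
  proof -
    have *: "a ^ 6 * d ^ 8 / c ^ 10 / (a ^ 8 * d ^ 4 / (b ^ 4 * c ^ 8)) ^ 2 = b ^ 8 * c ^ 6 / a ^ 10"
      if "a > 0" "b > 0" "c > 0" "d > 0" for a b c d :: real
      using that by (simp add: field_simps eval_nat_numeral)
    show ?thesis unfolding D_def uf(3)[OF q] by (rule *) (simp_all add: E_pos[OF q])
  qed
  finally show ?thesis .
qed

section \<open>Special values at fixed points of x -> 1/(k x)\<close>

lemma level6_monomials:
  assumes q: "0 < q" "q < 1"
  defines "t \<equiv> q * euler_E (q ^ 2) * euler_E (q ^ 6) ^ 5 / (euler_E q ^ 5 * euler_E (q ^ 3))"
  shows "t > 0"
    "q * euler_E q ^ 4 * euler_E (q ^ 6) ^ 8 / (euler_E (q ^ 2) ^ 8 * euler_E (q ^ 3) ^ 4) = t / (1 + 9 * t)"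
    "q * euler_E q ^ 3 * euler_E (q ^ 6) ^ 9 / (euler_E (q ^ 2) ^ 3 * euler_E (q ^ 3) ^ 9) = t / (1 + 8 * t)"
    "t * (1 + 8 * t) ^ 2 / (1 + 9 * t) = q * (euler_E (q ^ 3) / euler_E q) ^ 12"
    "t * (1 + 9 * t) ^ 3 / (1 + 8 * t) = q * (euler_E (q ^ 2) / euler_E q) ^ 24"
proof -
  define u where "u = q * euler_E q ^ 3 * euler_E (q ^ 6) ^ 9 / (euler_E (q ^ 2) ^ 3 * euler_E (q ^ 3) ^ 9)"
  note uf = level6_f3_f2[OF q, folded u_def, folded t_def]
  define a b c d where abcd: "a = euler_E q" "b = euler_E (q ^ 2)" "c = euler_E (q ^ 3)" "d = euler_E (q ^ 6)"
  have p: "a > 0" "b > 0" "c > 0" "d > 0" using E_pos[OF q] by (auto simp: abcd)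
  have t: "t = q * b * d ^ 5 / (a ^ 5 * c)" by (simp add: t_def abcd)
  show t0: "t > 0" unfolding t using p q by simp
  have M: "1 - 8 * u = a ^ 8 * d ^ 4 / (b ^ 4 * c ^ 8)" and K: "1 + u = b ^ 5 * d / (a * c ^ 5)"
    using uf(2,3) by (simp_all add: abcd)
  have M0: "1 - 8 * u > 0" "1 + u > 0" unfolding M K using p by auto
  have t8: "1 + 8 * t = 1 / (1 - 8 * u)" and t9: "1 + 9 * t = (1 + u) / (1 - 8 * u)"
    unfolding uf(5) using M0 by (simp_all add: field_simps)
  show "q * euler_E q ^ 4 * euler_E (q ^ 6) ^ 8 / (euler_E (q ^ 2) ^ 8 * euler_E (q ^ 3) ^ 4) = t / (1 + 9 * t)"
    unfolding uf(4) t9 unfolding uf(5) using M0 by simp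
  have "u = t / (1 + 8 * t)"
    unfolding t8 unfolding uf(5) using M0 by simp
  then show "q * euler_E q ^ 3 * euler_E (q ^ 6) ^ 9 / (euler_E (q ^ 2) ^ 3 * euler_E (q ^ 3) ^ 9) = t / (1 + 8 * t)"
    unfolding u_def .
  \<comment> \<open>With t, 1 + 8 t and 1 + 9 t known as eta quotients, the exponents in the last
    two claims are those for which only E(q^3) / E(q), respectively E(q^2) / E(q), survives.\<close>
  have t8': "1 + 8 * t = b ^ 4 * c ^ 8 / (a ^ 8 * d ^ 4)" unfolding t8 M by simp
  have t9': "1 + 9 * t = b ^ 9 * c ^ 3 / (a ^ 9 * d ^ 3)"
    unfolding t9 M K using p by (simp add: field_simps eval_nat_numeral)
  have "t * (1 + 8 * t) ^ 2 / (1 + 9 * t) = q * (c / a) ^ 12"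
    unfolding t8' t9' unfolding t using p q by (simp add: field_simps eval_nat_numeral)
  then show "t * (1 + 8 * t) ^ 2 / (1 + 9 * t) = q * (euler_E (q ^ 3) / euler_E q) ^ 12" by (simp add: abcd)
  have "t * (1 + 9 * t) ^ 3 / (1 + 8 * t) = q * (b / a) ^ 24"
    unfolding t8' t9' unfolding t using p q by (simp add: field_simps eval_nat_numeral)
  then show "t * (1 + 9 * t) ^ 3 / (1 + 8 * t) = q * (euler_E (q ^ 2) / euler_E q) ^ 24" by (simp add: abcd)
qed

text \<open>At x = 1 / sqrt 6, the fixed point of x -> 1/(6 x), the eta values at x and 6 x, and
  those at 2 x and 3 x, are proportional. They cancel and leave r' / r^5.\<close>

lemma level6_value_6:
  assumes q: "q = exp (- 2 * pi / sqrt 6)"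
  shows "q * euler_E (q ^ 2) * euler_E (q ^ 6) ^ 5 / (euler_E q ^ 5 * euler_E (q ^ 3)) = sqrt 2 / 12" (is "?t = _")
proof -
  define x where "x = 1 / sqrt 6"
  have x: "x > 0" "x * sqrt 6 = 1" by (auto simp: x_def)
  have s6: "sqrt 6 * sqrt 6 = 6" by simp
  have qx: "q = exp (- 2 * pi * x)" using q by (simp add: x_def)
  have q01: "0 < q" "q < 1" using x qx by auto
  define w where "w = exp (pi * x / 12)"
  have w: "w > 0" by (simp add: w_def)
  define e3 e6 where e: "e3 = eta (3 * x)" "e6 = eta (6 * x)"
  have epos: "e3 > 0" "e6 > 0" unfolding e using x by (auto intro!: eta_pos)
  have x6: "6 * x = sqrt 6" "3 * x = sqrt 6 / 2" unfolding x_def using s6 by (simp_all add: field_simps)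
  define r r' where "r = sqrt (sqrt 6)" and "r' = sqrt (sqrt 6 / 2)"
  have rpos: "r > 0" "r' > 0" by (auto simp: r_def r'_def)
  have t1: "eta x = r * e6" unfolding e r_def x6 by (rule eta_transformation') (use x in auto)
  have t2: "eta (2 * x) = r' * e3" unfolding e r'_def x6 by (rule eta_transformation') (use x in auto)
  have E: "euler_E q = w * (r * e6)" "euler_E (q ^ 2) = w ^ 2 * (r' * e3)" "euler_E (q ^ 3) = w ^ 3 * e3" "euler_E (q ^ 6) = w ^ 6 * e6"
    and F0: "q = 1 / w ^ 24"
    unfolding qx w_def e using euler_E_eta[OF x(1), of 1] euler_E_eta[OF x(1), of 2] euler_E_eta[OF x(1), of 3] euler_E_eta[OF x(1), of 6]
      eta_nome[of x] t1 t2 unfolding e by simp_all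
  have "?t = (w ^ 32 / w ^ 32) * (r' / r ^ 5)"
    unfolding E unfolding F0 using w epos rpos by (simp add: power_mult_distrib flip: power_mult) (simp add: field_simps eval_nat_numeral)
  then have t: "?t = r' / r ^ 5" using w by simp
  \<comment> \<open>Both r and r' are square roots of expressions in sqrt 6, so the value is
    compared after squaring.\<close>
  have "?t ^ 2 = r' ^ 2 / (r ^ 2) ^ 5" unfolding t by (simp add: power_divide flip: power_mult)
  also have "\<dots> = (sqrt 6 / 2) / sqrt 6 ^ 5" by (simp add: r_def r'_def)
  also have "\<dots> = (sqrt 2 / 12) ^ 2"
  proof -
    have "s ^ 5 = s * (s ^ 2) ^ 2" for s :: real by (simp flip: power_mult power_Suc)
    from this[of "sqrt 6"] have "sqrt 6 ^ 5 = sqrt 6 * 36" by simp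
    then show ?thesis by (simp add: power_divide)
  qed
  finally have sq: "?t ^ 2 = (sqrt 2 / 12) ^ 2" .
  have "0 \<le> ?t" unfolding t using rpos by simp
  then show ?thesis by (intro power2_eq_imp_eq[OF sq]) auto
qed

text \<open>If k x^2 = 1, then 1 / x = k x and the eta values at x and k x are proportional.
  Squaring removes the square root of k x.\<close>

lemma ratio_value:
  fixes k :: nat
  assumes x: "x > 0" "real k * x ^ 2 = 1" "k > 0" and q: "q = exp (- 2 * pi * x)"
  shows "(euler_E (q ^ k) / euler_E q) ^ 2 = exp (pi * x / 12) ^ (2 * k) / exp (pi * x / 12) ^ 2 / (real k * x)"
proof -
  have kx: "real k * x > 0" "x * (real k * x) = 1" using x by (auto simp: power2_eq_square mult_ac)
  have t: "eta x = sqrt (real k * x) * eta (real k * x)" by (rule eta_transformation'[OF kx])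
  have "euler_E (q ^ k) / euler_E q = exp (pi * x / 12) ^ k * eta (real k * x) / (exp (pi * x / 12) * (sqrt (real k * x) * eta (real k * x)))"
    unfolding q using euler_E_eta[OF x(1), of 1] euler_E_eta[OF x(1,3)] t by simp
  also have "\<dots> = exp (pi * x / 12) ^ k / exp (pi * x / 12) / sqrt (real k * x)"
    using eta_pos[OF kx(1)] by simp
  finally have e: "euler_E (q ^ k) / euler_E q = exp (pi * x / 12) ^ k / exp (pi * x / 12) / sqrt (real k * x)" .
  have "(W ^ k / W / sqrt y) ^ 2 = W ^ (2 * k) / W ^ 2 / y" if "y > 0" for W y :: real
    using that by (simp add: power_divide power_mult_distrib mult.commute[of 2] power_mult)
  then show ?thesis unfolding e using kx(1) by blast
qed

text \<open>The assumption \<open>n\<close> says (k - 1) n = 12 j, which makes the powers of w = exp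
  (pi x / 12) cancel against q^j = w^(-24 j).\<close>

lemma ratio_value_power:
  fixes k n j :: nat
  assumes x: "x > 0" "real k * x ^ 2 = 1" "k > 0" and q: "q = exp (- 2 * pi * x)" and n: "k * n = 12 * j + n"
  shows "q ^ j * (euler_E (q ^ k) / euler_E q) ^ (2 * n) = 1 / (real k * x) ^ n"
proof -
  define w where "w = exp (pi * x / 12)"
  have w: "w > 0" by (simp add: w_def)
  have q': "q = 1 / w ^ 24" unfolding q w_def by (rule eta_nome)
  have "(euler_E (q ^ k) / euler_E q) ^ (2 * n) = (w ^ (2 * k) / w ^ 2 / (real k * x)) ^ n"
    unfolding power_mult ratio_value[OF x q] w_def ..
  also have "\<dots> = w ^ (2 * (k * n)) / w ^ (2 * n) / (real k * x) ^ n"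
    by (simp only: power_divide power_mult[symmetric] mult.assoc)
  also have "\<dots> = w ^ (24 * j) * (w ^ (2 * n) / w ^ (2 * n)) / (real k * x) ^ n"
    unfolding n by (simp add: power_add distrib_left)
  also have "\<dots> = w ^ (24 * j) / (real k * x) ^ n" using w by simp
  finally have e: "(euler_E (q ^ k) / euler_E q) ^ (2 * n) = w ^ (24 * j) / (real k * x) ^ n" .
  show ?thesis unfolding e using w by (simp add: q' power_divide power_mult)
qed

lemma sqrt_powers: "sqrt 3 ^ 6 = (27::real)" "sqrt 2 ^ 12 = (64::real)" "sqrt 5 ^ 3 = 5 * sqrt 5" "sqrt 3 ^ 3 = 3 * sqrt 3"
proof -
  have e: "s ^ 6 = (s ^ 2) ^ 3" "s ^ 12 = (s ^ 2) ^ 6" "s ^ 3 = s ^ 2 * s" for s :: real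
  proof -
    show "s ^ 6 = (s ^ 2) ^ 3" "s ^ 12 = (s ^ 2) ^ 6" by (simp_all flip: power_mult)
    show "s ^ 3 = s ^ 2 * s" by (simp add: power3_eq_cube power2_eq_square)
  qed
  show "sqrt 3 ^ 6 = (27::real)" "sqrt 2 ^ 12 = (64::real)" "sqrt 5 ^ 3 = 5 * sqrt 5" "sqrt 3 ^ 3 = 3 * sqrt 3"
    unfolding e by simp_all
qed

text \<open>The fixed point of level three yields q (E(q^3) / E(q))^12 = 1/27, a cubic equation for
  t. It has the rational root -1/6; the positive root belongs to the quadratic factor.\<close>

lemma level6_value_3:
  assumes q: "q = exp (- 2 * pi / sqrt 3)"
  shows "q * euler_E (q ^ 2) * euler_E (q ^ 6) ^ 5 / (euler_E q ^ 5 * euler_E (q ^ 3)) = (sqrt 3 - 1) / 24" (is "?t = _")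
proof -
  define x where "x = 1 / sqrt 3"
  have x: "x > 0" "real 3 * x ^ 2 = 1" "real 3 * x = sqrt 3" by (auto simp: x_def power_divide real_div_sqrt)
  have qx: "q = exp (- 2 * pi * x)" using q by (simp add: x_def)
  have q01: "0 < q" "q < 1" using x qx by auto
  define t where "t = ?t"
  note tf = level6_monomials[OF q01, folded t_def]
  have "q ^ 1 * (euler_E (q ^ 3) / euler_E q) ^ (2 * 6) = 1 / (real 3 * x) ^ 6"
    by (rule ratio_value_power[OF x(1,2) _ qx]) auto
  then have "t * (1 + 8 * t) ^ 2 / (1 + 9 * t) = 1 / 27"
    unfolding tf(4) x(3) using sqrt_powers(1) by simp
  then have "27 * t * (1 + 8 * t) ^ 2 = 1 + 9 * t" using tf(1) by (simp add: field_simps)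
  then have "(12 * t + 2) * (288 * t ^ 2 + 24 * t - 1) = 0" by algebra
  moreover have "12 * t + 2 \<noteq> 0" using tf(1) by simp
  ultimately have "288 * t ^ 2 + 24 * t - 1 = 0" by simp
  then have "(24 * t + 1) ^ 2 = 3" by algebra
  then have "24 * t + 1 = sqrt 3" using tf(1) by (intro real_sqrt_unique[symmetric]) auto
  then show ?thesis unfolding t_def[symmetric] by simp
qed

text \<open>The fixed point of level two yields q (E(q^2) / E(q))^24 = 1/64, a quartic equation for
  t. In terms of 36 t it splits into two quadratics, only one of which vanishes at a positive
  argument.\<close>

lemma level6_value_2:
  assumes q: "q = exp (- 2 * pi / sqrt 2)"
  shows "q * euler_E (q ^ 2) * euler_E (q ^ 6) ^ 5 / (euler_E q ^ 5 * euler_E (q ^ 3)) = (sqrt 6 - 2) / 36" (is "?t = _")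
proof -
  define x where "x = 1 / sqrt 2"
  have x: "x > 0" "real 2 * x ^ 2 = 1" "real 2 * x = sqrt 2" by (auto simp: x_def power_divide real_div_sqrt)
  have qx: "q = exp (- 2 * pi * x)" using q by (simp add: x_def)
  have q01: "0 < q" "q < 1" using x qx by auto
  define t where "t = ?t"
  note tf = level6_monomials[OF q01, folded t_def]
  have "q ^ 1 * (euler_E (q ^ 2) / euler_E q) ^ (2 * 12) = 1 / (real 2 * x) ^ 12"
    by (rule ratio_value_power[OF x(1,2) _ qx]) auto
  then have "t * (1 + 9 * t) ^ 3 / (1 + 8 * t) = 1 / 64"
    unfolding tf(5) x(3) using sqrt_powers(2) by simp
  then have "64 * t * (1 + 9 * t) ^ 3 = 1 + 8 * t" using tf(1) by (simp add: field_simps)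
  then have "((36 * t) ^ 2 + 8 * (36 * t) + 18) * ((36 * t) ^ 2 + 4 * (36 * t) - 2) = 0" by algebra
  moreover have "(36 * t) ^ 2 + 8 * (36 * t) + 18 > 0" using tf(1) by (simp add: add_pos_pos)
  ultimately have "(36 * t) ^ 2 + 4 * (36 * t) - 2 = 0" by simp
  then have "(36 * t + 2) ^ 2 = 6" by algebra
  then have "36 * t + 2 = sqrt 6" using tf(1) by (intro real_sqrt_unique[symmetric]) auto
  then show ?thesis unfolding t_def[symmetric] by simp
qed

text \<open>Two fixed points coincide here: 8 x^2 = 1 gives E(q^8) / E(q), and 2 (2 x)^2 = 1 gives
  E(q^4) / E(q^2), the nome of the latter being q^2.\<close>

lemma level8_value:
  assumes q: "q = exp (- pi / sqrt 2)"
  shows "q * euler_E (q ^ 2) ^ 2 * euler_E (q ^ 8) ^ 4 / (euler_E q ^ 4 * euler_E (q ^ 4) ^ 2) = 1 / sqrt 32"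
proof -
  define x where "x = 1 / (2 * sqrt 2)"
  have x: "x > 0" "real 8 * x ^ 2 = 1" by (auto simp: x_def power_divide power_mult_distrib)
  have y: "2 * x > 0" "real 2 * (2 * x) ^ 2 = 1" by (auto simp: x_def power_divide power_mult_distrib)
  have qx: "q = exp (- 2 * pi * x)" using q by (simp add: x_def)
  have qy: "q ^ 2 = exp (- 2 * pi * (2 * x))" unfolding qx by (simp flip: exp_double)
  have q01: "0 < q" "q < 1" using x qx by auto
  define w where "w = exp (pi * x / 12)"
  have w: "w > 0" by (simp add: w_def)
  have w2: "exp (pi * (2 * x) / 12) = w ^ 2" unfolding w_def by (simp flip: exp_double)
  have q': "q = 1 / w ^ 24" unfolding qx w_def by (rule eta_nome)
  define A B where "A = (euler_E (q ^ 8) / euler_E q) ^ 2" and "B = (euler_E (q ^ 4) / euler_E (q ^ 2)) ^ 2"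
  have A: "A = w ^ 16 / w ^ 2 / (8 * x)"
    using ratio_value[OF x(1,2) _ qx] unfolding A_def w_def by simp
  have B: "B = w ^ 8 / w ^ 4 / (4 * x)"
    using ratio_value[OF y(1,2) _ qy] unfolding B_def w2 by (simp flip: power_mult)
  have "q * euler_E (q ^ 2) ^ 2 * euler_E (q ^ 8) ^ 4 / (euler_E q ^ 4 * euler_E (q ^ 4) ^ 2) = q * A ^ 2 / B"
    unfolding A_def B_def by (simp add: power_divide flip: power_mult)
  also have "\<dots> = 1 / (16 * x)"
    unfolding A B unfolding q' using w x by (simp add: field_simps eval_nat_numeral)
  also have "\<dots> = 1 / sqrt 32"
  proof -
    have "sqrt 32 = sqrt (16 * 2)" by simp
    also have "\<dots> = sqrt 16 * sqrt 2" by (rule real_sqrt_mult)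
    also have "sqrt 16 = 4" by (rule real_sqrt_unique) auto
    finally have "sqrt 32 = 4 * sqrt 2" .
    then show ?thesis by (simp add: x_def real_div_sqrt field_simps)
  qed
  finally show ?thesis .
qed

text \<open>\<open>ratio_value_power\<close> with k = 9, n = 3, j = 2 determines the square of the
  value; positivity does the rest.\<close>

lemma level9_value:
  assumes q: "q = exp (- 2 * pi / 3)"
  shows "q * euler_E (q ^ 9) ^ 3 / euler_E q ^ 3 = 1 / (3 * sqrt 3)" (is "?f = _")
proof -
  define x where "x = (1 / 3 :: real)"
  have x: "x > 0" "real 9 * x ^ 2 = 1" "real 9 * x = 3" by (auto simp: x_def power_divide)
  have qx: "q = exp (- 2 * pi * x)" using q by (simp add: x_def)
  have q01: "0 < q" "q < 1" using x qx by auto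
  have "q ^ 2 * (euler_E (q ^ 9) / euler_E q) ^ (2 * 3) = 1 / (real 9 * x) ^ 3"
    by (rule ratio_value_power[OF x(1,2) _ qx]) auto
  moreover have "?f ^ 2 = q ^ 2 * (euler_E (q ^ 9) / euler_E q) ^ (2 * 3)"
    by (simp add: power_divide power_mult_distrib flip: power_mult)
  ultimately have "?f ^ 2 = 1 / 27" unfolding x(3) by simp
  moreover have "(1 / (3 * sqrt 3)) ^ 2 = (1 / 27 :: real)" by (simp add: power_divide power_mult_distrib)
  ultimately have sq: "?f ^ 2 = (1 / (3 * sqrt 3)) ^ 2" by (simp only:)
  have "0 \<le> ?f" using q01 E_pos[OF q01] by (simp add: less_imp_le)
  then show ?thesis by (intro power2_eq_imp_eq[OF sq]) auto
qed

text \<open>The fixed point of level five turns \<open>rr_frac_relation\<close> into 1 / X - 11 - X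
  = 5 sqrt 5. Since alpha0^5 = (11 + 5 sqrt 5) / 2, X is the positive root of X^2 + 2 alpha0^5 X - 1
  = 0.\<close>

lemma level5_value:
  assumes q: "q = exp (- 2 * pi / sqrt 5)"
  shows "rr_frac q ^ 5 = sqrt (alpha0 ^ 10 + 1) - alpha0 ^ 5"
proof -
  define x where "x = 1 / sqrt 5"
  have x: "x > 0" "real 5 * x ^ 2 = 1" "real 5 * x = sqrt 5" by (auto simp: x_def power_divide real_div_sqrt)
  have qx: "q = exp (- 2 * pi * x)" using q by (simp add: x_def)
  have q01: "0 < q" "q < 1" using x qx by auto
  define X where "X = rr_frac q ^ 5"
  have g: "progression_prod 5 b q > 0" if "b > 0" for b using progression_prod_facts(2)[of q 5 b] q01 that by auto
  have X0: "X > 0" unfolding X_def using q01 g by (subst rr_frac_pow5) auto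
  have "q ^ 1 * (euler_E (q ^ 5) / euler_E q) ^ (2 * 3) = 1 / (real 5 * x) ^ 3"
    by (rule ratio_value_power[OF x(1,2) _ qx]) auto
  then have "q * euler_E (q ^ 5) ^ 6 / euler_E q ^ 6 = 1 / (5 * sqrt 5)"
    unfolding x(3) sqrt_powers(3) by (simp add: power_divide)
  then have "euler_E q ^ 6 / (q * euler_E (q ^ 5) ^ 6) = 5 * sqrt 5"
    by (metis divide_divide_eq_right divide_self_if inverse_divide inverse_eq_divide mult_1 div_by_1)
  then have "1 / X - 11 - X = 5 * sqrt 5"
    using rr_frac_relation[OF q01] unfolding X_def by simp
  then have X: "1 - 11 * X - X ^ 2 = 5 * sqrt 5 * X"
    using X0 by (simp add: field_simps power2_eq_square)
  define s where "s = sqrt 5"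
  have s: "s ^ 2 = 5" by (simp add: s_def)
  have al: "alpha0 ^ 5 = (11 + 5 * s) / 2"
  proof -
    have "32 * alpha0 ^ 5 = (1 + s) ^ 5" unfolding alpha0_def s_def by (simp add: power_divide)
    also have "\<dots> = 176 + 80 * s"
    proof -
      have "s * s = 5" "s * (s * y) = 5 * y" for y using s by (simp_all add: power2_eq_square flip: mult.assoc)
      note ss = this
      show ?thesis by (simp add: eval_nat_numeral algebra_simps ss)
    qed
    finally show ?thesis by simp
  qed
  have "2 * alpha0 ^ 5 * X = (11 + 5 * s) * X" unfolding al by simp
  then have "(X + alpha0 ^ 5) ^ 2 = (alpha0 ^ 5) ^ 2 + 1"
    using X unfolding s_def[symmetric] by (simp add: power2_eq_square algebra_simps)
  then have "(X + alpha0 ^ 5) ^ 2 = alpha0 ^ 10 + 1" by (simp flip: power_mult)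
  moreover have "alpha0 ^ 5 > 0" by (simp add: alpha0_def add_pos_pos)
  ultimately have "X + alpha0 ^ 5 = sqrt (alpha0 ^ 10 + 1)"
    using X0 by (intro real_sqrt_unique[symmetric]) auto
  then show ?thesis unfolding X_def by simp
qed

text \<open>Continuity at 0 is two-sided, so the antiderivative is written with the products
  \<open>progression_prod\<close>, which are differentiable on both sides of 0; it agrees with
  \<open>rr_frac q ^ 5\<close> at the end point.\<close>

lemma rr_frac_integral:
  assumes "0 < q" "q < 1"
  shows "((\<lambda>t. euler_E t ^ 5 / euler_E (t ^ 5) * rr_frac t ^ 5 / t) has_integral rr_frac q ^ 5) {0..q}"
proof -
  have "((\<lambda>t. euler_E t ^ 5 / euler_E (t ^ 5) * rr_frac t ^ 5 / t) has_integral
      q * (progression_prod 5 1 q * progression_prod 5 4 q / (progression_prod 5 2 q * progression_prod 5 3 q)) ^ 5) {0..q}"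
  proof (rule has_integral_of_deriv[OF assms])
    fix t :: real assume t: "0 \<le> t" "t < 1"
    have g: "isCont (progression_prod 5 b) t" "progression_prod 5 b t \<noteq> 0" if "b > 0" for b
      using progression_prod_facts[of t 5 b] t that by (auto intro: DERIV_isCont)
    show "isCont (\<lambda>q. q * (progression_prod 5 1 q * progression_prod 5 4 q / (progression_prod 5 2 q * progression_prod 5 3 q)) ^ 5) t"
      by (intro continuous_intros g) (use g in auto)
  qed (use level5_deriv in auto)
  then show ?thesis using rr_frac_pow5[of q] assms by simp
qed

theorem theorem1:
  fixes q :: real
  assumes "0 < q" and "q < 1"
  shows
   "(((\<lambda>t. euler_E t ^ 5 / euler_E (t ^ 5) * rr_frac t ^ 5 / t) has_integral rr_frac q ^ 5) {0..q}
      \<and> (q = exp (- 2 * pi / sqrt 5) \<longrightarrow> rr_frac q ^ 5 = sqrt (alpha0 ^ 10 + 1) - alpha0 ^ 5))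
    \<and> (((\<lambda>t. euler_E (t^2) ^ 8 * euler_E (t^3) ^ 6 / euler_E t ^ 10) has_integral
        q * euler_E (q^2) * euler_E (q^6) ^ 5 / (euler_E q ^ 5 * euler_E (q^3))) {0..q}
      \<and> (q = exp (- 2 * pi / sqrt 6) \<longrightarrow>
           q * euler_E (q^2) * euler_E (q^6) ^ 5 / (euler_E q ^ 5 * euler_E (q^3)) = sqrt 2 / 12)
      \<and> (q = exp (- 2 * pi / sqrt 3) \<longrightarrow>
           q * euler_E (q^2) * euler_E (q^6) ^ 5 / (euler_E q ^ 5 * euler_E (q^3)) = (sqrt 3 - 1) / 24)
      \<and> (q = exp (- 2 * pi / sqrt 2) \<longrightarrow>
           q * euler_E (q^2) * euler_E (q^6) ^ 5 / (euler_E q ^ 5 * euler_E (q^3)) = (sqrt 6 - 2) / 36))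
    \<and> (((\<lambda>t. euler_E t ^ 8 * euler_E (t^6) ^ 6 / euler_E (t^2) ^ 10) has_integral
        q * euler_E q ^ 4 * euler_E (q^6) ^ 8 / (euler_E (q^2) ^ 8 * euler_E (q^3) ^ 4)) {0..q}
      \<and> (q = exp (- 2 * pi / sqrt 6) \<longrightarrow>
           q * euler_E q ^ 4 * euler_E (q^6) ^ 8 / (euler_E (q^2) ^ 8 * euler_E (q^3) ^ 4) = (sqrt 2 - 1)^2 / 3)
      \<and> (q = exp (- 2 * pi / sqrt 3) \<longrightarrow>
           q * euler_E q ^ 4 * euler_E (q^6) ^ 8 / (euler_E (q^2) ^ 8 * euler_E (q^3) ^ 4) = (2 - sqrt 3)^2 / 3)
      \<and> (q = exp (- 2 * pi / sqrt 2) \<longrightarrow>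
           q * euler_E q ^ 4 * euler_E (q^6) ^ 8 / (euler_E (q^2) ^ 8 * euler_E (q^3) ^ 4) = (sqrt 6 - 2)^2 / 18))
    \<and> (((\<lambda>t. euler_E t ^ 6 * euler_E (t^6) ^ 8 / euler_E (t^3) ^ 10) has_integral
        q * euler_E q ^ 3 * euler_E (q^6) ^ 9 / (euler_E (q^2) ^ 3 * euler_E (q^3) ^ 9)) {0..q}
      \<and> (q = exp (- 2 * pi / sqrt 6) \<longrightarrow>
           q * euler_E q ^ 3 * euler_E (q^6) ^ 9 / (euler_E (q^2) ^ 3 * euler_E (q^3) ^ 9) = (3 * sqrt 2 - 4) / 4)
      \<and> (q = exp (- 2 * pi / sqrt 3) \<longrightarrow>
           q * euler_E q ^ 3 * euler_E (q^6) ^ 9 / (euler_E (q^2) ^ 3 * euler_E (q^3) ^ 9) = (sqrt 3 - 1)^3 / 16)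
      \<and> (q = exp (- 2 * pi / sqrt 2) \<longrightarrow>
           q * euler_E q ^ 3 * euler_E (q^6) ^ 9 / (euler_E (q^2) ^ 3 * euler_E (q^3) ^ 9) = (sqrt 6 - 2)^3 / 8))
    \<and> (((\<lambda>t. euler_E (t^2) ^ 8 * euler_E (t^4) ^ 4 / euler_E t ^ 8) has_integral
        q * euler_E (q^2) ^ 2 * euler_E (q^8) ^ 4 / (euler_E q ^ 4 * euler_E (q^4) ^ 2)) {0..q}
      \<and> (q = exp (- pi / sqrt 2) \<longrightarrow>
           q * euler_E (q^2) ^ 2 * euler_E (q^8) ^ 4 / (euler_E q ^ 4 * euler_E (q^4) ^ 2) = 1 / sqrt 32))
    \<and> (((\<lambda>t. euler_E (t^3) ^ 10 / euler_E t ^ 6) has_integral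
        q * euler_E (q^9) ^ 3 / euler_E q ^ 3) {0..q}
      \<and> (q = exp (- 2 * pi / 3) \<longrightarrow>
           q * euler_E (q^9) ^ 3 / euler_E q ^ 3 = 1 / (3 * sqrt 3)))"
proof -
  note cont = euler_E_isCont
  have i2: "((\<lambda>t. euler_E (t^2) ^ 8 * euler_E (t^3) ^ 6 / euler_E t ^ 10) has_integral
        q * euler_E (q^2) * euler_E (q^6) ^ 5 / (euler_E q ^ 5 * euler_E (q^3))) {0..q}"
    by (rule has_integral_of_deriv[OF assms])
       (auto intro!: continuous_intros cont level6_f2_deriv simp: cont)
  have i3: "((\<lambda>t. euler_E t ^ 8 * euler_E (t^6) ^ 6 / euler_E (t^2) ^ 10) has_integral
        q * euler_E q ^ 4 * euler_E (q^6) ^ 8 / (euler_E (q^2) ^ 8 * euler_E (q^3) ^ 4)) {0..q}"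
    by (rule has_integral_of_deriv[OF assms])
       (auto intro!: continuous_intros cont level6_f3_deriv simp: cont)
  have i4: "((\<lambda>t. euler_E t ^ 6 * euler_E (t^6) ^ 8 / euler_E (t^3) ^ 10) has_integral
        q * euler_E q ^ 3 * euler_E (q^6) ^ 9 / (euler_E (q^2) ^ 3 * euler_E (q^3) ^ 9)) {0..q}"
    by (rule has_integral_of_deriv[OF assms])
       (auto intro!: continuous_intros cont level6_f4_deriv simp: cont)
  have i5: "((\<lambda>t. euler_E (t^2) ^ 8 * euler_E (t^4) ^ 4 / euler_E t ^ 8) has_integral
        q * euler_E (q^2) ^ 2 * euler_E (q^8) ^ 4 / (euler_E q ^ 4 * euler_E (q^4) ^ 2)) {0..q}"
    by (rule has_integral_of_deriv[OF assms])
       (auto intro!: continuous_intros cont level8_deriv simp: cont)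
  have i6: "((\<lambda>t. euler_E (t^3) ^ 10 / euler_E t ^ 6) has_integral q * euler_E (q^9) ^ 3 / euler_E q ^ 3) {0..q}"
    by (rule has_integral_of_deriv[OF assms])
       (auto intro!: continuous_intros cont level9_deriv simp: cont)
  \<comment> \<open>The values in (3) and (4) are t / (1 + 9 t) and t / (1 + 8 t) at the values t
    found for (2); \<open>v6\<close>, \<open>v3\<close> and \<open>v2\<close> only simplify these
    fractions.\<close>
  note f34 = level6_monomials(2,3)[OF assms]
  have v6: "sqrt 2 / 12 / (1 + 9 * (sqrt 2 / 12)) = (sqrt 2 - 1)^2 / 3" "sqrt 2 / 12 / (1 + 8 * (sqrt 2 / 12)) = (3 * sqrt 2 - 4) / 4"
  proof -
    define s :: real where "s = sqrt 2"
    have s: "s ^ 2 = 2" "s > 0" by (auto simp: s_def)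
    have ss: "s * s = 2" "s * (s * y) = 2 * y" for y using s by (simp_all add: power2_eq_square flip: mult.assoc)
    have "s / 12 / (1 + 9 * (s / 12)) = (s - 1)^2 / 3 \<longleftrightarrow> s * 3 = (s - 1) ^ 2 * (12 + 9 * s)"
      using s(2) by (simp add: field_simps add_pos_pos)
    moreover have "s * 3 = (s - 1) ^ 2 * (12 + 9 * s)" by (simp add: eval_nat_numeral algebra_simps ss)
    moreover have "s / 12 / (1 + 8 * (s / 12)) = (3 * s - 4) / 4 \<longleftrightarrow> s * 4 = (3 * s - 4) * (12 + 8 * s)"
      using s(2) by (simp add: field_simps add_pos_pos)
    moreover have "s * 4 = (3 * s - 4) * (12 + 8 * s)" by (simp add: eval_nat_numeral algebra_simps ss)
    ultimately show "sqrt 2 / 12 / (1 + 9 * (sqrt 2 / 12)) = (sqrt 2 - 1)^2 / 3" "sqrt 2 / 12 / (1 + 8 * (sqrt 2 / 12)) = (3 * sqrt 2 - 4) / 4"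
      unfolding s_def by blast+
  qed
  have v3: "(sqrt 3 - 1) / 24 / (1 + 9 * ((sqrt 3 - 1) / 24)) = (2 - sqrt 3)^2 / 3"
    "(sqrt 3 - 1) / 24 / (1 + 8 * ((sqrt 3 - 1) / 24)) = (sqrt 3 - 1)^3 / 16"
  proof -
    define s :: real where "s = sqrt 3"
    have s: "s ^ 2 = 3" "s > 0" by (auto simp: s_def)
    have ss: "s * s = 3" "s * (s * y) = 3 * y" for y using s by (simp_all add: power2_eq_square flip: mult.assoc)
    have a: "(s - 1) / 24 / (1 + k * ((s - 1) / 24)) = (s - 1) / (24 + k * (s - 1))" for k :: real
    proof -
      have "1 + k * ((s - 1) / 24) = (24 + k * (s - 1)) / 24" by (simp add: field_simps)
      then show ?thesis by simp
    qed
    have "(s - 1) / (24 + 9 * (s - 1)) = (2 - s)^2 / 3"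
    proof -
      have "24 + 9 * (s - 1) > 0" using s(2) by simp
      moreover have "(s - 1) * 3 = (2 - s) ^ 2 * (24 + 9 * (s - 1))" by (simp add: eval_nat_numeral algebra_simps ss)
      ultimately show ?thesis by (subst frac_eq_eq) auto
    qed
    moreover have "(s - 1) / (24 + 8 * (s - 1)) = (s - 1)^3 / 16"
    proof -
      have "24 + 8 * (s - 1) > 0" using s(2) by simp
      moreover have "(s - 1) * 16 = (s - 1) ^ 3 * (24 + 8 * (s - 1))" by (simp add: eval_nat_numeral algebra_simps ss)
      ultimately show ?thesis by (subst frac_eq_eq) auto
    qed
    ultimately show "(sqrt 3 - 1) / 24 / (1 + 9 * ((sqrt 3 - 1) / 24)) = (2 - sqrt 3)^2 / 3"
        "(sqrt 3 - 1) / 24 / (1 + 8 * ((sqrt 3 - 1) / 24)) = (sqrt 3 - 1)^3 / 16"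
      unfolding s_def[symmetric] a by blast+
  qed
  have v2: "(sqrt 6 - 2) / 36 / (1 + 9 * ((sqrt 6 - 2) / 36)) = (sqrt 6 - 2)^2 / 18"
    "(sqrt 6 - 2) / 36 / (1 + 8 * ((sqrt 6 - 2) / 36)) = (sqrt 6 - 2)^3 / 8"
  proof -
    define s :: real where "s = sqrt 6"
    have s: "s ^ 2 = 6" "s > 0" by (auto simp: s_def)
    have ss: "s * s = 6" "s * (s * y) = 6 * y" for y using s by (simp_all add: power2_eq_square flip: mult.assoc)
    have a: "(s - 2) / 36 / (1 + k * ((s - 2) / 36)) = (s - 2) / (36 + k * (s - 2))" for k :: real
    proof -
      have "1 + k * ((s - 2) / 36) = (36 + k * (s - 2)) / 36" by (simp add: field_simps)
      then show ?thesis by simp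
    qed
    have "(s - 2) / (36 + 9 * (s - 2)) = (s - 2)^2 / 18"
    proof -
      have "36 + 9 * (s - 2) > 0" using s(2) by simp
      moreover have "(s - 2) * 18 = (s - 2) ^ 2 * (36 + 9 * (s - 2))" by (simp add: eval_nat_numeral algebra_simps ss)
      ultimately show ?thesis by (subst frac_eq_eq) auto
    qed
    moreover have "(s - 2) / (36 + 8 * (s - 2)) = (s - 2)^3 / 8"
    proof -
      have "36 + 8 * (s - 2) > 0" using s(2) by simp
      moreover have "(s - 2) * 8 = (s - 2) ^ 3 * (36 + 8 * (s - 2))" by (simp add: eval_nat_numeral algebra_simps ss)
      ultimately show ?thesis by (subst frac_eq_eq) auto
    qed
    ultimately show "(sqrt 6 - 2) / 36 / (1 + 9 * ((sqrt 6 - 2) / 36)) = (sqrt 6 - 2)^2 / 18"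
        "(sqrt 6 - 2) / 36 / (1 + 8 * ((sqrt 6 - 2) / 36)) = (sqrt 6 - 2)^3 / 8"
      unfolding s_def[symmetric] a by blast+
  qed
  show ?thesis
    using rr_frac_integral[OF assms] level5_value[of q] i2 level6_value_6[of q] level6_value_3[of q] level6_value_2[of q]
      i3 i4 f34 v6 v3 v2 i5 level8_value[of q] i6 level9_value[of q]
    by (intro conjI impI) (simp_all only:)
qed

end
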